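(* Let $\sigma:\mathbb{R}^2\to[0,\infty)$ be a continuous, bounded function that is not identically zero. Then there exist a (large) constant $\alpha_0>0$ and a (small) constant $\varepsilon_0>0$ such that, for every $0<\varepsilon<\varepsilon_0$ and every $\alpha>\alpha_0$, the equation $$i\,\partial_t\psi=(-\Delta+|x|^2+|\psi|^2)\psi+i\varepsilon(\sigma(x)-\alpha|\psi|^2)\psi,\qquad (x,t)\in\mathbb{R}^2\times\mathbb{R},$$ has a solitary wave solution $\psi^\varepsilon(x,t)=e^{-it\mu_\varepsilon}Q^\varepsilon(x)$, where $(Q^\varepsilon,\mu_\varepsilon)\in(\Sigma\setminus\{0\})\times(2,\infty)$ solves the stationary equation $$\mu_\varepsilon Q^\varepsilon=(-\Delta+|x|^2+|Q^\varepsilon|^2)Q^\varepsilon+i\varepsilon(\sigma(x)-\alpha|Q^\varepsilon|^2)Q^\varepsilon .$$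
   Context: $\Sigma:=\{u\in H^1(\mathbb{R}^2;\mathbb{C}): xu\in L^2(\mathbb{R}^2)\}$ with norm $\|u\|_\Sigma^2=\|\nabla u\|_{L^2}^2+\|xu\|_{L^2}^2+\|u\|_{L^2}^2$. The stationary equation is understood in the dual space $\Sigma^*$ (weak sense). The functions $Q^\varepsilon$ are complex-valued and $\mu_\varepsilon$ is real. *)

theory Defs
  imports "HOL-Analysis.Analysis"
begin

text \<open>Functions are representatives of almost-everywhere classes. Requiring Borel measurability
  loses nothing, since every Lebesgue measurable function is a.e. equal to a Borel one.\<close>

definition L2 :: "(real ^ 2 \<Rightarrow> complex) set" where
  "L2 = {u. u \<in> borel_measurable lborel \<and> integrable lborel (\<lambda>x. (norm (u x))\<^sup>2)}"

definition locally_integrable :: "(real ^ 2 \<Rightarrow> complex) \<Rightarrow> bool" where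
  "locally_integrable u \<longleftrightarrow>
     u \<in> borel_measurable lborel \<and> (\<forall>K. compact K \<longrightarrow> set_integrable lborel K u)"

fun C_k :: "nat \<Rightarrow> (real ^ 2 \<Rightarrow> complex) \<Rightarrow> bool" where
  "C_k 0 f \<longleftrightarrow> continuous_on UNIV f"
| "C_k (Suc k) f \<longleftrightarrow>
     f differentiable_on UNIV \<and> (\<forall>w. C_k k (\<lambda>x. frechet_derivative f (at x) w))"

definition test_function :: "(real ^ 2 \<Rightarrow> complex) \<Rightarrow> bool" where
  "test_function \<phi> \<longleftrightarrow> (\<forall>k. C_k k \<phi>) \<and> compact (closure {x. \<phi> x \<noteq> 0})"

definition has_weak_partial ::
    "(real ^ 2 \<Rightarrow> complex) \<Rightarrow> 2 \<Rightarrow> (real ^ 2 \<Rightarrow> complex) \<Rightarrow> bool" where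
  "has_weak_partial u j g \<longleftrightarrow>
     locally_integrable u \<and> locally_integrable g \<and>
     (\<forall>\<phi>. test_function \<phi> \<longrightarrow>
        (LINT x|lborel. u x * frechet_derivative \<phi> (at x) (axis j 1))
          = - (LINT x|lborel. g x * \<phi> x))"

text \<open>A weak partial derivative is unique only almost everywhere. The choice below is harmless
  because it is only ever used under an integral.\<close>

definition weak_partial :: "2 \<Rightarrow> (real ^ 2 \<Rightarrow> complex) \<Rightarrow> real ^ 2 \<Rightarrow> complex" where
  "weak_partial j u = (SOME g. has_weak_partial u j g)"

definition H1 :: "(real ^ 2 \<Rightarrow> complex) set" where
  "H1 = {u \<in> L2. \<forall>j. \<exists>g\<in>L2. has_weak_partial u j g}"

definition Sigma_space :: "(real ^ 2 \<Rightarrow> complex) set" where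
  "Sigma_space = {u \<in> H1. (\<lambda>x. norm x *\<^sub>R u x) \<in> L2}"

definition Sigma_norm :: "(real ^ 2 \<Rightarrow> complex) \<Rightarrow> real" where
  "Sigma_norm u = sqrt
     ((\<Sum>j\<in>UNIV. LINT x|lborel. (norm (weak_partial j u x))\<^sup>2)
      + (LINT x|lborel. (norm (norm x *\<^sub>R u x))\<^sup>2)
      + (LINT x|lborel. (norm (u x))\<^sup>2))"

text \<open>Elements of the dual of \<open>Sigma_space\<close> are represented by the conjugate-linear functionals
  they induce; a function \<open>u\<close> is identified with \<open>L2_pairing u\<close>.\<close>

definition L2_pairing :: "(real ^ 2 \<Rightarrow> complex) \<Rightarrow> (real ^ 2 \<Rightarrow> complex) \<Rightarrow> complex" where
  "L2_pairing u v = (LINT x|lborel. u x * cnj (v x))"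

text \<open>The functional \<open>(- \<Delta> + |x|\<^sup>2 + |u|\<^sup>2) u + i \<epsilon> (\<sigma> - \<alpha> |u|\<^sup>2) u\<close>, with the Laplacian integrated by
  parts. For \<open>u\<close>, \<open>v\<close> in \<open>Sigma_space\<close> and bounded measurable \<open>\<sigma>\<close> all integrands are integrable, the
  cubic ones because \<open>H1\<close> embeds into \<open>L\<^sup>4\<close> in dimension two.\<close>

definition GP_functional ::
    "(real ^ 2 \<Rightarrow> real) \<Rightarrow> real \<Rightarrow> real \<Rightarrow>
     (real ^ 2 \<Rightarrow> complex) \<Rightarrow> (real ^ 2 \<Rightarrow> complex) \<Rightarrow> complex" where
  "GP_functional \<sigma> \<epsilon> \<alpha> u v =
     (\<Sum>j\<in>UNIV. L2_pairing (weak_partial j u) (weak_partial j v))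
     + L2_pairing (\<lambda>x. of_real ((norm x)\<^sup>2 + (norm (u x))\<^sup>2) * u x) v
     + \<i> * of_real \<epsilon> * L2_pairing (\<lambda>x. of_real (\<sigma> x - \<alpha> * (norm (u x))\<^sup>2) * u x) v"

definition solves_stationary ::
    "(real ^ 2 \<Rightarrow> real) \<Rightarrow> real \<Rightarrow> real \<Rightarrow> real \<Rightarrow> (real ^ 2 \<Rightarrow> complex) \<Rightarrow> bool" where
  "solves_stationary \<sigma> \<epsilon> \<alpha> \<mu> Q \<longleftrightarrow>
     Q \<in> Sigma_space \<and>
     (\<forall>v\<in>Sigma_space. of_real \<mu> * L2_pairing Q v = GP_functional \<sigma> \<epsilon> \<alpha> Q v)"

text \<open>Convergence of the difference quotients in the dual norm, with the operator norm unfolded.\<close>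

definition has_dual_time_derivative ::
    "(real \<Rightarrow> real ^ 2 \<Rightarrow> complex) \<Rightarrow> ((real ^ 2 \<Rightarrow> complex) \<Rightarrow> complex) \<Rightarrow> real \<Rightarrow> bool" where
  "has_dual_time_derivative \<psi> D t \<longleftrightarrow>
     (\<forall>e>0. \<forall>\<^sub>F h in at 0. \<forall>v\<in>Sigma_space.
        norm ((L2_pairing (\<psi> (t + h)) v - L2_pairing (\<psi> t) v) / of_real h - D v)
          \<le> e * Sigma_norm v)"

definition solves_evolution ::
    "(real ^ 2 \<Rightarrow> real) \<Rightarrow> real \<Rightarrow> real \<Rightarrow> (real \<Rightarrow> real ^ 2 \<Rightarrow> complex) \<Rightarrow> bool" where
  "solves_evolution \<sigma> \<epsilon> \<alpha> \<psi> \<longleftrightarrow>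
     (\<forall>t. \<psi> t \<in> Sigma_space) \<and>
     (\<forall>t. ((\<lambda>s. Sigma_norm (\<lambda>x. \<psi> s x - \<psi> t x)) \<longlongrightarrow> 0) (at t)) \<and>
     (\<forall>t. \<exists>D. has_dual_time_derivative \<psi> D t \<and>
        (\<forall>v\<in>Sigma_space. \<i> * D v = GP_functional \<sigma> \<epsilon> \<alpha> (\<psi> t) v))"

end

theory Submission
  imports Defs "HOL-Probability.Probability"
begin

text \<open>A solitary wave bifurcates from the ground state \<open>\<phi> x = exp (- |x|\<^sup>2 / 2)\<close> of
  \<open>H = - \<Delta> + |x|\<^sup>2\<close>, whose eigenvalue is 2. With \<open>\<delta> = 1 / \<alpha>\<close> and \<open>Q = sqrt (\<delta> \<beta>) U\<close> the equation is
  \<open>(H - 2) U = m U - \<delta> \<beta> |U|\<^sup>2 U - \<i> \<epsilon> (\<sigma> - \<beta> |U|\<^sup>2) U\<close> with \<open>m = \<mu> - 2\<close>, so \<open>\<delta>\<close> and \<open>\<epsilon>\<close> are the two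
  small parameters. Modulo \<open>\<phi>\<close> it is solved by the reduced resolvent of \<open>H\<close> at 2, that is
  by integrating the Mehler kernel in time; this is a contraction in a space of continuous functions
  with Gaussian weight. The component along \<open>\<phi>\<close> is a complex number: its real part is removed by the
  choice of \<open>m\<close>. Pairing the equation with \<open>U\<close>, the imaginary part vanishes once \<open>\<beta>\<close> is the quotient
  of \<open>\<integral> \<sigma> |U|\<^sup>2\<close> and \<open>\<integral> |U|\<^sup>4\<close>, which is the mass balance between gain and loss. Finally
  \<open>\<mu> > 2\<close> because \<open>H \<ge> 2\<close> and the nonlinearity is repulsive.\<close>

section \<open>Smooth functions and cut-offs\<close>

text \<open>Gain and loss can balance only where \<open>\<alpha> |Q|^2\<close> is comparable to
  \<sigma>, so large \<alpha> forces a small amplitude and makes the cubic term a perturbation. The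
  parameter \<beta> is not solved for: it is recomputed from each profile along the iteration.

  The unknown is h with U = exp (-|x|^2 / 4) h. Relative to this weight the sup norm controls all
  powers of U, so Sobolev embeddings and compactness do not enter. The exponent is half of that of
  \<phi>: the rotation of (x, z) lets the heat flow preserve the weight uniformly in time and still
  leaves a Gaussian in z to integrate.

  That the time integral inverts H - 2 up to the projection is proved weakly instead of by spectral
  theory. At fixed time the derivatives of the dual element are moved onto the smooth kernel, the
  heat equation turns the result into an angular derivative, and its integral is the difference
  between the limit \<theta> = \<pi>/2, where the flow returns its datum, and \<theta> = 0, where
  only the projection is left.\<close>

lemma C_k_imp_continuous: "C_k k f \<Longrightarrow> continuous_on UNIV f"
  by (cases k) (auto intro: differentiable_imp_continuous_on)

lemma C_k_Suc_imp: "C_k (Suc k) f \<Longrightarrow> C_k k f"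
proof (induction k arbitrary: f)
  case 0
  then show ?case using C_k_imp_continuous by (metis C_k.simps(1))
next
  case (Suc k)
  then show ?case by (metis C_k.simps(2))
qed

lemma C_k_differentiable: "C_k (Suc k) f \<Longrightarrow> f differentiable (at x)"
  by (simp add: differentiable_on_def)

lemma C_k_SucI:
  assumes "\<And>x. (f has_derivative f' x) (at x)" and "\<And>w. C_k k (\<lambda>x. f' x w)"
  shows "C_k (Suc k) f"
proof -
  have "frechet_derivative f (at x) = f' x" for x
    using assms(1) frechet_derivative_at by metis
  then show ?thesis
    using assms by (auto simp: differentiable_on_def differentiable_def)
qed

lemma C_k_has_derivative:
  "C_k (Suc k) f \<Longrightarrow> (f has_derivative frechet_derivative f (at x)) (at x)"
  using C_k_differentiable frechet_derivative_works by blast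

lemma C_k_const: "C_k k (\<lambda>x. c)"
proof (induction k arbitrary: c)
  case (Suc k)
  then show ?case by (intro C_k_SucI[where f' = "\<lambda>x h. 0"]) auto
qed simp

lemma C_k_add: "C_k k f \<Longrightarrow> C_k k g \<Longrightarrow> C_k k (\<lambda>x. f x + g x)"
proof (induction k arbitrary: f g)
  case 0
  then show ?case by (auto intro: continuous_on_add)
next
  case (Suc k)
  show ?case
  proof (rule C_k_SucI[OF has_derivative_add])
    show "(f has_derivative frechet_derivative f (at x)) (at x)"
      and "(g has_derivative frechet_derivative g (at x)) (at x)" for x
      using Suc.prems by (auto intro: C_k_has_derivative simp del: C_k.simps)
    show "C_k k (\<lambda>x. frechet_derivative f (at x) w + frechet_derivative g (at x) w)" for w
      using Suc.prems by (intro Suc.IH) auto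
  qed
qed

lemma C_k_mult: "C_k k f \<Longrightarrow> C_k k g \<Longrightarrow> C_k k (\<lambda>x. f x * g x)"
proof (induction k arbitrary: f g)
  case 0
  then show ?case by (auto intro: continuous_on_mult)
next
  case (Suc k)
  have fg: "C_k k f" "C_k k g" using Suc.prems C_k_Suc_imp by auto
  show ?case
  proof (rule C_k_SucI[OF has_derivative_mult])
    show "(f has_derivative frechet_derivative f (at x)) (at x)"
      and "(g has_derivative frechet_derivative g (at x)) (at x)" for x
      using Suc.prems by (auto intro: C_k_has_derivative simp del: C_k.simps)
    show "C_k k (\<lambda>x. f x * frechet_derivative g (at x) w + frechet_derivative f (at x) w * g x)" for w
      using Suc.prems fg by (intro C_k_add Suc.IH) auto
  qed
qed

lemma C_k_uminus: "C_k k f \<Longrightarrow> C_k k (\<lambda>x. - f x)"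
  using C_k_mult[OF C_k_const[of k "-1"], of f] by simp

lemma C_k_diff: "C_k k f \<Longrightarrow> C_k k g \<Longrightarrow> C_k k (\<lambda>x. f x - g x)"
  using C_k_add[OF _ C_k_uminus, of k f g] by simp

text \<open>A directional derivative of \<open>f (x $ i)\<close> is a constant multiple of
  \<open>f' (x $ i)\<close> with f' in the same family, so the induction on k never leaves
  S.\<close>

lemma C_k_of_closed_family:
  assumes S: "\<And>f. f \<in> S \<Longrightarrow> \<exists>f'\<in>S. \<forall>x. (f has_real_derivative f' x) (at x)"
    and "f \<in> S"
  shows "C_k k (\<lambda>x. of_real (f (x $ i)))"
  using \<open>f \<in> S\<close>
proof (induction k arbitrary: f)
  case 0
  obtain f' where "\<And>x. (f has_real_derivative f' x) (at x)" using S[OF 0] by blast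
  then have "continuous_on UNIV f"
    by (meson DERIV_isCont continuous_at_imp_continuous_on)
  then show ?case
    by (auto intro!: continuous_intros intro: continuous_on_compose2[of UNIV f])
next
  case (Suc k)
  obtain f' where f': "f' \<in> S" "\<And>x. (f has_real_derivative f' x) (at x)" using S[OF Suc.prems] by blast
  show ?case
  proof (rule C_k_SucI)
    show "((\<lambda>x. complex_of_real (f (x $ i))) has_derivative
        (\<lambda>h. of_real (f' (x $ i)) * of_real (h $ i))) (at x)" for x :: "real^2"
    proof -
      have "((\<lambda>x::real^2. f (x $ i)) has_derivative (\<lambda>h. f' (x $ i) * (h $ i))) (at x)"
        using has_derivative_compose[of "\<lambda>x::real^2. x $ i" "\<lambda>h. h $ i" x UNIV f "\<lambda>h. f' (x$i) * h"]
          f'(2)[of "x $ i"]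
        by (auto simp: has_field_derivative_def bounded_linear_imp_has_derivative bounded_linear_vec_nth)
      from has_derivative_of_real[OF this] show ?thesis by simp
    qed
    show "C_k k (\<lambda>x. complex_of_real (f' (x $ i)) * of_real (w $ i))" for w :: "real^2"
      by (intro C_k_mult C_k_const Suc.IH f')
  qed
qed

text \<open>The family \<open>p (1/s) exp (-1/s)\<close>, \<open>s = c x + d\<close>, extended by 0 to \<open>s \<le> 0\<close>, is closed under
  differentiation, which makes all its members smooth.\<close>

definition flat_exp :: "real poly \<Rightarrow> real \<Rightarrow> real \<Rightarrow> real \<Rightarrow> real" where
  "flat_exp p c d x = (if c * x + d > 0 then poly p (1 / (c * x + d)) * exp (- (1 / (c * x + d))) else 0)"

lemma poly_times_exp_tendsto_0: "((\<lambda>y. poly p y * exp (- y)) \<longlongrightarrow> (0::real)) at_top"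
proof -
  have eq: "(\<lambda>y. poly p y * exp (- y)) = (\<lambda>y. \<Sum>i\<le>degree p. coeff p i * (y ^ i / exp y))"
    by (simp add: poly_altdef sum_distrib_left exp_minus divide_inverse mult_ac)
  have "((\<lambda>y. \<Sum>i\<le>degree p. coeff p i * (y ^ i / exp y)) \<longlongrightarrow> (\<Sum>i\<le>degree p. coeff p i * 0)) at_top"
    by (intro tendsto_sum tendsto_mult tendsto_const tendsto_power_div_exp_0)
  then show ?thesis by (simp add: eq)
qed

text \<open>From the right the difference quotient is y p(y) exp (-y) with y = 1 / h: dividing by h
  only raises the degree of the polynomial.\<close>

lemma flat_exp_base_deriv_0:
  "((\<lambda>h. (if h > 0 then poly p (1 / h) * exp (- (1 / h)) else 0)) has_real_derivative 0) (at 0)"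
proof -
  let ?g = "\<lambda>h::real. (if h > 0 then poly p (1 / h) * exp (- (1 / h)) else 0)"
  have R: "((\<lambda>h. ?g h / h) \<longlongrightarrow> 0) (at_right 0)"
  proof -
    have "((\<lambda>y. poly (pCons 0 p) y * exp (- y)) \<longlongrightarrow> (0::real)) at_top"
      by (rule poly_times_exp_tendsto_0)
    then have "((\<lambda>h. poly (pCons 0 p) (inverse h) * exp (- inverse h)) \<longlongrightarrow> (0::real)) (at_right 0)"
      by (rule filterlim_compose[OF _ filterlim_inverse_at_top_right])
    moreover have "eventually (\<lambda>h. poly (pCons 0 p) (inverse h) * exp (- inverse h) = ?g h / h) (at_right 0)"
      using eventually_at_right_less[of 0] by eventually_elim (simp add: field_simps)
    ultimately show ?thesis using tendsto_cong by fast
  qed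
  have L: "((\<lambda>h. ?g h / h) \<longlongrightarrow> 0) (at_left 0)"
  proof (rule tendsto_eventually)
    show "eventually (\<lambda>h. ?g h / h = 0) (at_left 0)"
      using eventually_at_left_real[of "-1" 0] by (auto elim: eventually_mono)
  qed
  show ?thesis
    using L R unfolding DERIV_def filterlim_at_split by (simp only: add_0) simp
qed

text \<open>With y = 1 / s one has dy/ds = - y^2, so p(y) exp (-y) becomes y^2 (p - p')(y) exp (-y).
  Here \<open>[:0,0,1:]\<close> is y^2 and c is the inner derivative.\<close>

lemma flat_exp_deriv:
  "(flat_exp p c d has_real_derivative flat_exp (smult c ([:0,0,1:] * (p - pderiv p))) c d x) (at x)"
proof -
  let ?g = "\<lambda>p h::real. (if h > 0 then poly p (1 / h) * exp (- (1 / h)) else 0)"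
  let ?D = "[:0,0,1:] * (p - pderiv p)"
  have base: "(?g p has_real_derivative ?g ?D h) (at h)" for h
  proof (cases h "0::real" rule: linorder_cases)
    case less
    have "((\<lambda>h. 0) has_real_derivative 0) (at h)" by simp
    moreover have "eventually (\<lambda>h. 0 = ?g p h) (nhds h)"
      using eventually_nhds_in_open[of "{..<0}" h] less by (auto elim: eventually_mono)
    ultimately show ?thesis using less DERIV_cong_ev[OF refl, of "\<lambda>h. 0" "?g p" h 0 0] by auto
  next
    case equal
    then show ?thesis using flat_exp_base_deriv_0[of p] by simp
  next
    case greater
    have "((\<lambda>h. poly p (1/h) * exp (- (1/h))) has_real_derivative
        (poly (pderiv p) (1/h) * (- 1 / h^2)) * exp (-(1/h)) + exp (-(1/h)) * (1/h^2) * poly p (1/h)) (at h)"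
      using greater
      by (auto intro!: derivative_eq_intros DERIV_chain2[OF poly_DERIV] simp: power2_eq_square field_simps)
    moreover have "eventually (\<lambda>h. poly p (1/h) * exp (- (1/h)) = ?g p h) (nhds h)"
      using eventually_nhds_in_open[of "{0<..}" h] greater by (auto elim: eventually_mono)
    moreover have "(poly (pderiv p) (1/h) * (- 1 / h^2)) * exp (-(1/h)) + exp (-(1/h)) * (1/h^2) * poly p (1/h) = ?g ?D h"
      using greater by (simp add: field_simps power2_eq_square)
    ultimately show ?thesis by (rule DERIV_cong_ev[OF refl, THEN iffD1, rotated 2])
  qed
  have "((\<lambda>x. ?g p (c * x + d)) has_real_derivative ?g ?D (c*x+d) * c) (at x)"
    by (rule DERIV_chain2[OF base]) (auto intro!: derivative_eq_intros)
  then show ?thesis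
    by (simp add: flat_exp_def[abs_def] mult_ac cong: if_cong) (auto simp: algebra_simps)
qed

lemma C_k_flat_exp: "C_k k (\<lambda>x. of_real (flat_exp p c d (x $ i)))"
  by (rule C_k_of_closed_family[where S = "{flat_exp p c d |p. True}"]) (use flat_exp_deriv in blast)+

text \<open>A second family closed under differentiation. Expanding the square in the Mehler kernel
  splits it into such factors, one for each coordinate of x.\<close>

definition poly_gauss :: "real poly \<Rightarrow> real \<Rightarrow> real \<Rightarrow> real \<Rightarrow> real" where
  "poly_gauss p A B x = poly p x * exp (B * x - A * x\<^sup>2)"

lemma poly_gauss_deriv:
  "(poly_gauss p A B has_real_derivative poly_gauss (pderiv p + [:B, -2 * A:] * p) A B x) (at x)"
  unfolding poly_gauss_def[abs_def]
  by (auto intro!: derivative_eq_intros poly_DERIV simp: algebra_simps)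

lemma C_k_poly_gauss: "C_k k (\<lambda>x. of_real (poly_gauss p A B (x $ i)))"
  by (rule C_k_of_closed_family[where S = "{poly_gauss p A B |p. True}"]) (use poly_gauss_deriv in blast)+

lemma C_k_nth: "C_k k (\<lambda>x. of_real (x $ i))"
  using C_k_poly_gauss[of k "[:0,1:]" 0 0 i] by (simp add: poly_gauss_def)


lemma C_k_prod: "finite I \<Longrightarrow> (\<And>i. i \<in> I \<Longrightarrow> C_k k (f i)) \<Longrightarrow> C_k k (\<lambda>x. \<Prod>i\<in>I. f i x)"
  by (induction I rule: finite_induct) (auto intro: C_k_const C_k_mult)

lemma flat_exp_nonneg: "0 \<le> flat_exp 1 c d x" and flat_exp_le_1: "flat_exp 1 c d x \<le> 1"
  by (auto simp: flat_exp_def)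

text \<open>The parameters c and d only reparametrize y = 1 / (c x + d) > 0, so one bound for p(y)
  exp (-y) on the half line serves all scalings.\<close>

lemma flat_exp_bounded: "\<exists>C>0. \<forall>c d x. \<bar>flat_exp p c d x\<bar> \<le> C"
proof -
  have "((\<lambda>y. norm (poly p y * exp (- y))) \<longlongrightarrow> 0) at_top"
    using poly_times_exp_tendsto_0 tendsto_norm_zero by blast
  then have "eventually (\<lambda>y. norm (poly p y * exp (- y)) < 1) at_top"
    by (rule order_tendstoD) simp
  then obtain Y where Y: "\<And>y. y \<ge> Y \<Longrightarrow> norm (poly p y * exp (- y)) < 1"
    by (auto simp: eventually_at_top_linorder)
  have "compact ((\<lambda>y. poly p y * exp (- y)) ` {0..max 0 Y})"
    by (intro compact_continuous_image continuous_intros) auto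
  then obtain B where "\<forall>v \<in> (\<lambda>y. poly p y * exp (- y)) ` {0..max 0 Y}. norm v \<le> B"
    using compact_imp_bounded bounded_iff by blast
  then have B: "\<And>y. y \<in> {0..max 0 Y} \<Longrightarrow> norm (poly p y * exp (- y)) \<le> B"
    by blast
  have "norm (poly p y * exp (- y)) \<le> max 1 B" if "y \<ge> 0" for y
    using that Y[of y] B[of y] by (cases "y \<ge> Y") (auto simp: max_def)
  then have "\<bar>flat_exp p c d x\<bar> \<le> max 1 B" for c d x
    by (auto simp: flat_exp_def)
  then show ?thesis by (intro exI[of _ "max 1 B"]) auto
qed

section \<open>Test functions: bumps on boxes and cut-offs\<close>

lemma test_functionI:
  assumes "\<And>k. C_k k f" "\<And>x. f x \<noteq> 0 \<Longrightarrow> x \<in> cbox l u"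
  shows "test_function f"
proof -
  have "closure {x. f x \<noteq> 0} \<subseteq> cbox l u"
    using assms(2) by (intro closure_minimal) auto
  then show ?thesis
    using assms(1) bounded_subset[OF bounded_cbox]
    by (auto simp: test_function_def compact_eq_bounded_closed)
qed

lemma test_function_supp:
  assumes "test_function f"
  obtains B where "B > 0" "\<And>x. norm x > B \<Longrightarrow> f x = 0"
proof -
  have "bounded {x. f x \<noteq> 0}"
    using assms bounded_subset[OF compact_imp_bounded closure_subset] by (auto simp: test_function_def)
  then obtain B where "B > 0" "\<And>x. f x \<noteq> 0 \<Longrightarrow> norm x \<le> B"
    by (auto simp: bounded_pos)
  then show ?thesis by (intro that[of B]) force+
qed

lemma test_function_mult:
  assumes "test_function f" "\<And>k. C_k k g"
  shows "test_function (\<lambda>x. f x * g x)"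
proof -
  have "bounded (closure {x. f x \<noteq> 0})"
    using assms(1) by (simp add: test_function_def compact_imp_bounded)
  then have "bounded {x. f x * g x \<noteq> 0}"
    by (rule bounded_subset) (use closure_subset[of "{x. f x \<noteq> 0}"] in auto)
  then have "compact (closure {x. f x * g x \<noteq> 0})"
    by (simp add: compact_closure)
  then show ?thesis using assms by (auto simp: test_function_def intro: C_k_mult)
qed

lemma test_function_has_derivative:
  "test_function f \<Longrightarrow> (f has_derivative frechet_derivative f (at x)) (at x)"
  unfolding test_function_def using C_k_has_derivative by blast

lemma frechet_derivative_eqI: "(f has_derivative f') (at x) \<Longrightarrow> frechet_derivative f (at x) = f'"
  using frechet_derivative_at by metis

text \<open>A factor exp (-1 / (n s)) vanishes for s \<le> 0 and tends to 1 for s > 0, so large n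
  approximates the indicator of the open box without enlarging the support.\<close>

definition box_bump :: "real^2 \<Rightarrow> real^2 \<Rightarrow> real \<Rightarrow> real^2 \<Rightarrow> complex" where
  "box_bump l u n x = (\<Prod>i\<in>UNIV. of_real (flat_exp 1 n (- n * l $ i) (x $ i)) * of_real (flat_exp 1 (- n) (n * u $ i) (x $ i)))"

lemma box_bump_supp:
  assumes "n > 0" "box_bump l u n x \<noteq> 0"
  shows "x \<in> cbox l u"
proof -
  have "n * x $ i - n * l $ i > 0" "- n * x $ i + n * u $ i > 0" for i
    using assms by (auto simp: box_bump_def flat_exp_def split: if_splits)
  then have "n * (x $ i - l $ i) > 0" "n * (u $ i - x $ i) > 0" for i by (simp_all add: algebra_simps)
  then show "x \<in> cbox l u"
    using \<open>n > 0\<close> by (auto simp: mem_box_cart zero_less_mult_iff intro: less_imp_le)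
qed

lemma box_bump_test: "n > 0 \<Longrightarrow> test_function (box_bump l u n)"
proof (rule test_functionI[OF _ box_bump_supp])
  show "C_k k (box_bump l u n)" for k
    unfolding box_bump_def[abs_def] by (intro C_k_prod C_k_mult C_k_flat_exp) auto
qed

lemma box_bump_norm_le: "norm (box_bump l u n x) \<le> 1"
  unfolding box_bump_def prod_norm[symmetric]
proof (rule prod_le_1)
  fix i
  have "\<bar>flat_exp 1 n (- n * l $ i) (x $ i)\<bar> * \<bar>flat_exp 1 (- n) (n * u $ i) (x $ i)\<bar> \<le> 1"
    by (intro mult_le_one) (simp_all add: flat_exp_nonneg flat_exp_le_1)
  then show "0 \<le> norm (complex_of_real (flat_exp 1 n (- n * l $ i) (x $ i)) * complex_of_real (flat_exp 1 (- n) (n * u $ i) (x $ i))) \<and>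
         norm (complex_of_real (flat_exp 1 n (- n * l $ i) (x $ i)) * complex_of_real (flat_exp 1 (- n) (n * u $ i) (x $ i))) \<le> 1"
    by (simp add: norm_mult)
qed

lemma flat_exp_tendsto_1:
  "(\<lambda>n. flat_exp 1 (real (Suc n) * a) (real (Suc n) * b) x) \<longlonglongrightarrow> (if a * x + b > 0 then 1 else 0)"
proof (cases "a * x + b > 0")
  case True
  have eq: "flat_exp 1 (real (Suc n) * a) (real (Suc n) * b) x = exp (- (1 / (real (Suc n) * (a * x + b))))" for n
  proof -
    have "real (Suc n) * (a * x + b) > 0" using True by (intro mult_pos_pos) auto
    moreover have "real (Suc n) * (a * x + b) = real (Suc n) * a * x + real (Suc n) * b" by (simp add: algebra_simps)
    ultimately show ?thesis by (simp add: flat_exp_def del: of_nat_Suc)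
  qed
  have "(\<lambda>n. exp (- (inverse (real (Suc n)) * (1 / (a * x + b))))) \<longlonglongrightarrow> exp (- (0 * (1 / (a * x + b))))"
    by (intro tendsto_exp tendsto_minus tendsto_mult tendsto_const LIMSEQ_inverse_real_of_nat)
  then show ?thesis using True by (simp only: eq if_True) (simp add: divide_inverse)
next
  case False
  have "\<not> (real (Suc n) * a * x + real (Suc n) * b > 0)" for n
  proof -
    have "real (Suc n) * (a * x + b) \<le> 0" using False by (intro mult_nonneg_nonpos) auto
    then show ?thesis by (simp add: algebra_simps)
  qed
  then show ?thesis using False by (simp add: flat_exp_def del: of_nat_Suc)
qed

lemma box_bump_tendsto: "(\<lambda>n. box_bump l u (real (Suc n)) x) \<longlonglongrightarrow> indicator (box l u) x"
proof -
  have "(\<lambda>n. box_bump l u (real (Suc n)) x) \<longlonglongrightarrow>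
     (\<Prod>i\<in>UNIV. of_real (if 1 * x $ i + (- l $ i) > 0 then 1 else 0) * of_real (if (-1) * x $ i + u $ i > 0 then 1 else 0))"
    unfolding box_bump_def
  proof (intro tendsto_prod tendsto_mult tendsto_of_real)
    fix i
    show "(\<lambda>n. flat_exp 1 (real (Suc n)) (- real (Suc n) * l $ i) (x $ i)) \<longlonglongrightarrow> (if 1 * x $ i + (- l $ i) > 0 then 1 else 0)"
      using flat_exp_tendsto_1[of 1 "- l $ i" "x $ i"] by (simp only: mult_1_right mult_minus_left mult_minus_right)
    show "(\<lambda>n. flat_exp 1 (- real (Suc n)) (real (Suc n) * u $ i) (x $ i)) \<longlonglongrightarrow> (if (-1) * x $ i + u $ i > 0 then 1 else 0)"
      using flat_exp_tendsto_1[of "-1" "u $ i" "x $ i"] by (simp only: mult_1_right mult_minus_left mult_minus_right)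
  qed
  also have "(\<Prod>i\<in>UNIV. of_real (if 1 * x $ i + (- l $ i) > 0 then 1 else 0) * of_real (if (-1) * x $ i + u $ i > 0 then 1 else 0))
      = (indicator (box l u) x :: complex)"
    by (auto simp: indicator_def mem_box_cart intro!: prod.neutral)
  finally show ?thesis .
qed

text \<open>Supported in the square of half side R. Each of the four factors tends to exp (-1) for
  large R, so the limit is exp (-4) and not 1; this constant is divided out in
  \<open>weak_partial_IBP\<close>.\<close>

definition cutoff :: "real \<Rightarrow> real^2 \<Rightarrow> complex" where
  "cutoff R x = (of_real (flat_exp 1 (1/R) 1 (x $ 1)) * of_real (flat_exp 1 (-1/R) 1 (x $ 1)))
     * (of_real (flat_exp 1 (1/R) 1 (x $ 2)) * of_real (flat_exp 1 (-1/R) 1 (x $ 2)))"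

lemma cutoff_test: "R > 0 \<Longrightarrow> test_function (cutoff R)"
proof (rule test_functionI)
  show "C_k k (cutoff R)" for k
    unfolding cutoff_def[abs_def] by (intro C_k_mult C_k_flat_exp)
  fix x assume "R > 0" "cutoff R x \<noteq> 0"
  then have "- R \<le> x $ i \<and> x $ i \<le> R" if "i = 1 \<or> i = 2" for i
    using that by (auto simp: cutoff_def flat_exp_def field_simps split: if_splits)
  then show "x \<in> cbox (\<chi> i. - R) (\<chi> i. R)" by (simp add: mem_box_cart exhaust_2)
qed

lemma cutoff_norm_le: "norm (cutoff R x) \<le> 1"
  unfolding cutoff_def norm_mult norm_of_real by (intro mult_le_one) (simp_all add: flat_exp_nonneg flat_exp_le_1)

lemma cutoff_tendsto: "(\<lambda>n. cutoff (real (Suc n)) x) \<longlonglongrightarrow> of_real (exp (- 4))"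
proof -
  have "(\<lambda>n. flat_exp 1 (c / real (Suc n)) 1 s) \<longlonglongrightarrow> exp (-1)" for c s
  proof -
    have lim: "(\<lambda>n. c * inverse (real (Suc n)) * s + 1) \<longlonglongrightarrow> c * 0 * s + 1"
      by (intro tendsto_intros LIMSEQ_inverse_real_of_nat)
    then have "eventually (\<lambda>n. c * inverse (real (Suc n)) * s + 1 > 0) sequentially"
      by (rule order_tendstoD) simp
    then have "eventually (\<lambda>n. exp (- (1 / (c * inverse (real (Suc n)) * s + 1))) = flat_exp 1 (c / real (Suc n)) 1 s) sequentially"
      by eventually_elim (simp add: flat_exp_def divide_inverse)
    moreover have "(\<lambda>n. exp (- (1 / (c * inverse (real (Suc n)) * s + 1)))) \<longlonglongrightarrow> exp (- (1 / (c * 0 * s + 1)))"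
      using lim by (intro tendsto_intros lim) auto
    ultimately show ?thesis by (auto dest: Lim_transform_eventually)
  qed
  note e = this[of 1] this[of "-1"]
  have "(\<lambda>n. cutoff (real (Suc n)) x) \<longlonglongrightarrow>
     (of_real (exp (-1)) * of_real (exp (-1))) * (of_real (exp (-1)) * of_real (exp (-1)))"
    unfolding cutoff_def by (intro tendsto_mult tendsto_of_real e)
  also have "(complex_of_real (exp (-1)) * of_real (exp (-1))) * (of_real (exp (-1)) * of_real (exp (-1))) = of_real (exp (-4))"
    by (simp flip: of_real_mult exp_add)
  finally show ?thesis .
qed

text \<open>The inner derivative of s / R + 1 supplies the factor 1 / R, and the remaining factors
  are bounded independently of the scaling.\<close>

lemma cutoff_deriv_bound:
  obtains C where "\<And>R x j. R > 0 \<Longrightarrow> norm (frechet_derivative (cutoff R) (at x) (axis j 1)) \<le> C / R"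
proof -
  define q :: "real poly" where "q = [:0,0,1:] * (1 - pderiv 1)"
  obtain B where B: "\<And>c d x. \<bar>flat_exp q c d x\<bar> \<le> B" "B > 0"
    using flat_exp_bounded by blast
  define t where "t R s = flat_exp 1 (1/R) 1 s * flat_exp 1 (-1/R) 1 s" for R s
  define t' where "t' R s = flat_exp (smult (1/R) q) (1/R) 1 s * flat_exp 1 (-1/R) 1 s
     + flat_exp (smult (-1/R) q) (-1/R) 1 s * flat_exp 1 (1/R) 1 s" for R s
  have D: "(t R has_real_derivative t' R s) (at s)" for R s
    unfolding t_def[abs_def] t'_def q_def by (intro DERIV_mult flat_exp_deriv)
  have smult: "flat_exp (smult c p) a d s = c * flat_exp p a d s" for c p a d s
    by (simp add: flat_exp_def)
  have t_le: "\<bar>t R s\<bar> \<le> 1" for R s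
    by (auto simp: t_def abs_mult flat_exp_nonneg flat_exp_le_1 intro!: mult_le_one)
  have t'_le: "\<bar>t' R s\<bar> \<le> 2 * B / R" if "R > 0" for R s
  proof -
    have "\<bar>flat_exp q (c/R) 1 s * flat_exp 1 (c'/R) 1 s\<bar> \<le> B * 1" for c c'
      unfolding abs_mult using B by (intro mult_mono) (auto simp: flat_exp_nonneg flat_exp_le_1)
    from this[of 1 "-1"] this[of "-1" 1] 
    have "\<bar>(1/R) * (flat_exp q (1/R) 1 s * flat_exp 1 (-1/R) 1 s) + (-1/R) * (flat_exp q (-1/R) 1 s * flat_exp 1 (1/R) 1 s)\<bar> \<le> (1/R) * B + (1/R) * B"
      using that by (intro order_trans[OF abs_triangle_ineq] add_mono) (auto simp: abs_mult divide_simps)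
    then show ?thesis unfolding t'_def smult by (simp add: mult_ac)
  qed
  have cut: "cutoff R = (\<lambda>x. complex_of_real (t R (x $ 1) * t R (x $ 2)))" for R
    by (auto simp: cutoff_def t_def)
  have nth: "((\<lambda>x::real^2. t R (x $ i)) has_derivative (\<lambda>h. t' R (x $ i) * (h $ i))) (at x)" for R i x
    using has_derivative_compose[of "\<lambda>x::real^2. x $ i" "\<lambda>h. h $ i" x UNIV "t R" "\<lambda>h. t' R (x$i) * h"]
      D[of R "x $ i"]
    by (auto simp: has_field_derivative_def bounded_linear_imp_has_derivative bounded_linear_vec_nth)
  have d: "(cutoff R has_derivative (\<lambda>h. of_real (t R (x $ 1) * (t' R (x $ 2) * h $ 2) + t' R (x $ 1) * h $ 1 * t R (x $ 2)))) (at x)" for R x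
    unfolding cut by (intro has_derivative_of_real has_derivative_mult nth)
  show ?thesis
  proof (rule that[of "4 * B"])
    fix R and x :: "real^2" and j :: 2 assume "(R::real) > 0"
    have 1: "\<bar>t' R (x $ i) * axis j 1 $ k\<bar> \<le> 2 * B / R" for i k
      using t'_le[OF \<open>R > 0\<close>, of "x $ i"] B \<open>R > 0\<close> by (auto simp: axis_def)
    have "\<bar>t R (x $ 1)\<bar> * \<bar>t' R (x $ 2) * axis j 1 $ 2\<bar> + \<bar>t' R (x $ 1) * axis j 1 $ 1\<bar> * \<bar>t R (x $ 2)\<bar>
       \<le> 1 * (2 * B / R) + (2 * B / R) * 1"
      using B \<open>R > 0\<close> by (intro add_mono mult_mono 1 t_le) auto
    then have "\<bar>t R (x $ 1) * (t' R (x $ 2) * axis j 1 $ 2) + t' R (x $ 1) * axis j 1 $ 1 * t R (x $ 2)\<bar> \<le> 4 * B / R"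
      using abs_triangle_ineq[of "t R (x $ 1) * (t' R (x $ 2) * axis j 1 $ 2)" "t' R (x $ 1) * axis j 1 $ 1 * t R (x $ 2)"]
      by (simp add: abs_mult)
    then show "norm (frechet_derivative (cutoff R) (at x) (axis j 1)) \<le> 4 * B / R"
      unfolding frechet_derivative_eqI[OF d] norm_of_real by simp
  qed
qed

section \<open>Weak partial derivatives\<close>

lemma test_function_deriv_continuous:
  "test_function f \<Longrightarrow> continuous_on UNIV (\<lambda>x. frechet_derivative f (at x) w)"
  using C_k.simps(1) C_k.simps(2)[of 0 f] unfolding test_function_def by blast

lemma test_function_continuous: "test_function f \<Longrightarrow> continuous_on UNIV f"
  using C_k.simps(1) unfolding test_function_def by blast

lemma vanishing_continuous_bounded:
  fixes f :: "real^2 \<Rightarrow> complex"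
  assumes "continuous_on UNIV f" "\<And>x. norm x > B \<Longrightarrow> f x = 0"
  shows "\<exists>M\<ge>0. \<forall>x. norm (f x) \<le> M"
proof -
  have "compact (f ` cball 0 B)"
    using assms(1) by (intro compact_continuous_image) (auto intro: continuous_on_subset)
  then obtain M where "\<forall>v\<in>f ` cball 0 B. norm v \<le> M" using compact_imp_bounded bounded_iff by blast
  then have "norm (f x) \<le> max 0 M" for x
    using assms(2)[of x] \<open>\<forall>v\<in>f ` cball 0 B. norm v \<le> M\<close>
    by (cases "norm x \<le> B") (auto simp: image_iff le_max_iff_disj)
  then show ?thesis by (intro exI[of _ "max 0 M"]) auto
qed

lemma test_function_deriv_supp:
  assumes "test_function f" "\<And>x. norm x > B \<Longrightarrow> f x = 0" "norm x > B"
  shows "frechet_derivative f (at x) w = 0"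
proof -
  have "eventually (\<lambda>y. norm y > B) (nhds x)"
    using assms(3) by (intro eventually_nhds_in_open[of "{y. norm y > B}" x, simplified] open_Collect_less continuous_intros) auto
  then have "eventually (\<lambda>y. (\<lambda>x. 0) y = f y) (nhds x)"
    by eventually_elim (simp add: assms(2))
  then have "(f has_derivative (\<lambda>h. 0)) (at x)"
    using assms by (intro has_derivative_transform_eventually[of "\<lambda>x. 0" "\<lambda>h. 0" x UNIV f])
      (auto simp: eventually_at_filter elim: eventually_mono)
  then show ?thesis by (simp add: frechet_derivative_eqI)
qed

text \<open>By translation invariance the integrals of all difference quotients vanish.\<close>

lemma integral_axis_derivative_test_function:
  assumes f: "test_function f"
  shows "(LINT x|lborel. frechet_derivative f (at x) (axis j 1)) = 0"
proof -
  obtain B where B: "B > 0" "\<And>x. norm x > B \<Longrightarrow> f x = 0" using test_function_supp[OF f] by metis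
  let ?w = "axis j 1 :: real^2"
  have nw: "norm ?w = 1" by (simp add: norm_axis_1)
  obtain M where M: "M \<ge> 0" "\<And>x. norm (frechet_derivative f (at x) ?w) \<le> M"
    using vanishing_continuous_bounded[OF test_function_deriv_continuous[OF f]] test_function_deriv_supp[OF f B(2)]
    by metis
  have [measurable]: "f \<in> borel_measurable borel"
    using test_function_continuous[OF f] by (rule borel_measurable_continuous_onI)
  have [measurable]: "(\<lambda>x. frechet_derivative f (at x) ?w) \<in> borel_measurable borel"
    using test_function_deriv_continuous[OF f] by (rule borel_measurable_continuous_onI)
  define h where "h n = inverse (real (Suc n))" for n
  have h: "h n > 0" "h n \<le> 1" for n by (auto simp: h_def field_simps)
  define s where "s n x = (f (x + h n *\<^sub>R ?w) - f x) /\<^sub>R h n" for n x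
  have int_f: "integrable lborel f"
  proof -
    have "integrable lborel (\<lambda>x. indicator (cball 0 B) x *\<^sub>R f x)"
      by (intro borel_integrable_compact) (use test_function_continuous[OF f] in \<open>auto intro: continuous_on_subset\<close>)
    also have "(\<lambda>x. indicator (cball 0 B) x *\<^sub>R f x) = f"
      using B(2) by (auto simp: indicator_def not_le)
    finally show ?thesis .
  qed
  have int0: "(LINT x|lborel. s n x) = 0" for n
  proof -
    have eq: "lborel = distr lborel borel ((+) (h n *\<^sub>R ?w))" by (rule lborel_distr_plus[symmetric])
    have "integrable (distr lborel borel ((+) (h n *\<^sub>R ?w))) f" using int_f eq by metis
    then have i: "integrable lborel (\<lambda>x. f (x + h n *\<^sub>R ?w))"
      by (simp add: integrable_distr_eq add.commute)
    have "(LINT x|lborel. f x) = (LINT x|distr lborel borel ((+) (h n *\<^sub>R ?w)). f x)" using eq by metis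
    also have "\<dots> = (LINT x|lborel. f (x + h n *\<^sub>R ?w))"
      by (simp add: integral_distr add.commute)
    finally show ?thesis using i int_f by (simp add: s_def)
  qed
  have "(\<lambda>n. LINT x|lborel. s n x) \<longlonglongrightarrow> (LINT x|lborel. frechet_derivative f (at x) ?w)"
  proof (rule integral_dominated_convergence)
    \<comment> \<open>Shifts by h n \<le> 1 enlarge the support by at most 1, and the mean value
      theorem along the axis bounds the quotients by M.\<close>
    show "integrable lborel (\<lambda>x::real^2. indicator (cball 0 (B + 1)) x *\<^sub>R M)"
      by (intro borel_integrable_compact) auto
    show "AE x in lborel. (\<lambda>n. s n x) \<longlonglongrightarrow> frechet_derivative f (at x) ?w"
    proof (intro AE_I2)
      fix x
      have "((\<lambda>y. norm (f (x + y) - f x - frechet_derivative f (at x) y) / norm y) \<longlongrightarrow> 0) (at 0)"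
        using test_function_has_derivative[OF f, of x] by (simp add: has_derivative_at)
      moreover have "filterlim (\<lambda>n. h n *\<^sub>R ?w) (at 0) sequentially"
      proof (rule filterlim_atI)
        have "(\<lambda>n. h n *\<^sub>R ?w) \<longlonglongrightarrow> 0 *\<^sub>R ?w" unfolding h_def by (intro tendsto_intros LIMSEQ_inverse_real_of_nat)
        then show "(\<lambda>n. h n *\<^sub>R ?w) \<longlonglongrightarrow> 0" by simp
        show "\<forall>\<^sub>F n in sequentially. h n *\<^sub>R ?w \<noteq> 0"
          using h(1) nw by (auto intro!: always_eventually simp: less_imp_neq[symmetric] axis_eq_0_iff)
      qed
      ultimately have lim: "(\<lambda>n. norm (f (x + h n *\<^sub>R ?w) - f x - frechet_derivative f (at x) (h n *\<^sub>R ?w)) / norm (h n *\<^sub>R ?w)) \<longlonglongrightarrow> 0"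
        by (rule filterlim_compose)
      have lin: "frechet_derivative f (at x) (h n *\<^sub>R ?w) = h n *\<^sub>R frechet_derivative f (at x) ?w" for n
        using test_function_has_derivative[OF f, of x] has_derivative_bounded_linear bounded_linear.linear linear_scale by blast
      have eq: "norm (f (x + h n *\<^sub>R ?w) - f x - frechet_derivative f (at x) (h n *\<^sub>R ?w)) / norm (h n *\<^sub>R ?w)
          = norm (s n x - frechet_derivative f (at x) ?w)" for n
      proof -
        have "f (x + h n *\<^sub>R ?w) - f x - frechet_derivative f (at x) (h n *\<^sub>R ?w) = h n *\<^sub>R (s n x - frechet_derivative f (at x) ?w)"
          using h(1)[of n] by (simp add: s_def lin scaleR_diff_right)
        then show ?thesis using h(1)[of n] nw by simp
      qed
      show "(\<lambda>n. s n x) \<longlonglongrightarrow> frechet_derivative f (at x) ?w"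
        using lim unfolding eq by (simp add: tendsto_norm_zero_iff LIM_zero_iff)
    qed
    show "AE x in lborel. norm (s n x) \<le> indicator (cball 0 (B + 1)) x *\<^sub>R M" for n
    proof (intro AE_I2)
      fix x :: "real^2"
      show "norm (s n x) \<le> indicator (cball 0 (B + 1)) x *\<^sub>R M"
      proof (cases "norm x \<le> B + 1")
        case False
        have "norm x \<le> norm (x + h n *\<^sub>R ?w) + norm (h n *\<^sub>R ?w)"
          using norm_triangle_ineq4[of "x + h n *\<^sub>R ?w" "h n *\<^sub>R ?w"] by simp
        then have "norm (x + h n *\<^sub>R ?w) > B" using False h[of n] nw by simp
        moreover have "norm x > B" using False by simp
        ultimately show ?thesis using B(2) M by (simp add: s_def)
      next
        case True
        have der: "((\<lambda>t. f (x + t *\<^sub>R ?w)) has_derivative (\<lambda>d. frechet_derivative f (at (x + t *\<^sub>R ?w)) (d *\<^sub>R ?w))) (at t)" for t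
          by (rule has_derivative_compose[OF _ test_function_has_derivative[OF f]]) (auto intro!: derivative_eq_intros)
        have "\<exists>t\<in>{0<..<h n}. norm (f (x + h n *\<^sub>R ?w) - f (x + 0 *\<^sub>R ?w)) \<le> norm (frechet_derivative f (at (x + t *\<^sub>R ?w)) ((h n - 0) *\<^sub>R ?w))"
          by (rule mvt_general[OF h(1) _ der]) (use der in \<open>blast intro: has_derivative_continuous continuous_at_imp_continuous_on\<close>)
        then obtain t where "norm (f (x + h n *\<^sub>R ?w) - f x) \<le> norm (frechet_derivative f (at (x + t *\<^sub>R ?w)) (h n *\<^sub>R ?w))"
          by auto
        also have "frechet_derivative f (at (x + t *\<^sub>R ?w)) (h n *\<^sub>R ?w) = h n *\<^sub>R frechet_derivative f (at (x + t *\<^sub>R ?w)) ?w"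
          using test_function_has_derivative[OF f] has_derivative_bounded_linear bounded_linear.linear linear_scale by blast
        also have "norm \<dots> \<le> h n * M" using M h(1)[of n] by simp
        finally have "norm (s n x) \<le> M" using h(1)[of n] by (simp add: s_def divide_simps mult.commute)
        then show ?thesis using True by simp
      qed
    qed
  qed (auto simp: s_def)
  then show ?thesis by (simp add: int0 LIMSEQ_const_iff)
qed

lemma locally_integrable_integrable_mult:
  assumes u: "locally_integrable u" and f: "continuous_on UNIV f" and B: "\<And>x. norm x > B \<Longrightarrow> f x = 0"
  shows "integrable lborel (\<lambda>x. u x * f x)"
proof -
  obtain M where M: "M \<ge> 0" "\<And>x. norm (f x) \<le> M" using vanishing_continuous_bounded[OF f B] by auto
  have [measurable]: "f \<in> borel_measurable borel" using f by (rule borel_measurable_continuous_onI)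
  have [measurable]: "u \<in> borel_measurable borel" using u by (simp add: locally_integrable_def)
  have "integrable lborel (\<lambda>x. M *\<^sub>R (indicator (cball 0 B) x *\<^sub>R u x))"
    using u by (intro integrable_scaleR_right) (auto simp: locally_integrable_def set_integrable_def)
  then show ?thesis
  proof (rule Bochner_Integration.integrable_bound)
    show "AE x in lborel. norm (u x * f x) \<le> norm (M *\<^sub>R (indicator (cball 0 B) x *\<^sub>R u x))"
    proof (rule AE_I2)
      fix x
      have "norm (u x) * norm (f x) \<le> norm (u x) * M" using M by (intro mult_left_mono) auto
      then show "norm (u x * f x) \<le> norm (M *\<^sub>R (indicator (cball 0 B) x *\<^sub>R u x))"
        using M B[of x] by (auto simp: norm_mult indicator_def not_le mult.commute)
    qed
  qed simp
qed

lemma locally_integrable_test_mult: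
  "locally_integrable u \<Longrightarrow> test_function f \<Longrightarrow> integrable lborel (\<lambda>x. u x * f x)"
  by (metis locally_integrable_integrable_mult test_function_continuous test_function_supp)

text \<open>The product of two test functions is a test function, so its derivative integrates to 0;
  the product rule then gives integration by parts.\<close>

lemma has_weak_partialI_test:
  assumes f: "test_function f"
  shows "has_weak_partial f j (\<lambda>x. frechet_derivative f (at x) (axis j 1))"
proof -
  have cont_loc: "locally_integrable g" if "continuous_on UNIV g" for g :: "real^2 \<Rightarrow> complex"
    using that borel_integrable_compact[of _ g]
    by (auto simp: locally_integrable_def set_integrable_def intro: borel_measurable_continuous_onI continuous_on_subset)
  note loc = cont_loc[OF test_function_continuous[OF f]] cont_loc[OF test_function_deriv_continuous[OF f]]
  have "(LINT x|lborel. f x * frechet_derivative p (at x) (axis j 1))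
      = - (LINT x|lborel. frechet_derivative f (at x) (axis j 1) * p x)" if p: "test_function p" for p
  proof -
    have fp: "test_function (\<lambda>x. f x * p x)" using f p by (intro test_function_mult) (auto simp: test_function_def)
    have "0 = (LINT x|lborel. frechet_derivative (\<lambda>x. f x * p x) (at x) (axis j 1))"
      using integral_axis_derivative_test_function[OF fp] by simp
    also have "\<dots> = (LINT x|lborel. f x * frechet_derivative p (at x) (axis j 1) + frechet_derivative f (at x) (axis j 1) * p x)"
      by (simp add: frechet_derivative_eqI[OF has_derivative_mult[OF test_function_has_derivative[OF f] test_function_has_derivative[OF p]]])
    also have "\<dots> = (LINT x|lborel. f x * frechet_derivative p (at x) (axis j 1)) + (LINT x|lborel. frechet_derivative f (at x) (axis j 1) * p x)"
    proof (rule Bochner_Integration.integral_add)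
      show "integrable lborel (\<lambda>x. frechet_derivative f (at x) (axis j 1) * p x)"
        by (intro locally_integrable_test_mult loc p)
      obtain B where "\<And>x. norm x > B \<Longrightarrow> p x = 0" using test_function_supp[OF p] by metis
      then show "integrable lborel (\<lambda>x. f x * frechet_derivative p (at x) (axis j 1))"
        by (intro locally_integrable_integrable_mult[of _ _ B] loc test_function_deriv_continuous p test_function_deriv_supp)
    qed
    finally show ?thesis by (simp add: eq_neg_iff_add_eq_0)
  qed
  then show ?thesis using loc by (simp add: has_weak_partial_def)
qed

text \<open>Boxes are closed under intersection and generate the Borel sets, so Dynkin's argument
  applies. The plane itself is not a box; \<open>tot\<close> supplies its integral for the
  complements.\<close>

lemma AE_zero_of_box_integrals:
  fixes f :: "real^2 \<Rightarrow> complex"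
  assumes f: "integrable lborel f" and box: "\<And>l u. (LINT x|lborel. indicator (box l u) x *\<^sub>R f x) = 0"
    and tot: "(LINT x|lborel. f x) = 0"
  shows "AE x in lborel. f x = 0"
proof (rule sigma_finite_measure.density_zero[OF sigma_finite_lborel f])
  fix A :: "(real^2) set" assume "A \<in> sets lborel"
  have "Int_stable (range (\<lambda>(a, b). box a b :: (real^2) set))"
    by (auto simp: Int_stable_def box_Int_box)
  moreover have "range (\<lambda>(a, b). box a b :: (real^2) set) \<subseteq> Pow UNIV" by simp
  moreover have "A \<in> sigma_sets UNIV (range (\<lambda>(a, b). box a b))" using \<open>A \<in> sets lborel\<close> by (simp add: borel_eq_box)
  ultimately show "set_lebesgue_integral lborel A f = 0"
  proof (induction rule: sigma_sets_induct_disjoint)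
    case (basic A)
    then show ?case using box by (auto simp: set_lebesgue_integral_def)
  next
    case empty
    then show ?case by (simp add: set_lebesgue_integral_def)
  next
    case (compl A)
    then have Am: "A \<in> sets lborel" by (simp add: borel_eq_box)
    have "(LINT x|lborel. indicator (UNIV - A) x *\<^sub>R f x) = (LINT x|lborel. f x - indicator A x *\<^sub>R f x)"
      by (intro Bochner_Integration.integral_cong) (auto simp: indicator_def)
    also have "\<dots> = 0"
      using compl tot f Am by (subst Bochner_Integration.integral_diff) (auto simp: set_lebesgue_integral_def integrable_mult_indicator)
    finally show ?case by (simp add: set_lebesgue_integral_def)
  next
    case (union A)
    have "A i \<in> sets lborel" for i using union(2) by (auto simp: borel_eq_box)
    then show ?case
      using union f by (subst lebesgue_integral_countable_add)
        (auto simp: disjoint_family_on_def set_integrable_def intro!: integrable_mult_indicator)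
  qed
qed

lemma AE_zero_of_test_functions:
  assumes g: "locally_integrable g" and 0: "\<And>p. test_function p \<Longrightarrow> (LINT x|lborel. g x * p x) = 0"
  shows "AE x in lborel. g x = 0"
proof -
  have [measurable]: "g \<in> borel_measurable borel" using g by (simp add: locally_integrable_def)
  have gint: "integrable lborel (\<lambda>x. indicator (cbox l u) x *\<^sub>R g x)" for l u
    using g by (auto simp: locally_integrable_def set_integrable_def)
  have gint': "integrable lborel (\<lambda>x. indicator (box l u) x *\<^sub>R g x)" for l u
    by (rule Bochner_Integration.integrable_bound[OF gint[of l u]]) (use box_subset_cbox in \<open>auto simp: indicator_def intro!: AE_I2\<close>)
  have box0: "(LINT x|lborel. indicator (box l u) x *\<^sub>R g x) = 0" for l u
  proof -
    have [measurable]: "box_bump l u (real (Suc n)) \<in> borel_measurable borel" for n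
      by (intro borel_measurable_continuous_onI test_function_continuous box_bump_test) simp
    have "(\<lambda>n. LINT x|lborel. g x * box_bump l u (real (Suc n)) x) \<longlonglongrightarrow> (LINT x|lborel. indicator (box l u) x *\<^sub>R g x)"
    proof (rule integral_dominated_convergence)
      show "integrable lborel (\<lambda>x. norm (indicator (cbox l u) x *\<^sub>R g x))" using gint by (rule integrable_norm)
      show "AE x in lborel. (\<lambda>n. g x * box_bump l u (real (Suc n)) x) \<longlonglongrightarrow> indicator (box l u) x *\<^sub>R g x"
      proof (rule AE_I2)
        fix x
        have "(\<lambda>n. g x * box_bump l u (real (Suc n)) x) \<longlonglongrightarrow> g x * indicator (box l u) x"
          by (intro tendsto_mult tendsto_const box_bump_tendsto)
        then show "(\<lambda>n. g x * box_bump l u (real (Suc n)) x) \<longlonglongrightarrow> indicator (box l u) x *\<^sub>R g x"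
          by (auto simp: indicator_def split: if_splits)
      qed
      show "AE x in lborel. norm (g x * box_bump l u (real (Suc n)) x) \<le> norm (indicator (cbox l u) x *\<^sub>R g x)" for n
      proof (rule AE_I2)
        fix x
        have "box_bump l u (real (Suc n)) x = 0" if "x \<notin> cbox l u"
          using that box_bump_supp[of "real (Suc n)" l u x] by auto
        then show "norm (g x * box_bump l u (real (Suc n)) x) \<le> norm (indicator (cbox l u) x *\<^sub>R g x)"
          using box_bump_norm_le[of l u "real (Suc n)" x] by (auto simp: norm_mult indicator_def intro: mult_left_le)
      qed
    qed (auto simp del: of_nat_Suc)
    moreover have "(LINT x|lborel. g x * box_bump l u (real (Suc n)) x) = 0" for n
      by (intro 0 box_bump_test) simp
    ultimately show ?thesis by (simp add: LIMSEQ_const_iff)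
  qed
  \<comment> \<open>Since g is only locally integrable, the previous lemma is applied to its
    restrictions to boxes that exhaust the plane.\<close>
  define b :: "nat \<Rightarrow> (real^2) set" where "b n = box (- (real n *\<^sub>R One)) (real n *\<^sub>R One)" for n
  have "AE x in lborel. indicator (b n) x *\<^sub>R g x = 0" for n
  proof (rule AE_zero_of_box_integrals)
    fix l u :: "real^2"
    obtain l' u' where "box l u \<inter> b n = box l' u'" by (auto simp: b_def box_Int_box)
    then have "(\<lambda>x. indicator (box l u) x *\<^sub>R indicator (b n) x *\<^sub>R g x) = (\<lambda>x. indicator (box l' u') x *\<^sub>R g x)"
      by (auto simp: fun_eq_iff indicator_def split: if_splits)
    then show "(LINT x|lborel. indicator (box l u) x *\<^sub>R indicator (b n) x *\<^sub>R g x) = 0" using box0[of l' u'] by simp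
  qed (auto simp: b_def gint' box0)
  then have "AE x in lborel. \<forall>n. indicator (b n) x *\<^sub>R g x = 0" unfolding AE_all_countable ..
  then show ?thesis
  proof eventually_elim
    case (elim x)
    have "(\<Union>n. b n) = UNIV" unfolding b_def UN_box_eq_UNIV by simp
    then obtain n where "x \<in> b n" by blast
    then show ?case using elim by (auto dest: spec[of _ n])
  qed
qed

lemma has_weak_partial_unique:
  assumes "has_weak_partial u j g" "has_weak_partial u j h"
  shows "AE x in lborel. g x = h x"
proof -
  have g: "locally_integrable g" "locally_integrable h" using assms by (auto simp: has_weak_partial_def)
  have "AE x in lborel. g x - h x = 0"
  proof (rule AE_zero_of_test_functions)
    show "locally_integrable (\<lambda>x. g x - h x)"
      using g by (auto simp: locally_integrable_def set_integrable_def scaleR_diff_right)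
    fix p assume p: "test_function p"
    have "(LINT x|lborel. (g x - h x) * p x) = (LINT x|lborel. g x * p x) - (LINT x|lborel. h x * p x)"
      unfolding left_diff_distrib by (intro Bochner_Integration.integral_diff locally_integrable_test_mult p g)
    also have "\<dots> = 0" using assms p by (auto simp: has_weak_partial_def)
    finally show "(LINT x|lborel. (g x - h x) * p x) = 0" .
  qed
  then show ?thesis by simp
qed


section \<open>Square integrable functions and weak gradients\<close>

lemma L2_measurable [measurable_dest]: "u \<in> L2 \<Longrightarrow> u \<in> borel_measurable borel"
  by (simp add: L2_def)

lemma L2_integrable: "u \<in> L2 \<Longrightarrow> integrable lborel (\<lambda>x. (norm (u x))\<^sup>2)"
  by (simp add: L2_def)

lemma L2_mult_integrable:
  assumes "u \<in> L2" "v \<in> L2"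
  shows "integrable lborel (\<lambda>x. u x * v x)"
proof (rule Bochner_Integration.integrable_bound)
  show "integrable lborel (\<lambda>x. (norm (u x))\<^sup>2 + (norm (v x))\<^sup>2)"
    using assms by (intro Bochner_Integration.integrable_add L2_integrable)
  show "(\<lambda>x. u x * v x) \<in> borel_measurable lborel" using assms by (auto simp: L2_def)
  show "AE x in lborel. norm (u x * v x) \<le> norm ((norm (u x))\<^sup>2 + (norm (v x))\<^sup>2)"
  proof (rule AE_I2)
    fix x
    have "0 \<le> (norm (u x) - norm (v x))\<^sup>2" "0 \<le> norm (u x) * norm (v x)" by auto
    then have "norm (u x) * norm (v x) \<le> (norm (u x))\<^sup>2 + (norm (v x))\<^sup>2"
      unfolding power2_diff by linarith
    then show "norm (u x * v x) \<le> norm ((norm (u x))\<^sup>2 + (norm (v x))\<^sup>2)" by (simp add: norm_mult)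
  qed
qed

lemma L2_bound:
  assumes "v \<in> L2" "u \<in> borel_measurable borel" "\<And>x. norm (u x) \<le> C * norm (v x)"
  shows "u \<in> L2"
proof -
  have "integrable lborel (\<lambda>x. C\<^sup>2 * (norm (v x))\<^sup>2)"
    using assms by (intro integrable_mult_right L2_integrable)
  then have "integrable lborel (\<lambda>x. (norm (u x))\<^sup>2)"
  proof (rule Bochner_Integration.integrable_bound)
    show "(\<lambda>x. (norm (u x))\<^sup>2) \<in> borel_measurable lborel" using assms by simp
    show "AE x in lborel. norm ((norm (u x))\<^sup>2) \<le> norm (C\<^sup>2 * (norm (v x))\<^sup>2)"
      using assms(3) by (auto intro!: AE_I2 power_mono simp flip: power_mult_distrib)
  qed
  then show ?thesis using assms by (simp add: L2_def)
qed

lemma L2_cmult: "u \<in> L2 \<Longrightarrow> (\<lambda>x. c * u x) \<in> L2"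
  by (rule L2_bound[of u _ "norm c"]) (auto simp: norm_mult L2_measurable)

lemma L2_cnj: "u \<in> L2 \<Longrightarrow> (\<lambda>x. cnj (u x)) \<in> L2"
  by (rule L2_bound[of u _ 1]) (auto simp: L2_measurable intro: borel_measurable_continuous_on[OF continuous_on_cnj[OF continuous_on_id]])

lemma L2_bounded_mult:
  assumes "u \<in> L2" "f \<in> borel_measurable borel" "\<And>x. norm (f x) \<le> C"
  shows "(\<lambda>x. f x * u x) \<in> L2"
  by (rule L2_bound[OF assms(1), of _ C]) (use assms in \<open>auto simp: norm_mult L2_measurable intro: mult_right_mono\<close>)

lemma L2_add:
  assumes "u \<in> L2" "v \<in> L2" shows "(\<lambda>x. u x + v x) \<in> L2"
proof -
  have "integrable lborel (\<lambda>x. 2 * (norm (u x))\<^sup>2 + 2 * (norm (v x))\<^sup>2)"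
    using assms by (intro Bochner_Integration.integrable_add integrable_mult_right L2_integrable)
  then have "integrable lborel (\<lambda>x. (norm (u x + v x))\<^sup>2)"
  proof (rule Bochner_Integration.integrable_bound)
    show "AE x in lborel. norm ((norm (u x + v x))\<^sup>2) \<le> norm (2 * (norm (u x))\<^sup>2 + 2 * (norm (v x))\<^sup>2)"
    proof (rule AE_I2)
      fix x
      have "(norm (u x + v x))\<^sup>2 \<le> (norm (u x) + norm (v x))\<^sup>2" by (intro power_mono norm_triangle_ineq) auto
      moreover have "0 \<le> (norm (u x) - norm (v x))\<^sup>2" by simp
      ultimately show "norm ((norm (u x + v x))\<^sup>2) \<le> norm (2 * (norm (u x))\<^sup>2 + 2 * (norm (v x))\<^sup>2)"
        by (simp add: power2_diff power2_sum)
    qed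
  qed (use assms in \<open>auto simp: L2_measurable\<close>)
  moreover have "(\<lambda>x. u x + v x) \<in> borel_measurable borel"
    using assms[THEN L2_measurable] by (rule borel_measurable_add)
  ultimately show ?thesis by (simp add: L2_def)
qed

lemma L2_diff: "u \<in> L2 \<Longrightarrow> v \<in> L2 \<Longrightarrow> (\<lambda>x. u x - v x) \<in> L2"
  using L2_add[OF _ L2_cmult, of u v "-1"] by simp

lemma L2_pairing_integrable: "u \<in> L2 \<Longrightarrow> v \<in> L2 \<Longrightarrow> integrable lborel (\<lambda>x. u x * cnj (v x))"
  by (intro L2_mult_integrable L2_cnj)

lemma L2_locally_integrable:
  assumes "u \<in> L2" shows "locally_integrable u"
proof -
  have "integrable lborel (\<lambda>x. indicator K x *\<^sub>R u x)" if "compact K" for K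
  proof (rule Bochner_Integration.integrable_bound)
    show "integrable lborel (\<lambda>x. indicator K x *\<^sub>R (1::real) + (norm (u x))\<^sup>2)"
      using that assms by (intro Bochner_Integration.integrable_add borel_integrable_compact L2_integrable) auto
    show "(\<lambda>x. indicator K x *\<^sub>R u x) \<in> borel_measurable lborel"
      using that L2_measurable[OF assms] by (auto simp: borel_compact intro!: borel_measurable_scaleR borel_measurable_indicator)
    show "AE x in lborel. norm (indicator K x *\<^sub>R u x) \<le> norm (indicator K x *\<^sub>R (1::real) + (norm (u x))\<^sup>2)"
    proof (rule AE_I2)
      fix x
      have "0 \<le> (norm (u x) - 1)\<^sup>2" by simp
      then have "2 * norm (u x) \<le> 1 + (norm (u x))\<^sup>2" by (simp add: power2_diff)
      moreover have "0 \<le> norm (u x)" by simp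
      ultimately have "norm (u x) \<le> 1 + (norm (u x))\<^sup>2" by linarith
      then show "norm (indicator K x *\<^sub>R u x) \<le> norm (indicator K x *\<^sub>R (1::real) + (norm (u x))\<^sup>2)"
        by (auto simp: indicator_def)
    qed
  qed
  then show ?thesis using assms by (auto simp: locally_integrable_def set_integrable_def L2_measurable)
qed

lemma Sigma_space_L2: "u \<in> Sigma_space \<Longrightarrow> u \<in> L2"
  by (simp add: Sigma_space_def H1_def)

text \<open>\<open>weak_partial\<close> picks an arbitrary weak derivative, not the square
  integrable one that membership provides; almost everywhere uniqueness transfers the
  integrability.\<close>

lemma Sigma_space_weak_partial:
  assumes "u \<in> Sigma_space"
  shows "has_weak_partial u j (weak_partial j u)" "weak_partial j u \<in> L2"
proof -
  obtain g where g: "g \<in> L2" "has_weak_partial u j g" using assms by (auto simp: Sigma_space_def H1_def)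
  show w: "has_weak_partial u j (weak_partial j u)" unfolding weak_partial_def using g(2) by (metis someI)
  then have [measurable]: "weak_partial j u \<in> borel_measurable borel" by (simp add: has_weak_partial_def locally_integrable_def)
  have ae: "AE x in lborel. (norm (g x))\<^sup>2 = (norm (weak_partial j u x))\<^sup>2"
    using has_weak_partial_unique[OF g(2) w] by eventually_elim simp
  have "integrable lborel (\<lambda>x. (norm (weak_partial j u x))\<^sup>2)"
    by (rule integrable_cong_AE_imp[OF L2_integrable[OF g(1)] _ ae]) simp
  then show "weak_partial j u \<in> L2" by (simp add: L2_def)
qed

lemma Sigma_space_weak_partial_AE:
  assumes "u \<in> Sigma_space" "has_weak_partial u j g"
  shows "AE x in lborel. weak_partial j u x = g x"
  using Sigma_space_weak_partial(1)[OF assms(1)] assms(2) has_weak_partial_unique by blast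

text \<open>Extends the defining identity of a weak derivative from test functions to functions such
  as the kernel, which is smooth and decays but has no compact support. After multiplication by
  cut-offs, the term with the derivative of the cut-off is of order 1 / R against the integrable
  product of v and p.\<close>

lemma weak_partial_IBP:
  assumes v: "v \<in> L2" and g: "g \<in> L2" and vg: "has_weak_partial v j g"
    and C: "\<And>k. C_k k p" and p: "p \<in> L2" and D: "\<And>x. (p has_derivative p' x) (at x)"
    and p': "(\<lambda>x. p' x (axis j 1)) \<in> L2"
  shows "(LINT x|lborel. v x * p' x (axis j 1)) = - (LINT x|lborel. g x * p x)"
proof -
  let ?w = "axis j 1 :: real^2"
  obtain K where K: "\<And>R x. R > 0 \<Longrightarrow> norm (frechet_derivative (cutoff R) (at x) ?w) \<le> K / R"
    using cutoff_deriv_bound by metis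
  define c where "c n = cutoff (real (Suc n))" for n
  define c' where "c' n x = frechet_derivative (c n) (at x) ?w" for n x
  have c: "test_function (c n)" for n unfolding c_def by (intro cutoff_test) simp
  have c'K: "norm (c' n x) \<le> K / real (Suc n)" for n x unfolding c'_def c_def by (rule K) simp
  have K0: "K \<ge> 0" using order_trans[OF norm_ge_zero c'K[of 0 0]] by simp
  have [measurable]: "c n \<in> borel_measurable borel" "c' n \<in> borel_measurable borel" for n
    unfolding c'_def[abs_def] using test_function_continuous[OF c[of n]] test_function_deriv_continuous[OF c[of n]]
    by (auto intro!: borel_measurable_continuous_onI)
  note [measurable] = L2_measurable[OF v] L2_measurable[OF g] L2_measurable[OF p] L2_measurable[OF p']
  have "(LINT x|lborel. v x * (c n x * p' x ?w + c' n x * p x)) = - (LINT x|lborel. g x * (c n x * p x))" for n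
  proof -
    have "test_function (\<lambda>x. c n x * p x)" using c C by (rule test_function_mult)
    moreover have "frechet_derivative (\<lambda>x. c n x * p x) (at x) ?w = c n x * p' x ?w + c' n x * p x" for x
      using has_derivative_mult[OF test_function_has_derivative[OF c[of n]] D, of x]
      by (simp add: frechet_derivative_eqI c'_def)
    ultimately show ?thesis using vg by (auto simp: has_weak_partial_def)
  qed
  moreover have "(\<lambda>n. LINT x|lborel. v x * (c n x * p' x ?w + c' n x * p x)) \<longlonglongrightarrow> (LINT x|lborel. v x * (of_real (exp (-4)) * p' x ?w + 0 * p x))"
  proof (rule integral_dominated_convergence)
    show "integrable lborel (\<lambda>x. norm (v x * p' x ?w) + K * norm (v x * p x))"
      using v p p' by (intro Bochner_Integration.integrable_add integrable_mult_right integrable_norm L2_mult_integrable)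
    show "AE x in lborel. (\<lambda>n. v x * (c n x * p' x ?w + c' n x * p x)) \<longlonglongrightarrow> v x * (of_real (exp (- 4)) * p' x ?w + 0 * p x)"
    proof (intro AE_I2 tendsto_intros)
      fix x
      show "(\<lambda>n. c n x) \<longlonglongrightarrow> of_real (exp (-4))" unfolding c_def by (rule cutoff_tendsto)
      have "(\<lambda>n. K * inverse (real (Suc n))) \<longlonglongrightarrow> K * 0"
        by (intro tendsto_intros LIMSEQ_inverse_real_of_nat)
      then show "(\<lambda>n. c' n x) \<longlonglongrightarrow> 0"
        by (intro Lim_null_comparison[of "\<lambda>n. c' n x" "\<lambda>n. K / real (Suc n)"])
          (auto intro!: always_eventually c'K[unfolded divide_inverse] simp: divide_inverse simp del: of_nat_Suc)
    qed
    show "AE x in lborel. norm (v x * (c n x * p' x ?w + c' n x * p x)) \<le> norm (v x * p' x ?w) + K * norm (v x * p x)" for n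
    proof (rule AE_I2)
      fix x
      have "norm (c' n x) \<le> K" using order_trans[OF c'K[of n x], of K] K0 by (simp add: divide_le_eq mult_le_cancel_left1 mult.commute)
      moreover have "norm (c n x) \<le> 1" unfolding c_def by (rule cutoff_norm_le)
      ultimately have "norm (c n x) * norm (v x * p' x ?w) + norm (c' n x) * norm (v x * p x) \<le> 1 * norm (v x * p' x ?w) + K * norm (v x * p x)"
        using K0 by (intro add_mono mult_mono) auto
      moreover have "norm (v x * (c n x * p' x ?w + c' n x * p x)) \<le> norm (c n x) * norm (v x * p' x ?w) + norm (c' n x) * norm (v x * p x)"
        unfolding distrib_left by (rule order_trans[OF norm_triangle_ineq]) (simp add: norm_mult mult_ac)
      ultimately show "norm (v x * (c n x * p' x ?w + c' n x * p x)) \<le> norm (v x * p' x ?w) + K * norm (v x * p x)" by simp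
    qed
  qed auto
  moreover have "(\<lambda>n. - (LINT x|lborel. g x * (c n x * p x))) \<longlonglongrightarrow> - (LINT x|lborel. g x * (of_real (exp (-4)) * p x))"
  proof (rule tendsto_minus, rule integral_dominated_convergence)
    show "integrable lborel (\<lambda>x. norm (g x * p x))"
      using g p by (intro integrable_norm L2_mult_integrable)
    show "AE x in lborel. (\<lambda>n. g x * (c n x * p x)) \<longlonglongrightarrow> g x * (of_real (exp (- 4)) * p x)"
      unfolding c_def by (intro AE_I2 tendsto_intros cutoff_tendsto)
    show "AE x in lborel. norm (g x * (c n x * p x)) \<le> norm (g x * p x)" for n
    proof (rule AE_I2)
      fix x
      have "norm (c n x) * norm (g x * p x) \<le> 1 * norm (g x * p x)"
        unfolding c_def by (intro mult_right_mono cutoff_norm_le) auto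
      then show "norm (g x * (c n x * p x)) \<le> norm (g x * p x)" by (simp add: norm_mult mult_ac)
    qed
  qed auto
  ultimately have "(LINT x|lborel. v x * (of_real (exp (-4)) * p' x ?w + 0 * p x)) = - (LINT x|lborel. g x * (of_real (exp (-4)) * p x))"
    using LIMSEQ_unique by fastforce
  \<comment> \<open>Both limits carry the constant exp (-4) of the cut-offs, which is
    cancelled.\<close>
  then have "of_real (exp (-4)) * (LINT x|lborel. v x * p' x ?w) = of_real (exp (-4)) * (- (LINT x|lborel. g x * p x))"
    by (simp only: mult.left_commute[of _ "of_real (exp (-4))"] integral_mult_right_zero mult_zero_left add_0_right mult_minus_right)
  then show ?thesis by (rule mult_left_cancel[THEN iffD1, rotated]) simp
qed

section \<open>The Mehler kernel\<close>

lemma nn_integral_affine: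
  fixes f :: "real^2 \<Rightarrow> ennreal"
  assumes [measurable]: "f \<in> borel_measurable borel" and c: "c \<noteq> 0"
  shows "(\<integral>\<^sup>+x. f x \<partial>lborel) = ennreal (c\<^sup>2) * (\<integral>\<^sup>+x. f (t + c *\<^sub>R x) \<partial>lborel)"
  by (subst lborel_affine[OF c, of t]) (simp add: nn_integral_density nn_integral_distr nn_integral_cmult)

lemma gaussian_integrable:
  assumes "c > 0" shows "integrable lborel (\<lambda>x::real^2. exp (- c * (norm x)\<^sup>2))"
proof -
  \<comment> \<open>The standard deviation whose normal density has the exponent c x^2; the plane
    follows by multiplying over the coordinates.\<close>
  define s where "s = 1 / sqrt (2 * c)"
  have s: "s > 0" "2 * s\<^sup>2 = 1 / c" using assms by (auto simp: s_def power_divide)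
  have "integrable lborel (\<lambda>x. sqrt (2 * pi * s\<^sup>2) * normal_density 0 s x)"
    using s by (intro integrable_mult_right integrable_normal_density)
  also have "(\<lambda>x. sqrt (2 * pi * s\<^sup>2) * normal_density 0 s x) = (\<lambda>x. exp (- c * x\<^sup>2))"
    using s by (simp add: normal_density_def fun_eq_iff) 
  finally have "(\<integral>\<^sup>+x. ennreal (exp (- c * x\<^sup>2)) \<partial>lborel) < \<infinity>"
    by (simp add: integrable_iff_bounded)
  moreover have "integral\<^sup>N lborel (\<lambda>x::real^2. ennreal (exp (- c * (norm x)\<^sup>2)))
      = integral\<^sup>N lborel (\<lambda>x::real^2. \<Prod>b\<in>Basis. ennreal (exp (- c * (x \<bullet> b)\<^sup>2)))"
  proof (rule nn_integral_cong)
    fix x :: "real^2"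
    have "(norm x)\<^sup>2 = (\<Sum>b\<in>Basis. (x \<bullet> b)\<^sup>2)"
      using euclidean_inner[of x x] unfolding power2_norm_eq_inner by (simp add: power2_eq_square)
    then have "exp (- c * (norm x)\<^sup>2) = (\<Prod>b\<in>Basis. exp (- c * (x \<bullet> b)\<^sup>2))"
      by (simp add: sum_distrib_left exp_sum flip: sum_negf)
    then show "ennreal (exp (- c * (norm x)\<^sup>2)) = (\<Prod>b\<in>Basis. ennreal (exp (- c * (x \<bullet> b)\<^sup>2)))"
      by (simp add: prod_ennreal)
  qed
  moreover have "\<dots> = (\<Prod>b\<in>(Basis::(real^2) set). (\<integral>\<^sup>+x. ennreal (exp (- c * x\<^sup>2)) \<partial>lborel))"
    by (rule nn_integral_lborel_prod) auto
  moreover have "\<dots> < \<infinity>" using calculation(1)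
    by (simp add: power_less_top_ennreal)
  ultimately show ?thesis by (simp add: integrable_iff_bounded)
qed

text \<open>Trades a polynomial factor for a small part of the Gaussian decay. It follows from exp t
  \<ge> 1 + t and (s - 1)^2 \<ge> 0.\<close>

lemma one_plus_le_exp: "0 \<le> s \<Longrightarrow> 1 + s \<le> 4 * exp (s\<^sup>2 / 8 :: real)"
proof -
  assume "0 \<le> s"
  have "1 + s\<^sup>2 / 8 \<le> exp (s\<^sup>2 / 8)" by (rule exp_ge_add_one_self)
  moreover have "0 \<le> (s - 1)\<^sup>2" by simp
  ultimately show ?thesis unfolding power2_diff by (simp del: exp_ge_add_one_self)
qed

lemma one_plus_sq_le_exp: "0 \<le> s \<Longrightarrow> (1 + s)\<^sup>2 \<le> 16 * exp (s\<^sup>2 / 4 :: real)"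
  using power_mono[OF one_plus_le_exp, of s 2] by (simp add: power_mult_distrib flip: exp_double)

text \<open>\<open>mehler \<theta> x y\<close> is, up to a factor \<open>\<pi>\<close>, the kernel of \<open>exp (- s (H - 2))\<close> at the time \<open>s\<close> with
  \<open>exp (-2 s) = sin \<theta>\<close>, multiplied by \<open>exp (- |y|\<^sup>2 / 2)\<close>. The angle removes the singularity at small
  times: the substitution \<open>y = sin \<theta> x + cos \<theta> z\<close> is a rotation of \<open>(x, z)\<close>, and \<open>z\<close> is
  \<open>mehler_arg \<theta> x y\<close>. The case \<open>\<theta> = 0\<close> is the projection onto the ground state.\<close>

definition mehler_arg :: "real \<Rightarrow> real^2 \<Rightarrow> real^2 \<Rightarrow> real^2" where
  "mehler_arg \<theta> x y = (1 / cos \<theta>) *\<^sub>R (y - sin \<theta> *\<^sub>R x)"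

definition mehler :: "real \<Rightarrow> real^2 \<Rightarrow> real^2 \<Rightarrow> real" where
  "mehler \<theta> x y = exp (- (norm x)\<^sup>2 / 2) * exp (- (norm (mehler_arg \<theta> x y))\<^sup>2) / (cos \<theta>)\<^sup>2"

definition mehler_dtheta :: "real \<Rightarrow> real^2 \<Rightarrow> real^2 \<Rightarrow> real" where
  "mehler_dtheta \<theta> x y = mehler \<theta> x y * (2 * sin \<theta> / cos \<theta> + 2 * (x \<bullet> mehler_arg \<theta> x y) - 2 * sin \<theta> * (norm (mehler_arg \<theta> x y))\<^sup>2 / cos \<theta>)"

text \<open>The integral over all times of \<open>exp (- s (H - 2))\<close> minus the ground state projection is the reduced
  resolvent; \<open>ds = - cos \<theta> / (2 sin \<theta>) d\<theta>\<close>.\<close>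

definition res_ker :: "real \<Rightarrow> real^2 \<Rightarrow> real^2 \<Rightarrow> real" where
  "res_ker \<theta> x y = cos \<theta> / (2 * sin \<theta>) * (mehler \<theta> x y - mehler 0 x y)"

text \<open>The derivative of \<open>res_ker\<close> in the direction x_j. Differentiating the
  Gaussian produces 2 sin \<theta> / cos \<theta>, which cancels the singular prefactor, so the
  second summand is regular at \<theta> = 0.\<close>

definition res_ker_grad :: "2 \<Rightarrow> real \<Rightarrow> real^2 \<Rightarrow> real^2 \<Rightarrow> real" where
  "res_ker_grad j \<theta> x y = - x $ j * res_ker \<theta> x y + mehler \<theta> x y * mehler_arg \<theta> x y $ j"

lemma mehler_arg_measurable [measurable (raw)]:
  assumes [measurable]: "f \<in> borel_measurable M" "g \<in> borel_measurable M" "h \<in> borel_measurable M"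
  shows "(\<lambda>x. mehler_arg (f x) (g x) (h x)) \<in> borel_measurable M"
  unfolding mehler_arg_def by measurable

lemma mehler_measurable [measurable (raw)]:
  assumes [measurable]: "f \<in> borel_measurable M" "g \<in> borel_measurable M" "h \<in> borel_measurable M"
  shows "(\<lambda>x. mehler (f x) (g x) (h x)) \<in> borel_measurable M"
  unfolding mehler_def by measurable

lemma mehler_dtheta_measurable [measurable (raw)]:
  assumes [measurable]: "f \<in> borel_measurable M" "g \<in> borel_measurable M" "h \<in> borel_measurable M"
  shows "(\<lambda>x. mehler_dtheta (f x) (g x) (h x)) \<in> borel_measurable M"
  unfolding mehler_dtheta_def by measurable

lemma res_ker_measurable [measurable (raw)]:
  assumes [measurable]: "f \<in> borel_measurable M" "g \<in> borel_measurable M" "h \<in> borel_measurable M"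
  shows "(\<lambda>x. res_ker (f x) (g x) (h x)) \<in> borel_measurable M"
  unfolding res_ker_def by measurable

lemma nth_measurable [measurable (raw)]:
  "f \<in> borel_measurable M \<Longrightarrow> (\<lambda>x. (f x :: real^2) $ j) \<in> borel_measurable M"
  by (rule borel_measurable_continuous_on[of "\<lambda>v. v $ j"]) (auto intro: continuous_intros)

lemma res_ker_grad_measurable [measurable (raw)]:
  assumes [measurable]: "f \<in> borel_measurable M" "g \<in> borel_measurable M" "h \<in> borel_measurable M"
  shows "(\<lambda>x. res_ker_grad j (f x) (g x) (h x)) \<in> borel_measurable M"
  unfolding res_ker_grad_def by measurable

lemma mehler_nonneg: "0 \<le> mehler \<theta> x y"
  by (simp add: mehler_def)

text \<open>The angle 1/2 splits the range: below it the cosine is bounded away from 0, above it the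
  sine is.\<close>

lemma cos_half_ge: "0 \<le> \<theta> \<Longrightarrow> \<theta> \<le> 1/2 \<Longrightarrow> cos \<theta> \<ge> (1/2::real)"
  using cos_monotone_0_pi_le[of \<theta> "pi/3"] pi_ge_two cos_60 pi_gt3 by simp

lemma sin_ge_half_self: "0 \<le> \<theta> \<Longrightarrow> \<theta> \<le> 1/2 \<Longrightarrow> sin \<theta> \<ge> (\<theta>/2::real)"
proof (cases "\<theta> = 0")
  case False
  assume "0 \<le> \<theta>" "\<theta> \<le> 1/2"
  then have "0 < \<theta>" using False by simp
  then obtain z where z: "0 < z" "z < \<theta>" "sin \<theta> - sin 0 = (\<theta> - 0) * cos z"
    using MVT2[of 0 \<theta> sin cos] DERIV_sin by blast
  have "cos z \<ge> 1/2" using z \<open>\<theta> \<le> 1/2\<close> by (intro cos_half_ge) auto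
  then have "\<theta> * (1/2) \<le> \<theta> * cos z" using \<open>0 < \<theta>\<close> by (intro mult_left_mono) auto
  then show ?thesis using z by simp
qed simp

lemma sin_ge_quarter: "1/2 \<le> \<theta> \<Longrightarrow> \<theta> < pi/2 \<Longrightarrow> sin \<theta> \<ge> (1/4::real)"
  using sin_monotone_2pi_le[of "1/2" \<theta>] sin_ge_half_self[of "1/2"] pi_gt3 by simp

lemma norm_mehler_arg_sq:
  "(norm (mehler_arg \<theta> x y))\<^sup>2 = (y \<bullet> y - 2 * sin \<theta> * (x \<bullet> y) + (sin \<theta>)\<^sup>2 * (x \<bullet> x)) / (cos \<theta>)\<^sup>2"
  unfolding power2_norm_eq_inner mehler_arg_def
  by (simp add: inner_simps inner_commute power2_eq_square diff_divide_distrib add_divide_distrib algebra_simps)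

lemma inner_mehler_arg: "x \<bullet> mehler_arg \<theta> x y = (x \<bullet> y - sin \<theta> * (x \<bullet> x)) / cos \<theta>"
  by (simp add: mehler_arg_def inner_simps)

lemma mehler_deriv_theta:
  assumes "cos \<theta> \<noteq> 0"
  shows "((\<lambda>\<theta>. mehler \<theta> x y) has_real_derivative mehler_dtheta \<theta> x y) (at \<theta>)"
proof -
  define X P Y where "X = x \<bullet> x" "P = x \<bullet> y" "Y = y \<bullet> y"
  define N where "N t = (Y - 2 * sin t * P + (sin t)\<^sup>2 * X) / (cos t)\<^sup>2" for t
  define N' where "N' = -2 * ((P - sin \<theta> * X) / cos \<theta>) + 2 * sin \<theta> / cos \<theta> * N \<theta>"
  have N': "(N has_real_derivative N') (at \<theta>)"
    unfolding N_def[abs_def] N'_def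
    using assms by (auto intro!: derivative_eq_intros simp: field_simps power2_eq_square)
  have "((\<lambda>t. exp (- (norm x)\<^sup>2 / 2) * exp (- N t) / (cos t)\<^sup>2) has_real_derivative
      exp (- (norm x)\<^sup>2 / 2) * exp (- N \<theta>) / (cos \<theta>)\<^sup>2 * (2 * sin \<theta> / cos \<theta> - N')) (at \<theta>)"
    using assms by (auto intro!: derivative_eq_intros N' simp: field_simps power2_eq_square)
  moreover have mehler: "mehler t x y = exp (- (norm x)\<^sup>2 / 2) * exp (- N t) / (cos t)\<^sup>2" for t
    by (simp add: mehler_def norm_mehler_arg_sq N_def X_P_Y_def)
  moreover have "mehler_dtheta \<theta> x y = mehler \<theta> x y * (2 * sin \<theta> / cos \<theta> - N')"
    unfolding mehler_dtheta_def norm_mehler_arg_sq inner_mehler_arg N'_def N_def X_P_Y_def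
    by (simp add: diff_divide_distrib mult.commute)
  ultimately show ?thesis by simp
qed

text \<open>The Jacobian of y = sin \<theta> x + cos \<theta> z cancels the denominator of the
  kernel. Hence the bounds derived from this do not degenerate as \<theta> tends to \<pi>/2.\<close>

lemma nn_integral_mehler:
  assumes [measurable]: "F \<in> borel_measurable borel" and "cos \<theta> \<noteq> 0"
  shows "(\<integral>\<^sup>+y. ennreal (mehler \<theta> x y) * F y \<partial>lborel)
    = ennreal (exp (- (norm x)\<^sup>2 / 2)) * (\<integral>\<^sup>+z. ennreal (exp (- (norm z)\<^sup>2)) * F (sin \<theta> *\<^sub>R x + cos \<theta> *\<^sub>R z) \<partial>lborel)"
proof -
  have *: "mehler_arg \<theta> x (sin \<theta> *\<^sub>R x + cos \<theta> *\<^sub>R z) = z" for z using assms by (simp add: mehler_arg_def)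
  have "(\<integral>\<^sup>+y. ennreal (mehler \<theta> x y) * F y \<partial>lborel) = ennreal ((cos \<theta>)\<^sup>2) *
     (\<integral>\<^sup>+z. ennreal (mehler \<theta> x (sin \<theta> *\<^sub>R x + cos \<theta> *\<^sub>R z)) * F (sin \<theta> *\<^sub>R x + cos \<theta> *\<^sub>R z) \<partial>lborel)"
    using assms by (subst nn_integral_affine[of _ "cos \<theta>" "sin \<theta> *\<^sub>R x"]) auto
  also have "\<dots> = (\<integral>\<^sup>+z. ennreal ((cos \<theta>)\<^sup>2 * mehler \<theta> x (sin \<theta> *\<^sub>R x + cos \<theta> *\<^sub>R z)) * F (sin \<theta> *\<^sub>R x + cos \<theta> *\<^sub>R z) \<partial>lborel)"
    by (subst nn_integral_cmult[symmetric]) (auto simp: ennreal_mult mehler_nonneg mult.assoc)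
  also have "\<dots> = (\<integral>\<^sup>+z. ennreal (exp (- (norm x)\<^sup>2 / 2)) * (ennreal (exp (- (norm z)\<^sup>2)) * F (sin \<theta> *\<^sub>R x + cos \<theta> *\<^sub>R z)) \<partial>lborel)"
    using assms by (intro nn_integral_cong) (simp add: mehler_def * ennreal_mult mult.assoc)
  also have "\<dots> = ennreal (exp (- (norm x)\<^sup>2 / 2)) * (\<integral>\<^sup>+z. ennreal (exp (- (norm z)\<^sup>2)) * F (sin \<theta> *\<^sub>R x + cos \<theta> *\<^sub>R z) \<partial>lborel)"
    by (rule nn_integral_cmult) simp
  finally show ?thesis .
qed

text \<open>Its value is 4 \<pi>. It is what the z integral leaves over after all weights have been
  absorbed.\<close>

definition gauss4 :: real where "gauss4 = (LINT z|lborel. exp (- (norm (z::real^2))\<^sup>2 / 4))"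

lemma nn_gauss4: "(\<integral>\<^sup>+z. ennreal (exp (- (norm (z::real^2))\<^sup>2 / 4)) \<partial>lborel) = ennreal gauss4"
  unfolding gauss4_def using gaussian_integrable[of "1/4"] by (intro nn_integral_eq_integral) auto

lemma gauss4_nonneg: "0 \<le> gauss4"
  unfolding gauss4_def by (rule Bochner_Integration.integral_nonneg) simp

text \<open>The kernel carries an extra exp (-|y|^2 / 2), while a source is exp (-|y|^2 / 4) times a
  bounded function. Undoing the former and inserting the latter leaves the weight exp (|y|^2 /
  4).\<close>

abbreviation wint :: "(real^2 \<Rightarrow> real) \<Rightarrow> ennreal" where
  "wint f \<equiv> (\<integral>\<^sup>+y. ennreal (f y * exp ((norm y)\<^sup>2 / 4)) \<partial>lborel)"

text \<open>The number d is the part of the exponent |y|^2 / 4 that is charged to x. In z the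
  exponents add up to -1 + 1/4 + 1/2 = -1/4, where 1/4 pays for the square of 1 + |z|.\<close>

lemma nn_integral_mehler_weight:
  assumes c: "cos \<theta> \<noteq> 0" and d: "\<And>z. (norm (sin \<theta> *\<^sub>R x + cos \<theta> *\<^sub>R z))\<^sup>2 / 4 \<le> d + (norm z)\<^sup>2 / 2"
  shows "wint (\<lambda>y. mehler \<theta> x y * (1 + norm (mehler_arg \<theta> x y))\<^sup>2)
     \<le> ennreal (16 * gauss4 * exp (d - (norm x)\<^sup>2 / 2))"
proof -
  let ?F = "\<lambda>y. ennreal ((1 + norm (mehler_arg \<theta> x y))\<^sup>2 * exp ((norm y)\<^sup>2 / 4))"
  have *: "mehler_arg \<theta> x (sin \<theta> *\<^sub>R x + cos \<theta> *\<^sub>R z) = z" for z using assms by (simp add: mehler_arg_def)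
  have "wint (\<lambda>y. mehler \<theta> x y * (1 + norm (mehler_arg \<theta> x y))\<^sup>2)
      = (\<integral>\<^sup>+y. ennreal (mehler \<theta> x y) * ?F y \<partial>lborel)"
    by (intro nn_integral_cong) (simp add: ennreal_mult mehler_nonneg mult.assoc flip: ennreal_mult)
  also have "\<dots> = ennreal (exp (- (norm x)\<^sup>2 / 2)) * (\<integral>\<^sup>+z. ennreal (exp (- (norm z)\<^sup>2)) * ?F (sin \<theta> *\<^sub>R x + cos \<theta> *\<^sub>R z) \<partial>lborel)"
    using c by (intro nn_integral_mehler) auto
  also have "\<dots> \<le> ennreal (exp (- (norm x)\<^sup>2 / 2)) * (\<integral>\<^sup>+z. ennreal (16 * exp d) * ennreal (exp (- (norm (z::real^2))\<^sup>2 / 4)) \<partial>lborel)"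
  proof (intro mult_left_mono nn_integral_mono)
    fix z :: "real^2"
    have "exp (- (norm z)\<^sup>2) * ((1 + norm z)\<^sup>2 * exp ((norm (sin \<theta> *\<^sub>R x + cos \<theta> *\<^sub>R z))\<^sup>2 / 4))
       \<le> exp (- (norm z)\<^sup>2) * ((16 * exp ((norm z)\<^sup>2 / 4)) * exp (d + (norm z)\<^sup>2 / 2))"
      using d[of z] by (intro mult_mono one_plus_sq_le_exp) auto
    also have "\<dots> = 16 * (exp (- (norm z)\<^sup>2) * exp ((norm z)\<^sup>2 / 4) * exp (d + (norm z)\<^sup>2 / 2))" by simp
    also have "\<dots> = 16 * exp d * exp (- (norm z)\<^sup>2 / 4)"
      unfolding exp_add[symmetric] mult.assoc by (simp flip: exp_add)
    finally show "ennreal (exp (- (norm z)\<^sup>2)) * ?F (sin \<theta> *\<^sub>R x + cos \<theta> *\<^sub>R z) \<le> ennreal (16 * exp d) * ennreal (exp (- (norm z)\<^sup>2 / 4))"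
      unfolding * by (simp add: ennreal_leI flip: ennreal_mult)
  qed simp
  also have "\<dots> = ennreal (exp (- (norm x)\<^sup>2 / 2)) * (ennreal (16 * exp d) * ennreal gauss4)"
    by (subst nn_integral_cmult, simp, simp only: nn_gauss4)
  also have "\<dots> = ennreal (16 * gauss4 * (exp d * exp (- (norm x)\<^sup>2 / 2)))"
    by (simp add: gauss4_nonneg mult_ac flip: ennreal_mult)
  also have "exp d * exp (- (norm x)\<^sup>2 / 2) = exp (d - (norm x)\<^sup>2 / 2)" by (simp flip: exp_add)
  finally show ?thesis .
qed

text \<open>The left-hand side is one component of a rotation of (x, z); the squared norm of the
  other component is discarded.\<close>

lemma norm_rotation_le:
  "(norm (sin \<theta> *\<^sub>R x + cos \<theta> *\<^sub>R z))\<^sup>2 \<le> (norm x)\<^sup>2 + (norm (z::real^2))\<^sup>2"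
proof -
  have *: "(norm (a *\<^sub>R x + b *\<^sub>R z))\<^sup>2 + (norm (b *\<^sub>R x - a *\<^sub>R z))\<^sup>2 = (a\<^sup>2 + b\<^sup>2) * (x \<bullet> x + z \<bullet> z)" for a b
    unfolding power2_norm_eq_inner by (simp add: inner_simps inner_commute power2_eq_square algebra_simps)
  have "(norm (sin \<theta> *\<^sub>R x + cos \<theta> *\<^sub>R z))\<^sup>2 + (norm (cos \<theta> *\<^sub>R x - sin \<theta> *\<^sub>R z))\<^sup>2 = (norm x)\<^sup>2 + (norm z)\<^sup>2"
    unfolding * by (simp add: power2_norm_eq_inner)
  then show ?thesis using zero_le_power2[of "norm (cos \<theta> *\<^sub>R x - sin \<theta> *\<^sub>R z)"] by linarith
qed

text \<open>At small angles y depends weakly on x. Compared with \<open>norm_rotation_le\<close>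
  this gains a factor exp (-|x|^2 / 8), which absorbs the factor 1 + |x| in the bound of
  \<open>mehler_dtheta\<close>.\<close>

lemma norm_rotation_le_small:
  assumes "\<bar>sin \<theta>\<bar> \<le> 1/2"
  shows "(norm (sin \<theta> *\<^sub>R x + cos \<theta> *\<^sub>R z))\<^sup>2 \<le> (norm x)\<^sup>2 / 2 + 2 * (norm (z::real^2))\<^sup>2"
proof -
  have "norm (sin \<theta> *\<^sub>R x + cos \<theta> *\<^sub>R z) \<le> norm (sin \<theta> *\<^sub>R x) + norm (cos \<theta> *\<^sub>R z)" by (rule norm_triangle_ineq)
  also have "\<dots> \<le> norm x / 2 + norm z"
    using assms mult_right_mono[OF assms, of "norm x"] mult_right_mono[OF abs_cos_le_one[of \<theta>], of "norm z"] by simp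
  finally have "(norm (sin \<theta> *\<^sub>R x + cos \<theta> *\<^sub>R z))\<^sup>2 \<le> (norm x / 2 + norm z)\<^sup>2" by (intro power_mono) auto
  also have "\<dots> \<le> (norm x)\<^sup>2 / 2 + 2 * (norm z)\<^sup>2"
    using zero_le_power2[of "norm x / 2 - norm z"] by (simp add: power2_sum power2_diff power_divide)
  finally show ?thesis .
qed

lemma mehler_weight_bound:
  assumes "cos \<theta> \<noteq> 0"
  shows "wint (\<lambda>y. mehler \<theta> x y * (1 + norm (mehler_arg \<theta> x y))\<^sup>2)
     \<le> ennreal (16 * gauss4 * exp (- (norm x)\<^sup>2 / 4))"
proof -
  have "(norm (sin \<theta> *\<^sub>R x + cos \<theta> *\<^sub>R z))\<^sup>2 / 4 \<le> (norm x)\<^sup>2 / 4 + (norm z)\<^sup>2 / 2" for z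
    using norm_rotation_le[of \<theta> x z] zero_le_power2[of "norm z"] by linarith
  from nn_integral_mehler_weight[OF assms this] show ?thesis by simp
qed

lemma mehler_weight_bound_small:
  assumes "0 \<le> \<theta>" "\<theta> \<le> 1/2"
  shows "wint (\<lambda>y. mehler \<theta> x y * (1 + norm (mehler_arg \<theta> x y))\<^sup>2)
     \<le> ennreal (16 * gauss4 * exp (- 3 * (norm x)\<^sup>2 / 8))"
proof -
  have c: "cos \<theta> \<noteq> 0" using cos_half_ge[OF assms] by auto
  have "\<bar>sin \<theta>\<bar> \<le> 1/2" using abs_sin_x_le_abs_x[of \<theta>] assms by simp
  then have "(norm (sin \<theta> *\<^sub>R x + cos \<theta> *\<^sub>R z))\<^sup>2 / 4 \<le> (norm x)\<^sup>2 / 8 + (norm z)\<^sup>2 / 2" for z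
    using norm_rotation_le_small[of \<theta> x z] by linarith
  from nn_integral_mehler_weight[OF c this] show ?thesis by simp
qed

lemma mehler_dtheta_abs_le:
  assumes "0 < cos \<theta>"
  shows "\<bar>mehler_dtheta \<theta> x y\<bar> \<le> 2 / cos \<theta> * (1 + norm x) * (mehler \<theta> x y * (1 + norm (mehler_arg \<theta> x y))\<^sup>2)"
proof -
  let ?z = "norm (mehler_arg \<theta> x y)"
  have 1: "\<bar>sin \<theta> / cos \<theta>\<bar> \<le> 1 / cos \<theta>" using assms divide_right_mono[OF abs_sin_le_one, of "cos \<theta>"] by (simp add: abs_divide)
  have 2: "\<bar>x \<bullet> mehler_arg \<theta> x y\<bar> \<le> 1 / cos \<theta> * (norm x * ?z)"
  proof -
    have "\<bar>x \<bullet> mehler_arg \<theta> x y\<bar> \<le> norm x * ?z" by (rule Cauchy_Schwarz_ineq2)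
    also have "\<dots> \<le> 1 / cos \<theta> * (norm x * ?z)"
      using assms by (intro mult_le_cancel_right1[THEN iffD2]) (auto simp: mult_less_0_iff)
    finally show ?thesis .
  qed
  have 3: "\<bar>sin \<theta> / cos \<theta> * ?z\<^sup>2\<bar> \<le> 1 / cos \<theta> * ?z\<^sup>2"
    unfolding abs_mult using 1 assms by (intro mult_mono) auto
  have "\<bar>2 * sin \<theta> / cos \<theta> + 2 * (x \<bullet> mehler_arg \<theta> x y) - 2 * sin \<theta> * ?z\<^sup>2 / cos \<theta>\<bar>
     \<le> 2 * \<bar>sin \<theta> / cos \<theta>\<bar> + 2 * \<bar>x \<bullet> mehler_arg \<theta> x y\<bar> + 2 * \<bar>sin \<theta> / cos \<theta> * ?z\<^sup>2\<bar>"
    by (simp add: abs_if)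
  also have "\<dots> \<le> 2 * (1 / cos \<theta>) + 2 * (1 / cos \<theta> * (norm x * ?z)) + 2 * (1 / cos \<theta> * ?z\<^sup>2)"
    by (intro add_mono mult_left_mono 1 2 3) auto
  also have "\<dots> = 2 / cos \<theta> * (1 + norm x * ?z + ?z\<^sup>2)" by (simp add: algebra_simps)
  also have "\<dots> \<le> 2 / cos \<theta> * ((1 + norm x) * (1 + ?z)\<^sup>2)"
    using assms by (intro mult_left_mono) (auto simp: power2_eq_square algebra_simps)
  finally have "mehler \<theta> x y * \<bar>2 * sin \<theta> / cos \<theta> + 2 * (x \<bullet> mehler_arg \<theta> x y) - 2 * sin \<theta> * ?z\<^sup>2 / cos \<theta>\<bar> \<le> mehler \<theta> x y * (2 / cos \<theta> * ((1 + norm x) * (1 + ?z)\<^sup>2))"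
    by (intro mult_left_mono mehler_nonneg)
  then show ?thesis unfolding mehler_dtheta_def abs_mult abs_of_nonneg[OF mehler_nonneg] by (simp only: mult_ac)
qed

text \<open>The factor 1 / cos \<theta> is not integrable up to \<pi>/2, so this bound serves for
  angles cut off at some s < \<pi>/2.\<close>

lemma mehler_dtheta_weight_bound:
  assumes "0 < cos \<theta>"
  shows "wint (\<lambda>y. \<bar>mehler_dtheta \<theta> x y\<bar>)
     \<le> ennreal (32 * gauss4 / cos \<theta> * (1 + norm x) * exp (- (norm x)\<^sup>2 / 4))"
proof -
  let ?C = "2 / cos \<theta> * (1 + norm x)"
  have C: "0 \<le> ?C" using assms by simp
  have "wint (\<lambda>y. \<bar>mehler_dtheta \<theta> x y\<bar>)
    \<le> (\<integral>\<^sup>+y. ennreal ?C * ennreal (mehler \<theta> x y * (1 + norm (mehler_arg \<theta> x y))\<^sup>2 * exp ((norm y)\<^sup>2 / 4)) \<partial>lborel)"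
  proof (intro nn_integral_mono)
    fix y
    have "\<bar>mehler_dtheta \<theta> x y\<bar> * exp ((norm y)\<^sup>2 / 4) \<le> ?C * (mehler \<theta> x y * (1 + norm (mehler_arg \<theta> x y))\<^sup>2) * exp ((norm y)\<^sup>2 / 4)"
      by (intro mult_right_mono mehler_dtheta_abs_le assms) auto
    then show "ennreal (\<bar>mehler_dtheta \<theta> x y\<bar> * exp ((norm y)\<^sup>2 / 4)) \<le> ennreal ?C * ennreal (mehler \<theta> x y * (1 + norm (mehler_arg \<theta> x y))\<^sup>2 * exp ((norm y)\<^sup>2 / 4))"
      unfolding ennreal_mult'[OF C, symmetric] by (intro ennreal_leI) (simp add: mult.assoc)
  qed
  also have "\<dots> \<le> ennreal ?C * ennreal (16 * gauss4 * exp (- (norm x)\<^sup>2 / 4))"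
    using mehler_weight_bound[of \<theta> x] assms by (subst nn_integral_cmult) (auto intro!: mult_left_mono)
  also have "\<dots> = ennreal (32 * gauss4 / cos \<theta> * (1 + norm x) * exp (- (norm x)\<^sup>2 / 4))"
    unfolding ennreal_mult'[OF C, symmetric] by (simp add: algebra_simps)
  finally show ?thesis .
qed

lemma mehler_dtheta_weight_bound_small:
  assumes "0 \<le> \<theta>" "\<theta> \<le> 1/2"
  shows "wint (\<lambda>y. \<bar>mehler_dtheta \<theta> x y\<bar>) \<le> ennreal (256 * gauss4 * exp (- (norm x)\<^sup>2 / 4))"
proof -
  have c: "1/2 \<le> cos \<theta>" by (rule cos_half_ge[OF assms])
  let ?C = "16 * exp ((norm x)\<^sup>2 / 8)"
  have "2 / cos \<theta> \<le> 4" using c by (simp add: divide_le_eq)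
  then have C: "2 / cos \<theta> * (1 + norm x) \<le> ?C"
    using mult_mono[of "2 / cos \<theta>" 4 "1 + norm x", OF _ one_plus_le_exp] by simp
  have "wint (\<lambda>y. \<bar>mehler_dtheta \<theta> x y\<bar>)
    \<le> (\<integral>\<^sup>+y. ennreal ?C * ennreal (mehler \<theta> x y * (1 + norm (mehler_arg \<theta> x y))\<^sup>2 * exp ((norm y)\<^sup>2 / 4)) \<partial>lborel)"
  proof (intro nn_integral_mono)
    fix y
    have "\<bar>mehler_dtheta \<theta> x y\<bar> \<le> 2 / cos \<theta> * (1 + norm x) * (mehler \<theta> x y * (1 + norm (mehler_arg \<theta> x y))\<^sup>2)"
      using c by (intro mehler_dtheta_abs_le) auto
    also have "\<dots> \<le> ?C * (mehler \<theta> x y * (1 + norm (mehler_arg \<theta> x y))\<^sup>2)"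
      using C mehler_nonneg by (intro mult_right_mono) auto
    finally have "\<bar>mehler_dtheta \<theta> x y\<bar> * exp ((norm y)\<^sup>2 / 4) \<le> ?C * (mehler \<theta> x y * (1 + norm (mehler_arg \<theta> x y))\<^sup>2) * exp ((norm y)\<^sup>2 / 4)"
      by (intro mult_right_mono) auto
    then show "ennreal (\<bar>mehler_dtheta \<theta> x y\<bar> * exp ((norm y)\<^sup>2 / 4)) \<le> ennreal ?C * ennreal (mehler \<theta> x y * (1 + norm (mehler_arg \<theta> x y))\<^sup>2 * exp ((norm y)\<^sup>2 / 4))"
      by (subst ennreal_mult'[symmetric]) (auto intro!: ennreal_leI simp: mult_ac)
  qed
  also have "\<dots> \<le> ennreal ?C * ennreal (16 * gauss4 * exp (- 3 * (norm x)\<^sup>2 / 8))"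
    using mehler_weight_bound_small[OF assms, of x] by (subst nn_integral_cmult) (auto intro!: mult_left_mono)
  also have "\<dots> = ennreal (256 * gauss4 * (exp ((norm x)\<^sup>2 / 8) * exp (- 3 * (norm x)\<^sup>2 / 8)))"
    by (subst ennreal_mult'[symmetric]) (auto simp: mult_ac)
  also have "exp ((norm x)\<^sup>2 / 8) * exp (- 3 * (norm x)\<^sup>2 / 8) = exp (- (norm x)\<^sup>2 / 4)"
    by (simp flip: exp_add)
  finally show ?thesis .
qed

lemma mehler_FTC:
  assumes "0 \<le> s" "s < pi/2"
  shows "has_bochner_integral lborel (\<lambda>\<tau>. indicator {0..s} \<tau> *\<^sub>R mehler_dtheta \<tau> x y) (mehler s x y - mehler 0 x y)"
proof (rule has_bochner_integral_FTC_Icc)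
  have c: "cos \<tau> \<noteq> 0" if "0 \<le> \<tau>" "\<tau> \<le> s" for \<tau>
    using cos_gt_zero_pi[of \<tau>] that assms by auto
  show "((\<lambda>\<tau>. mehler \<tau> x y) has_vector_derivative mehler_dtheta \<tau> x y) (at \<tau> within {0..s})" if "0 \<le> \<tau>" "\<tau> \<le> s" for \<tau>
    using mehler_deriv_theta[OF c[OF that]] has_vector_derivative_at_within has_real_derivative_iff_has_vector_derivative by blast
  have "continuous_on {0..s} (\<lambda>\<tau>. mehler_dtheta \<tau> x y)"
    unfolding mehler_dtheta_def mehler_def mehler_arg_def by (intro continuous_intros) (use c in auto)
  then show "continuous_on {0..s} (\<lambda>\<tau>. mehler_dtheta \<tau> x y)" .
qed (use assms in simp)

text \<open>For small angles the difference of the kernels is integrated from its angular derivative, which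
  compensates the factor \<open>1 / sin \<theta>\<close>.\<close>

lemma res_ker_weight_bound:
  assumes "0 < \<theta>" "\<theta> < pi/2"
  shows "wint (\<lambda>y. \<bar>res_ker \<theta> x y\<bar>) \<le> ennreal (256 * gauss4 * exp (- (norm x)\<^sup>2 / 4))"
proof (cases "\<theta> \<le> 1/2")
  case True
  have sin: "sin \<theta> \<ge> \<theta> / 2" using True assms by (intro sin_ge_half_self) auto
  \<comment> \<open>This 1 / \<theta> cancels against the length of the interval of
    \<open>\<tau>\<close> in the integral below.\<close>
  have "\<bar>cos \<theta> / (2 * sin \<theta>)\<bar> \<le> 1 / \<theta>"
  proof -
    have "\<bar>cos \<theta>\<bar> / (2 * sin \<theta>) \<le> 1 / \<theta>"
      using sin assms by (intro frac_le) auto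
    moreover have "\<bar>cos \<theta> / (2 * sin \<theta>)\<bar> = \<bar>cos \<theta>\<bar> / (2 * sin \<theta>)" unfolding abs_divide using sin assms by simp
    ultimately show ?thesis by (simp only:)
  qed
  then have k: "\<bar>res_ker \<theta> x y\<bar> \<le> 1 / \<theta> * \<bar>mehler \<theta> x y - mehler 0 x y\<bar>" for y
    unfolding res_ker_def abs_mult by (rule mult_right_mono) simp
  have d: "ennreal (\<bar>mehler \<theta> x y - mehler 0 x y\<bar>) \<le> (\<integral>\<^sup>+\<tau>. indicator {0..\<theta>} \<tau> * ennreal \<bar>mehler_dtheta \<tau> x y\<bar> \<partial>lborel)" for y
  proof -
    note F = mehler_FTC[of \<theta> x y]
    have "mehler \<theta> x y - mehler 0 x y = (LINT \<tau>|lborel. indicator {0..\<theta>} \<tau> *\<^sub>R mehler_dtheta \<tau> x y)"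
      using F assms by (simp add: has_bochner_integral_iff)
    moreover have "ennreal \<bar>LINT \<tau>|lborel. indicator {0..\<theta>} \<tau> *\<^sub>R mehler_dtheta \<tau> x y\<bar> \<le> (\<integral>\<^sup>+\<tau>. ennreal (norm (indicator {0..\<theta>} \<tau> *\<^sub>R mehler_dtheta \<tau> x y)) \<partial>lborel)"
      using integral_norm_bound_ennreal[of lborel "\<lambda>\<tau>. indicator {0..\<theta>} \<tau> *\<^sub>R mehler_dtheta \<tau> x y"] F assms by (simp add: has_bochner_integral_iff)
    moreover have "\<dots> = (\<integral>\<^sup>+\<tau>. indicator {0..\<theta>} \<tau> * ennreal \<bar>mehler_dtheta \<tau> x y\<bar> \<partial>lborel)"
      by (intro nn_integral_cong) (auto simp: indicator_def)
    ultimately show ?thesis by simp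
  qed
  have "wint (\<lambda>y. \<bar>res_ker \<theta> x y\<bar>)
     \<le> (\<integral>\<^sup>+y. ennreal (1 / \<theta>) * (\<integral>\<^sup>+\<tau>. indicator {0..\<theta>} \<tau> * ennreal (\<bar>mehler_dtheta \<tau> x y\<bar> * exp ((norm y)\<^sup>2 / 4)) \<partial>lborel) \<partial>lborel)"
  proof (intro nn_integral_mono)
    fix y
    have "ennreal (\<bar>res_ker \<theta> x y\<bar> * exp ((norm y)\<^sup>2 / 4)) \<le> ennreal (1 / \<theta>) * ennreal \<bar>mehler \<theta> x y - mehler 0 x y\<bar> * ennreal (exp ((norm y)\<^sup>2 / 4))"
    proof -
      have "\<bar>res_ker \<theta> x y\<bar> * exp ((norm y)\<^sup>2 / 4) \<le> 1 / \<theta> * \<bar>mehler \<theta> x y - mehler 0 x y\<bar> * exp ((norm y)\<^sup>2 / 4)"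
        using k[of y] by (intro mult_right_mono) auto
      then have "ennreal (\<bar>res_ker \<theta> x y\<bar> * exp ((norm y)\<^sup>2 / 4)) \<le> ennreal (1 / \<theta> * \<bar>mehler \<theta> x y - mehler 0 x y\<bar> * exp ((norm y)\<^sup>2 / 4))"
        by (rule ennreal_leI)
      also have "ennreal (1 / \<theta> * \<bar>mehler \<theta> x y - mehler 0 x y\<bar> * exp ((norm y)\<^sup>2 / 4)) = ennreal (1 / \<theta>) * ennreal \<bar>mehler \<theta> x y - mehler 0 x y\<bar> * ennreal (exp ((norm y)\<^sup>2 / 4))"
        using assms by (subst ennreal_mult, simp, simp, subst ennreal_mult) auto
      finally show ?thesis .
    qed
    also have "\<dots> \<le> ennreal (1 / \<theta>) * (\<integral>\<^sup>+\<tau>. indicator {0..\<theta>} \<tau> * ennreal \<bar>mehler_dtheta \<tau> x y\<bar> \<partial>lborel) * ennreal (exp ((norm y)\<^sup>2 / 4))"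
      using d[of y] by (intro mult_right_mono mult_left_mono) auto
    also have "\<dots> = ennreal (1 / \<theta>) * (\<integral>\<^sup>+\<tau>. indicator {0..\<theta>} \<tau> * ennreal (\<bar>mehler_dtheta \<tau> x y\<bar> * exp ((norm y)\<^sup>2 / 4)) \<partial>lborel)"
      unfolding mult.assoc by (subst nn_integral_multc[symmetric]) (auto simp: ennreal_mult mult.assoc)
    finally show "ennreal (\<bar>res_ker \<theta> x y\<bar> * exp ((norm y)\<^sup>2 / 4)) \<le> \<dots>" .
  qed
  also have "\<dots> = ennreal (1 / \<theta>) * (\<integral>\<^sup>+\<tau>. (\<integral>\<^sup>+y. indicator {0..\<theta>} \<tau> * ennreal (\<bar>mehler_dtheta \<tau> x y\<bar> * exp ((norm y)\<^sup>2 / 4)) \<partial>lborel) \<partial>lborel)"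
    by (subst nn_integral_cmult, simp, subst lborel_pair.Fubini') (auto simp: borel_prod)
  also have "\<dots> \<le> ennreal (1 / \<theta>) * (\<integral>\<^sup>+\<tau>. ennreal (256 * gauss4 * exp (- (norm x)\<^sup>2 / 4)) * indicator {0..\<theta>} \<tau> \<partial>lborel)"
    using mehler_dtheta_weight_bound_small[of _ x] True by (intro mult_left_mono nn_integral_mono) (auto simp: indicator_def)
  also have "\<dots> = ennreal (1 / \<theta>) * (ennreal (256 * gauss4 * exp (- (norm x)\<^sup>2 / 4)) * ennreal \<theta>)"
    using assms by (subst nn_integral_cmult_indicator) auto
  also have "\<dots> = ennreal (256 * gauss4 * exp (- (norm x)\<^sup>2 / 4))"
    using assms gauss4_nonneg by (simp flip: ennreal_mult)
  finally show ?thesis .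
next
  case False
  have sin: "sin \<theta> \<ge> 1/4" using False assms by (intro sin_ge_quarter) auto
  have c: "cos \<theta> \<noteq> 0" using cos_gt_zero_pi[of \<theta>] assms by simp
  have "\<bar>cos \<theta> / (2 * sin \<theta>)\<bar> \<le> 2"
    using sin by (simp add: abs_divide divide_le_eq order_trans[OF abs_cos_le_one])
  then have k: "\<bar>res_ker \<theta> x y\<bar> \<le> 2 * (mehler \<theta> x y + mehler 0 x y)" for y
    unfolding res_ker_def abs_mult using mehler_nonneg[of \<theta> x y] mehler_nonneg[of 0 x y] by (intro mult_mono) auto
  have q: "mehler t x y \<le> mehler t x y * (1 + norm (mehler_arg t x y))\<^sup>2" for t y
    using mehler_nonneg[of t x y] by (intro mult_le_cancel_left1[THEN iffD2]) auto
  have "wint (\<lambda>y. \<bar>res_ker \<theta> x y\<bar>)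
     \<le> (\<integral>\<^sup>+y. ennreal 2 * (ennreal (mehler \<theta> x y * (1 + norm (mehler_arg \<theta> x y))\<^sup>2 * exp ((norm y)\<^sup>2 / 4)) + ennreal (mehler 0 x y * (1 + norm (mehler_arg 0 x y))\<^sup>2 * exp ((norm y)\<^sup>2 / 4))) \<partial>lborel)"
  proof (intro nn_integral_mono)
    fix y
    have "\<bar>res_ker \<theta> x y\<bar> * exp ((norm y)\<^sup>2 / 4) \<le> (2 * (mehler \<theta> x y * (1 + norm (mehler_arg \<theta> x y))\<^sup>2 + mehler 0 x y * (1 + norm (mehler_arg 0 x y))\<^sup>2)) * exp ((norm y)\<^sup>2 / 4)"
      using k[of y] q[of \<theta> y] q[of 0 y] by (intro mult_right_mono) auto
    then have "ennreal (\<bar>res_ker \<theta> x y\<bar> * exp ((norm y)\<^sup>2 / 4)) \<le> ennreal (2 * (mehler \<theta> x y * (1 + norm (mehler_arg \<theta> x y))\<^sup>2 * exp ((norm y)\<^sup>2 / 4) + mehler 0 x y * (1 + norm (mehler_arg 0 x y))\<^sup>2 * exp ((norm y)\<^sup>2 / 4)))"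
      by (intro ennreal_leI) (simp add: algebra_simps)
    then show "ennreal (\<bar>res_ker \<theta> x y\<bar> * exp ((norm y)\<^sup>2 / 4)) \<le> ennreal 2 * (ennreal (mehler \<theta> x y * (1 + norm (mehler_arg \<theta> x y))\<^sup>2 * exp ((norm y)\<^sup>2 / 4)) + ennreal (mehler 0 x y * (1 + norm (mehler_arg 0 x y))\<^sup>2 * exp ((norm y)\<^sup>2 / 4)))"
      by (simp only: ennreal_mult' ennreal_plus mehler_nonneg mult_nonneg_nonneg zero_le_power2 exp_ge_zero zero_le_numeral)
  qed
  also have "\<dots> \<le> ennreal 2 * (ennreal (16 * gauss4 * exp (- (norm x)\<^sup>2 / 4)) + ennreal (16 * gauss4 * exp (- (norm x)\<^sup>2 / 4)))"
    using mehler_weight_bound[OF c, of x] mehler_weight_bound[of 0 x]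
    by (subst nn_integral_cmult, simp, subst nn_integral_add) (auto intro!: mult_left_mono add_mono)
  also have "\<dots> \<le> ennreal (256 * gauss4 * exp (- (norm x)\<^sup>2 / 4))"
  proof -
    have "2 * (16 * gauss4 * exp (- (norm x)\<^sup>2 / 4) + 16 * gauss4 * exp (- (norm x)\<^sup>2 / 4)) \<le> 256 * gauss4 * exp (- (norm x)\<^sup>2 / 4)"
      using gauss4_nonneg by simp
    then show ?thesis
      using gauss4_nonneg by (simp only: ennreal_leI mult_nonneg_nonneg exp_ge_zero zero_le_numeral flip: ennreal_plus ennreal_mult')
  qed
  finally show ?thesis .
qed

lemma res_ker_grad_weight_bound:
  assumes "0 < \<theta>" "\<theta> < pi/2"
  shows "wint (\<lambda>y. \<bar>res_ker_grad j \<theta> x y\<bar>) \<le> ennreal (256 * gauss4 * (1 + norm x) * exp (- (norm x)\<^sup>2 / 4))"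
proof -
  have c: "cos \<theta> \<noteq> 0" using cos_gt_zero_pi[of \<theta>] assms by simp
  have "wint (\<lambda>y. \<bar>res_ker_grad j \<theta> x y\<bar>)
     \<le> (\<integral>\<^sup>+y. ennreal (norm x) * ennreal (\<bar>res_ker \<theta> x y\<bar> * exp ((norm y)\<^sup>2 / 4)) + ennreal (mehler \<theta> x y * (1 + norm (mehler_arg \<theta> x y))\<^sup>2 * exp ((norm y)\<^sup>2 / 4)) \<partial>lborel)"
  proof (intro nn_integral_mono)
    fix y
    have z: "\<bar>mehler_arg \<theta> x y $ j\<bar> \<le> (1 + norm (mehler_arg \<theta> x y))\<^sup>2"
      using component_le_norm_cart[of "mehler_arg \<theta> x y" j] norm_ge_zero[of "mehler_arg \<theta> x y"]
      by (simp add: power2_sum) (smt (verit) zero_le_power2)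
    have "\<bar>res_ker_grad j \<theta> x y\<bar> \<le> \<bar>x $ j\<bar> * \<bar>res_ker \<theta> x y\<bar> + mehler \<theta> x y * \<bar>mehler_arg \<theta> x y $ j\<bar>"
      unfolding res_ker_grad_def using mehler_nonneg[of \<theta> x y] by (intro order_trans[OF abs_triangle_ineq]) (simp add: abs_mult)
    also have "\<dots> \<le> norm x * \<bar>res_ker \<theta> x y\<bar> + mehler \<theta> x y * (1 + norm (mehler_arg \<theta> x y))\<^sup>2"
      using mehler_nonneg[of \<theta> x y] by (intro add_mono mult_right_mono mult_left_mono component_le_norm_cart z) auto
    finally have "\<bar>res_ker_grad j \<theta> x y\<bar> * exp ((norm y)\<^sup>2 / 4) \<le> (norm x * \<bar>res_ker \<theta> x y\<bar> + mehler \<theta> x y * (1 + norm (mehler_arg \<theta> x y))\<^sup>2) * exp ((norm y)\<^sup>2 / 4)"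
      by (intro mult_right_mono) auto
    then have "ennreal (\<bar>res_ker_grad j \<theta> x y\<bar> * exp ((norm y)\<^sup>2 / 4)) \<le> ennreal (norm x * (\<bar>res_ker \<theta> x y\<bar> * exp ((norm y)\<^sup>2 / 4)) + mehler \<theta> x y * (1 + norm (mehler_arg \<theta> x y))\<^sup>2 * exp ((norm y)\<^sup>2 / 4))"
      by (intro ennreal_leI) (simp add: algebra_simps)
    then show "ennreal (\<bar>res_ker_grad j \<theta> x y\<bar> * exp ((norm y)\<^sup>2 / 4)) \<le> ennreal (norm x) * ennreal (\<bar>res_ker \<theta> x y\<bar> * exp ((norm y)\<^sup>2 / 4)) + ennreal (mehler \<theta> x y * (1 + norm (mehler_arg \<theta> x y))\<^sup>2 * exp ((norm y)\<^sup>2 / 4))"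
      by (simp only: ennreal_mult' ennreal_plus mehler_nonneg mult_nonneg_nonneg zero_le_power2 exp_ge_zero norm_ge_zero abs_ge_zero)
  qed
  also have "\<dots> \<le> ennreal (norm x) * ennreal (256 * gauss4 * exp (- (norm x)\<^sup>2 / 4)) + ennreal (16 * gauss4 * exp (- (norm x)\<^sup>2 / 4))"
    using res_ker_weight_bound[OF assms, of x] mehler_weight_bound[OF c, of x]
    by (subst nn_integral_add, simp, simp, subst nn_integral_cmult) (auto intro!: mult_left_mono add_mono)
  also have "\<dots> \<le> ennreal (256 * gauss4 * (1 + norm x) * exp (- (norm x)\<^sup>2 / 4))"
    using gauss4_nonneg by (subst ennreal_mult'[symmetric], simp, subst ennreal_plus[symmetric]) (auto intro!: ennreal_leI simp: algebra_simps)
  finally show ?thesis .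
qed

section \<open>Integration by parts against the kernel\<close>

text \<open>A class for functions of x at fixed \<theta> and y, on which the constant may depend. It
  provides the square integrability that integration by parts asks for; n counts polynomial factors,
  and n = 2 covers second derivatives of the kernel.\<close>

definition gauss_bd :: "nat \<Rightarrow> (real^2 \<Rightarrow> real) \<Rightarrow> bool" where
  "gauss_bd n f \<longleftrightarrow> (\<exists>C\<ge>0. \<forall>x. \<bar>f x\<bar> \<le> C * (1 + norm x) ^ n * exp (- (norm x)\<^sup>2 / 2))"

lemma gauss_bd_add: "gauss_bd n f \<Longrightarrow> gauss_bd n g \<Longrightarrow> gauss_bd n (\<lambda>x. f x + g x)"
proof -
  assume "gauss_bd n f" "gauss_bd n g"
  then obtain C D where *: "C \<ge> 0" "D \<ge> 0" "\<And>x. \<bar>f x\<bar> \<le> C * (1 + norm x) ^ n * exp (- (norm x)\<^sup>2 / 2)"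
    "\<And>x. \<bar>g x\<bar> \<le> D * (1 + norm x) ^ n * exp (- (norm x)\<^sup>2 / 2)" by (auto simp: gauss_bd_def)
  have "\<bar>f x + g x\<bar> \<le> (C + D) * (1 + norm x) ^ n * exp (- (norm x)\<^sup>2 / 2)" for x
    using *(3)[of x] *(4)[of x] abs_triangle_ineq[of "f x" "g x"] by (simp add: distrib_right)
  then show ?thesis unfolding gauss_bd_def using * by (intro exI[of _ "C + D"]) auto
qed

lemma gauss_bd_mult:
  assumes "gauss_bd n f" "\<And>x. \<bar>l x\<bar> \<le> D * (1 + norm x) ^ m"
  shows "gauss_bd (n + m) (\<lambda>x. l x * f x)"
proof -
  from assms obtain C where *: "C \<ge> 0" "\<And>x. \<bar>f x\<bar> \<le> C * (1 + norm x) ^ n * exp (- (norm x)\<^sup>2 / 2)" by (auto simp: gauss_bd_def)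
  have D: "D \<ge> 0" using order_trans[OF abs_ge_zero assms(2)[of 0]] by simp
  have "\<bar>l x * f x\<bar> \<le> (D * C) * (1 + norm x) ^ (n + m) * exp (- (norm x)\<^sup>2 / 2)" for x
  proof -
    have "\<bar>l x * f x\<bar> \<le> (D * (1 + norm x) ^ m) * (C * (1 + norm x) ^ n * exp (- (norm x)\<^sup>2 / 2))"
      unfolding abs_mult using * assms(2) D by (intro mult_mono) auto
    then show ?thesis by (simp add: power_add mult_ac)
  qed
  then show ?thesis unfolding gauss_bd_def using * D by (intro exI[of _ "D * C"]) auto
qed

lemma gauss_bd_cmult: "gauss_bd n f \<Longrightarrow> gauss_bd n (\<lambda>x. c * f x)"
  using gauss_bd_mult[of n f "\<lambda>x. c" "\<bar>c\<bar>" 0] by simp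

lemma gauss_bd_mono:
  assumes "gauss_bd n f" "n \<le> m" shows "gauss_bd m f"
proof -
  have "1 \<le> (1 + norm x) ^ (m - n)" for x :: "real^2" by (rule one_le_power) simp
  then show ?thesis using gauss_bd_mult[OF assms(1), of "\<lambda>x. 1" 1 "m - n"] assms(2) by simp
qed

lemma gauss_bd_diff: "gauss_bd n f \<Longrightarrow> gauss_bd n g \<Longrightarrow> gauss_bd n (\<lambda>x. f x - g x)"
  using gauss_bd_add[OF _ gauss_bd_cmult, of n f g "-1"] by simp

lemma exp_gauss_L2:
  assumes [measurable]: "f \<in> borel_measurable borel" and "\<And>x. norm (f x) \<le> C * exp (- (norm x)\<^sup>2 / 4)"
  shows "f \<in> L2"
proof (rule L2_bound[of "\<lambda>x. of_real (exp (- (norm x)\<^sup>2 / 4))" _ C])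
  have "integrable lborel (\<lambda>x::real^2. exp (- (1/2) * (norm x)\<^sup>2))" by (rule gaussian_integrable) simp
  also have "(\<lambda>x::real^2. exp (- (1/2) * (norm x)\<^sup>2)) = (\<lambda>x. (norm (complex_of_real (exp (- (norm x)\<^sup>2 / 4))))\<^sup>2)"
    by (simp add: fun_eq_iff flip: exp_double)
  finally show "(\<lambda>x. complex_of_real (exp (- (norm x)\<^sup>2 / 4))) \<in> L2" by (simp add: L2_def)
qed (use assms in auto)

lemma exp_gauss_poly_L2:
  assumes f: "f \<in> borel_measurable borel" and b: "\<And>x. norm (f x) \<le> C * (1 + norm x)\<^sup>2 * exp (- (norm x)\<^sup>2 / 4)"
  shows "f \<in> L2"
proof (rule L2_bound[of "\<lambda>x. of_real ((1 + norm x)\<^sup>2 * exp (- (norm x)\<^sup>2 / 4))" _ C])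
  have *: "integrable lborel (\<lambda>x::real^2. 65536 * exp (- (1/4) * (norm x)\<^sup>2))"
    by (intro integrable_mult_right gaussian_integrable) simp
  have "integrable lborel (\<lambda>x::real^2. ((1 + norm x)\<^sup>2 * exp (- (norm x)\<^sup>2 / 4))\<^sup>2)"
  proof (rule Bochner_Integration.integrable_bound[OF *])
    show "AE x in lborel. norm (((1 + norm (x::real^2))\<^sup>2 * exp (- (norm x)\<^sup>2 / 4))\<^sup>2) \<le> norm (65536 * exp (- (1/4) * (norm x)\<^sup>2))"
    proof (rule AE_I2)
      fix x :: "real^2"
      define s where "s = norm x"
      \<comment> \<open>Rescaling by sqrt 2 halves the exponent, so that the fourth power of 1 + s
        costs only exp (s^2 / 4) out of exp (s^2 / 2).\<close>
      have 1: "1 + s / sqrt 2 \<le> 4 * exp ((s / sqrt 2)\<^sup>2 / 8)" by (rule one_plus_le_exp) (simp add: s_def)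
      have "1 \<le> sqrt 2" by simp
      then have "1 + s \<le> sqrt 2 * (1 + s / sqrt 2)" by (simp add: distrib_left)
      also have "\<dots> \<le> 2 * (4 * exp ((s / sqrt 2)\<^sup>2 / 8))"
        using 1 sqrt2_less_2 by (intro mult_mono) (auto simp: s_def)
      finally have "1 + s \<le> 8 * exp (s\<^sup>2 / 16)" by (simp add: power_divide)
      then have "(1 + s) ^ 4 \<le> (8 * exp (s\<^sup>2 / 16)) ^ 4" by (intro power_mono) (auto simp: s_def)
      also have "\<dots> = 4096 * exp (s\<^sup>2 / 4)" by (simp add: power_mult_distrib flip: exp_of_nat_mult)
      finally have 2: "(1 + s) ^ 4 \<le> 65536 * exp (s\<^sup>2 / 4)" by (rule order_trans) simp
      have "((1 + s)\<^sup>2 * exp (- s\<^sup>2 / 4))\<^sup>2 = (1 + s) ^ 4 * exp (- s\<^sup>2 / 2)"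
        by (simp add: power_mult_distrib flip: power_mult exp_double)
      also have "\<dots> \<le> 65536 * exp (s\<^sup>2 / 4) * exp (- s\<^sup>2 / 2)" using 2 by (intro mult_right_mono) auto
      also have "\<dots> = 65536 * exp (- (1/4) * s\<^sup>2)" by (simp flip: exp_add)
      finally show "norm (((1 + norm x)\<^sup>2 * exp (- (norm x)\<^sup>2 / 4))\<^sup>2) \<le> norm (65536 * exp (- (1/4) * (norm x)\<^sup>2))"
        by (simp add: s_def)
    qed
  qed simp
  then show "(\<lambda>x. complex_of_real ((1 + norm x)\<^sup>2 * exp (- (norm x)\<^sup>2 / 4))) \<in> L2"
    unfolding L2_def mem_Collect_eq norm_of_real power2_abs by auto
qed (use assms in \<open>auto simp: abs_mult mult.assoc simp del: of_real_mult of_real_power of_real_add\<close>)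

lemma gauss_bd_L2:
  assumes "gauss_bd 2 f" "f \<in> borel_measurable borel" shows "(\<lambda>x. complex_of_real (f x)) \<in> L2"
proof -
  obtain C where C: "C \<ge> 0" "\<And>x. \<bar>f x\<bar> \<le> C * (1 + norm x)\<^sup>2 * exp (- (norm x)\<^sup>2 / 2)"
    using assms by (auto simp: gauss_bd_def)
  have "\<bar>f x\<bar> \<le> C * (1 + norm x)\<^sup>2 * exp (- (norm x)\<^sup>2 / 4)" for x
    using C(1) by (intro order_trans[OF C(2)] mult_left_mono) auto
  then show ?thesis using assms(2) by (intro exp_gauss_poly_L2[of _ C]) auto
qed

lemma gauss_bd_mehler: "gauss_bd 0 (\<lambda>x. mehler \<theta> x y)"
  unfolding gauss_bd_def
proof (intro exI[of _ "1 / (cos \<theta>)\<^sup>2"] conjI allI)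
  fix x
  have "exp (- (norm x)\<^sup>2 / 2) * exp (- (norm (mehler_arg \<theta> x y))\<^sup>2) / (cos \<theta>)\<^sup>2 \<le> exp (- (norm x)\<^sup>2 / 2) * 1 / (cos \<theta>)\<^sup>2"
    by (intro divide_right_mono mult_left_mono) auto
  then show "\<bar>mehler \<theta> x y\<bar> \<le> 1 / (cos \<theta>)\<^sup>2 * (1 + norm x) ^ 0 * exp (- (norm x)\<^sup>2 / 2)"
    by (simp add: mehler_nonneg) (simp add: mehler_def)
qed simp

lemma gauss_bd_res_ker: "gauss_bd 0 (\<lambda>x. res_ker \<theta> x y)"
  unfolding res_ker_def by (intro gauss_bd_cmult gauss_bd_diff gauss_bd_mehler)

lemma nth_bd: "\<bar>x $ j\<bar> \<le> 1 * (1 + norm x) ^ 1"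
  using component_le_norm_cart[of x j] by simp

lemma mehler_arg_bd: "\<exists>C. \<forall>x. \<bar>mehler_arg \<theta> x y $ j\<bar> \<le> C * (1 + norm x) ^ 1"
proof (intro exI[of _ "\<bar>1 / cos \<theta>\<bar> * (1 + norm y)"] allI)
  fix x :: "real^2"
  have 1: "\<bar>sin \<theta>\<bar> * norm x \<le> 1 * norm x" by (intro mult_right_mono) auto
  have "\<bar>mehler_arg \<theta> x y $ j\<bar> \<le> norm (mehler_arg \<theta> x y)" by (rule component_le_norm_cart)
  also have "\<dots> = \<bar>1 / cos \<theta>\<bar> * norm (y - sin \<theta> *\<^sub>R x)" by (simp add: mehler_arg_def)
  also have "\<dots> \<le> \<bar>1 / cos \<theta>\<bar> * ((1 + norm y) * (1 + norm x))"
  proof (intro mult_left_mono)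
    have "norm (y - sin \<theta> *\<^sub>R x) \<le> norm y + norm x" using norm_triangle_ineq4[of y "sin \<theta> *\<^sub>R x"] 1 by simp
    also have "\<dots> \<le> (1 + norm y) * (1 + norm x)" by (simp add: algebra_simps)
    finally show "norm (y - sin \<theta> *\<^sub>R x) \<le> (1 + norm y) * (1 + norm x)" .
  qed simp
  finally show "\<bar>mehler_arg \<theta> x y $ j\<bar> \<le> \<bar>1 / cos \<theta>\<bar> * (1 + norm y) * (1 + norm x) ^ 1" by simp
qed

lemma gauss_bd_nth: "gauss_bd n f \<Longrightarrow> gauss_bd (Suc n) (\<lambda>x. x $ j * f x)"
  using gauss_bd_mult[of n f "\<lambda>x. x $ j" 1 1, OF _ nth_bd] by simp

lemma gauss_bd_mehler_arg: "gauss_bd n f \<Longrightarrow> gauss_bd (Suc n) (\<lambda>x. mehler_arg \<theta> x y $ j * f x)"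
  using mehler_arg_bd[of \<theta> y j] gauss_bd_mult[of n f "\<lambda>x. mehler_arg \<theta> x y $ j" _ 1] by auto

lemma gauss_bd_res_ker_grad: "gauss_bd 1 (\<lambda>x. res_ker_grad j \<theta> x y)"
proof -
  have "gauss_bd 1 (\<lambda>x. mehler_arg \<theta> x y $ j * mehler \<theta> x y - x $ j * res_ker \<theta> x y)"
    unfolding One_nat_def by (intro gauss_bd_diff gauss_bd_mehler_arg gauss_bd_nth gauss_bd_mehler gauss_bd_res_ker)
  then show ?thesis by (simp add: res_ker_grad_def mult.commute)
qed

section \<open>Derivatives of the kernel in the space variable\<close>

lemma mehler_arg_has_derivative: "((\<lambda>x. mehler_arg \<theta> x y) has_derivative (\<lambda>h. - (sin \<theta> / cos \<theta>) *\<^sub>R h)) (at x)"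
  unfolding mehler_arg_def by (auto intro!: derivative_eq_intros)

lemma norm_sq_has_derivative:
  assumes "(f has_derivative f') (at x)"
  shows "((\<lambda>x. (norm (f x :: real^2))\<^sup>2) has_derivative (\<lambda>h. 2 * (f x \<bullet> f' h))) (at x)"
  unfolding power2_norm_eq_inner using has_derivative_inner[OF assms assms] by (simp add: inner_commute)

lemma nth_has_derivative:
  assumes "(f has_derivative f') (at x)"
  shows "((\<lambda>x. (f x :: real^2) $ j) has_derivative (\<lambda>h. f' h $ j)) (at x)"
  using bounded_linear.has_derivative[OF bounded_linear_vec_nth assms] .

lemma has_derivative_divide_const:
  "(f has_derivative f') (at x) \<Longrightarrow> ((\<lambda>x. f x / c) has_derivative (\<lambda>h. f' h / (c::real))) (at x)"
  using has_derivative_mult_left[of f f' "at x" "1/c"] by simp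

lemma mehler_has_derivative:
  "((\<lambda>x. mehler \<theta> x y) has_derivative (\<lambda>h. mehler \<theta> x y * (2 * (sin \<theta> / cos \<theta>) * (mehler_arg \<theta> x y \<bullet> h) - x \<bullet> h))) (at x)"
proof -
  have n: "((\<lambda>x::real^2. (norm x)\<^sup>2) has_derivative (\<lambda>h. 2 * (x \<bullet> h))) (at x)"
    by (rule norm_sq_has_derivative) simp
  have m: "((\<lambda>x. (norm (mehler_arg \<theta> x y))\<^sup>2) has_derivative (\<lambda>h. 2 * (mehler_arg \<theta> x y \<bullet> (- (sin \<theta> / cos \<theta>) *\<^sub>R h)))) (at x)"
    by (rule norm_sq_has_derivative[OF mehler_arg_has_derivative])
  show ?thesis
    unfolding mehler_def
  proof (rule has_derivative_eq_rhs)
    show "((\<lambda>x. exp (- (norm x)\<^sup>2 / 2) * exp (- (norm (mehler_arg \<theta> x y))\<^sup>2) / (cos \<theta>)\<^sup>2) has_derivative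
      (\<lambda>h. (exp (- (norm x)\<^sup>2 / 2) * (- (2 * (mehler_arg \<theta> x y \<bullet> (- (sin \<theta> / cos \<theta>) *\<^sub>R h))) * exp (- (norm (mehler_arg \<theta> x y))\<^sup>2))
          + (- (2 * (x \<bullet> h)) / 2 * exp (- (norm x)\<^sup>2 / 2)) * exp (- (norm (mehler_arg \<theta> x y))\<^sup>2)) / (cos \<theta>)\<^sup>2)) (at x)"
      by (intro has_derivative_divide_const has_derivative_mult has_derivative_exp has_derivative_minus n m)
    show "(\<lambda>h. (exp (- (norm x)\<^sup>2 / 2) * (- (2 * (mehler_arg \<theta> x y \<bullet> (- (sin \<theta> / cos \<theta>) *\<^sub>R h))) * exp (- (norm (mehler_arg \<theta> x y))\<^sup>2))
          + (- (2 * (x \<bullet> h)) / 2 * exp (- (norm x)\<^sup>2 / 2)) * exp (- (norm (mehler_arg \<theta> x y))\<^sup>2)) / (cos \<theta>)\<^sup>2)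
      = (\<lambda>h. exp (- (norm x)\<^sup>2 / 2) * exp (- (norm (mehler_arg \<theta> x y))\<^sup>2) / (cos \<theta>)\<^sup>2 * (2 * (sin \<theta> / cos \<theta>) * (mehler_arg \<theta> x y \<bullet> h) - x \<bullet> h))"
      by (simp add: fun_eq_iff add_divide_distrib diff_divide_distrib algebra_simps)
  qed
qed

lemma res_ker_has_derivative:
  assumes "sin \<theta> \<noteq> 0" "cos \<theta> \<noteq> 0"
  shows "((\<lambda>x. res_ker \<theta> x y) has_derivative (\<lambda>h. mehler \<theta> x y * (mehler_arg \<theta> x y \<bullet> h) - res_ker \<theta> x y * (x \<bullet> h))) (at x)"
  unfolding res_ker_def using assms
  by (auto intro!: derivative_eq_intros mehler_has_derivative simp: field_simps)

lemma res_ker_grad_has_derivative: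
  assumes "sin \<theta> \<noteq> 0" "cos \<theta> \<noteq> 0"
  shows "((\<lambda>x. res_ker_grad j \<theta> x y) has_derivative (\<lambda>h. - (h $ j) * res_ker \<theta> x y
     - x $ j * (mehler \<theta> x y * (mehler_arg \<theta> x y \<bullet> h) - res_ker \<theta> x y * (x \<bullet> h))
     + mehler \<theta> x y * (2 * (sin \<theta> / cos \<theta>) * (mehler_arg \<theta> x y \<bullet> h) - x \<bullet> h) * mehler_arg \<theta> x y $ j
     - mehler \<theta> x y * (sin \<theta> / cos \<theta>) * h $ j)) (at x)"
  unfolding res_ker_grad_def
  by (auto intro!: derivative_eq_intros mehler_has_derivative res_ker_has_derivative assms nth_has_derivative[OF mehler_arg_has_derivative]
      nth_has_derivative[OF has_derivative_ident] simp: algebra_simps)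

lemma norm_sq_sum: "(norm (x::real^2))\<^sup>2 = (\<Sum>i\<in>UNIV. (x $ i)\<^sup>2)"
  unfolding power2_norm_eq_inner inner_vec_def by (simp add: power2_eq_square)

text \<open>Expanding the square separates the coordinates of x: the kernel is a product of
  \<open>poly_gauss\<close> factors and a constant that depends on y and \<theta>.\<close>

lemma C_k_mehler:
  assumes "cos \<theta> \<noteq> 0"
  shows "C_k k (\<lambda>x. of_real (mehler \<theta> x y))"
proof -
  let ?A = "1/2 + (sin \<theta>)\<^sup>2 / (cos \<theta>)\<^sup>2" and ?B = "\<lambda>i. 2 * sin \<theta> * y $ i / (cos \<theta>)\<^sup>2"
  have "mehler \<theta> x y = (\<Prod>i\<in>UNIV. poly_gauss 1 ?A (?B i) (x $ i)) * (exp (- (norm y)\<^sup>2 / (cos \<theta>)\<^sup>2) / (cos \<theta>)\<^sup>2)" for x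
  proof -
    have "(\<Prod>i\<in>UNIV. poly_gauss 1 ?A (?B i) (x $ i)) = exp (\<Sum>i\<in>UNIV. ?B i * x $ i - ?A * (x $ i)\<^sup>2)"
      by (simp add: poly_gauss_def exp_sum)
    also have "(\<Sum>i\<in>UNIV. ?B i * x $ i - ?A * (x $ i)\<^sup>2) = 2 * sin \<theta> * (x \<bullet> y) / (cos \<theta>)\<^sup>2 - ?A * (norm x)\<^sup>2"
      unfolding norm_sq_sum inner_vec_def UNIV_2 by (simp add: algebra_simps add_divide_distrib)
    finally have 1: "(\<Prod>i\<in>UNIV. poly_gauss 1 ?A (?B i) (x $ i)) = exp (2 * sin \<theta> * (x \<bullet> y) / (cos \<theta>)\<^sup>2 - ?A * (norm x)\<^sup>2)" .
    have 2: "- (norm x)\<^sup>2 / 2 + - (norm (mehler_arg \<theta> x y))\<^sup>2 = (2 * sin \<theta> * (x \<bullet> y) / (cos \<theta>)\<^sup>2 - ?A * (norm x)\<^sup>2) + - (norm y)\<^sup>2 / (cos \<theta>)\<^sup>2"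
      unfolding norm_mehler_arg_sq by (simp add: power2_norm_eq_inner add_divide_distrib diff_divide_distrib algebra_simps)
    show ?thesis unfolding mehler_def 1 exp_add[symmetric] 2 by (simp only: exp_add times_divide_eq_right)
  qed
  then have "(\<lambda>x. complex_of_real (mehler \<theta> x y)) = (\<lambda>x. (\<Prod>i\<in>UNIV. of_real (poly_gauss 1 ?A (?B i) (x $ i))) * of_real (exp (- (norm y)\<^sup>2 / (cos \<theta>)\<^sup>2) / (cos \<theta>)\<^sup>2))"
    by (simp only: of_real_mult of_real_prod)
  then show ?thesis by (simp only:) (intro C_k_mult C_k_prod C_k_const C_k_poly_gauss, simp)
qed

lemma C_k_res_ker:
  assumes "cos \<theta> \<noteq> 0"
  shows "C_k k (\<lambda>x. of_real (res_ker \<theta> x y))"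
  unfolding res_ker_def of_real_mult of_real_diff using assms
  by (intro C_k_mult C_k_const C_k_diff C_k_mehler) auto

lemma C_k_res_ker_grad:
  assumes "cos \<theta> \<noteq> 0"
  shows "C_k k (\<lambda>x. of_real (res_ker_grad j \<theta> x y))"
proof -
  have "(\<lambda>x. complex_of_real (res_ker_grad j \<theta> x y)) = (\<lambda>x. of_real (mehler \<theta> x y) * (of_real (1 / cos \<theta>) * (of_real (y $ j) - of_real (sin \<theta>) * of_real (x $ j))) - of_real (x $ j) * of_real (res_ker \<theta> x y))"
    by (simp add: res_ker_grad_def mehler_arg_def fun_eq_iff)
  then show ?thesis using assms
    by (simp only:) (intro C_k_mult C_k_diff C_k_const C_k_nth C_k_res_ker C_k_mehler)
qed

lemma inner_axis_1: "x \<bullet> axis j 1 = (x::real^2) $ j"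
  by (simp add: inner_axis)

text \<open>At fixed \<theta> and y the kernel is smooth and Gaussian in x, so derivatives can be
  moved onto it. The three identities serve, in this order, for the weak gradient of the resolvent,
  for the square completed in \<open>ansatz_energy_nonneg\<close>, and for the weak
  equation.\<close>

lemma
  assumes \<theta>: "0 < \<theta>" "\<theta> < pi/2" and v: "v \<in> L2" "g \<in> L2" "has_weak_partial v j g"
  shows res_ker_IBP: "(LINT x|lborel. v x * of_real (res_ker_grad j \<theta> x y)) = - (LINT x|lborel. g x * of_real (res_ker \<theta> x y))"
    and nth_res_ker_IBP: "(LINT x|lborel. v x * of_real (res_ker \<theta> x y + x $ j * res_ker_grad j \<theta> x y)) = - (LINT x|lborel. g x * of_real (x $ j * res_ker \<theta> x y))"
    and res_ker_grad_IBP: "(LINT x|lborel. v x * of_real (mehler \<theta> x y * (2 * (sin \<theta> / cos \<theta>) * (mehler_arg \<theta> x y $ j)\<^sup>2 - x $ j * mehler_arg \<theta> x y $ j - sin \<theta> / cos \<theta>) - res_ker \<theta> x y - x $ j * res_ker_grad j \<theta> x y))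
       = - (LINT x|lborel. g x * of_real (res_ker_grad j \<theta> x y))"
proof -
  have sc: "sin \<theta> \<noteq> 0" "cos \<theta> \<noteq> 0" using sin_gt_zero[of \<theta>] cos_gt_zero[of \<theta>] \<theta> pi_gt_zero by auto
  have res_ker_grad: "mehler \<theta> x y * mehler_arg \<theta> x y $ j - res_ker \<theta> x y * x $ j = res_ker_grad j \<theta> x y" for x by (simp add: res_ker_grad_def)
  have bd: "gauss_bd 2 (\<lambda>x. res_ker \<theta> x y)" "gauss_bd 2 (\<lambda>x. res_ker_grad j \<theta> x y)" "gauss_bd 2 (\<lambda>x. x $ j * res_ker \<theta> x y)" "gauss_bd 2 (\<lambda>x. x $ j * res_ker_grad j \<theta> x y)"
    using gauss_bd_mono[OF gauss_bd_res_ker] gauss_bd_mono[OF gauss_bd_res_ker_grad] gauss_bd_mono[OF gauss_bd_nth[OF gauss_bd_res_ker]] gauss_bd_nth[OF gauss_bd_res_ker_grad]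
    by (auto simp: numeral_2_eq_2)
  show "(LINT x|lborel. v x * of_real (res_ker_grad j \<theta> x y)) = - (LINT x|lborel. g x * of_real (res_ker \<theta> x y))"
    using weak_partial_IBP[OF v C_k_res_ker[OF sc(2), of _ y] _ has_derivative_of_real[OF res_ker_has_derivative[OF sc]]]
      gauss_bd_L2[OF bd(1)] gauss_bd_L2[OF bd(2)]
    by (simp add: inner_axis_1 res_ker_grad)
  have D: "((\<lambda>x. x $ j * res_ker \<theta> x y) has_derivative (\<lambda>h. x $ j * (mehler \<theta> x y * (mehler_arg \<theta> x y \<bullet> h) - res_ker \<theta> x y * (x \<bullet> h)) + h $ j * res_ker \<theta> x y)) (at x)" for x
    by (rule has_derivative_mult[OF nth_has_derivative[OF has_derivative_ident] res_ker_has_derivative[OF sc]])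
  show "(LINT x|lborel. v x * of_real (res_ker \<theta> x y + x $ j * res_ker_grad j \<theta> x y)) = - (LINT x|lborel. g x * of_real (x $ j * res_ker \<theta> x y))"
  proof -
    have C: "C_k k (\<lambda>x. complex_of_real (x $ j * res_ker \<theta> x y))" for k
      unfolding of_real_mult by (intro C_k_mult C_k_nth C_k_res_ker sc)
    show ?thesis
      using weak_partial_IBP[OF v C _ has_derivative_of_real[OF D]]
        gauss_bd_L2[OF bd(3)] gauss_bd_L2[OF gauss_bd_add[OF bd(1) bd(4)]]
      by (simp add: inner_axis_1 res_ker_grad add.commute)
  qed
  let ?f = "\<lambda>x. mehler \<theta> x y * (2 * (sin \<theta> / cos \<theta>) * (mehler_arg \<theta> x y $ j)\<^sup>2 - x $ j * mehler_arg \<theta> x y $ j - sin \<theta> / cos \<theta>) - res_ker \<theta> x y - x $ j * res_ker_grad j \<theta> x y"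
  have "gauss_bd 2 (\<lambda>x. 2 * (sin \<theta> / cos \<theta>) * (mehler_arg \<theta> x y $ j * (mehler_arg \<theta> x y $ j * mehler \<theta> x y)) - x $ j * (mehler_arg \<theta> x y $ j * mehler \<theta> x y) - sin \<theta> / cos \<theta> * mehler \<theta> x y - res_ker \<theta> x y - x $ j * res_ker_grad j \<theta> x y)"
    by (intro gauss_bd_diff bd gauss_bd_cmult) 
      (auto simp: numeral_2_eq_2 intro!: gauss_bd_mehler_arg gauss_bd_nth gauss_bd_mehler gauss_bd_mono[OF gauss_bd_mehler])
  moreover have "2 * (sin \<theta> / cos \<theta>) * (mehler_arg \<theta> x y $ j * (mehler_arg \<theta> x y $ j * mehler \<theta> x y)) - x $ j * (mehler_arg \<theta> x y $ j * mehler \<theta> x y) - sin \<theta> / cos \<theta> * mehler \<theta> x y - res_ker \<theta> x y - x $ j * res_ker_grad j \<theta> x y = ?f x" for x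
    by (simp add: power2_eq_square algebra_simps)
  ultimately have bd': "gauss_bd 2 ?f" by (simp only:)
  have "(\<lambda>x. complex_of_real (?f x)) \<in> L2" by (intro gauss_bd_L2 bd') measurable
  moreover have "- (axis j 1 $ j) * res_ker \<theta> x y
     - x $ j * (mehler \<theta> x y * (mehler_arg \<theta> x y \<bullet> axis j 1) - res_ker \<theta> x y * (x \<bullet> axis j 1))
     + mehler \<theta> x y * (2 * (sin \<theta> / cos \<theta>) * (mehler_arg \<theta> x y \<bullet> axis j 1) - x \<bullet> axis j 1) * mehler_arg \<theta> x y $ j
     - mehler \<theta> x y * (sin \<theta> / cos \<theta>) * axis j 1 $ j = ?f x" for x
    unfolding inner_axis_1 res_ker_grad by (simp add: power2_eq_square algebra_simps)
  ultimately show "(LINT x|lborel. v x * of_real (?f x)) = - (LINT x|lborel. g x * of_real (res_ker_grad j \<theta> x y))"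
    using weak_partial_IBP[OF v C_k_res_ker_grad[OF sc(2), of _ j y] gauss_bd_L2[OF bd(2)] has_derivative_of_real[OF res_ker_grad_has_derivative[OF sc]]]
    by (simp only:) simp
qed

text \<open>The heat equation for the Mehler kernel: applying \<open>H - 2\<close> to \<open>res_ker \<theta> \<sqdot> y\<close> gives the angular
  derivative of \<open>mehler \<theta> \<sqdot> y\<close>, because \<open>\<theta> = 0\<close> contributes nothing.\<close>

lemma mehler_dtheta_decomp:
  assumes "cos \<theta> \<noteq> 0"
  shows "((norm x)\<^sup>2 - 2) * res_ker \<theta> x y - (\<Sum>j\<in>UNIV. mehler \<theta> x y * (2 * (sin \<theta> / cos \<theta>) * (mehler_arg \<theta> x y $ j)\<^sup>2 - x $ j * mehler_arg \<theta> x y $ j - sin \<theta> / cos \<theta>) - res_ker \<theta> x y - x $ j * res_ker_grad j \<theta> x y)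
    = mehler_dtheta \<theta> x y"
  unfolding mehler_dtheta_def res_ker_grad_def norm_sq_sum inner_vec_def
  by (simp add: UNIV_2 power2_eq_square algebra_simps add_divide_distrib)

text \<open>The weak form of this heat equation at a fixed angle: once the derivatives sit on the
  kernel, the pointwise identity combines them with the potential term.\<close>

lemma mehler_dtheta_IBP:
  assumes \<theta>: "0 < \<theta>" "\<theta> < pi/2" and v: "v \<in> L2" "\<And>j. g j \<in> L2" "\<And>j. has_weak_partial v j (g j)"
  shows "(\<Sum>j\<in>UNIV. LINT x|lborel. g j x * of_real (res_ker_grad j \<theta> x y)) + (LINT x|lborel. v x * of_real (((norm x)\<^sup>2 - 2) * res_ker \<theta> x y))
    = (LINT x|lborel. v x * of_real (mehler_dtheta \<theta> x y))"
proof -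
  have sc: "sin \<theta> \<noteq> 0" "cos \<theta> \<noteq> 0" using sin_gt_zero[of \<theta>] cos_gt_zero[of \<theta>] \<theta> pi_gt_zero by auto
  let ?f = "\<lambda>j x. mehler \<theta> x y * (2 * (sin \<theta> / cos \<theta>) * (mehler_arg \<theta> x y $ j)\<^sup>2 - x $ j * mehler_arg \<theta> x y $ j - sin \<theta> / cos \<theta>) - res_ker \<theta> x y - x $ j * res_ker_grad j \<theta> x y"
  have f: "integrable lborel (\<lambda>x. v x * of_real (?f j x))" for j
  proof (intro L2_mult_integrable v gauss_bd_L2)
    have "gauss_bd 2 (\<lambda>x. 2 * (sin \<theta> / cos \<theta>) * (mehler_arg \<theta> x y $ j * (mehler_arg \<theta> x y $ j * mehler \<theta> x y)) - x $ j * (mehler_arg \<theta> x y $ j * mehler \<theta> x y) - sin \<theta> / cos \<theta> * mehler \<theta> x y - res_ker \<theta> x y - x $ j * res_ker_grad j \<theta> x y)"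
      by (intro gauss_bd_diff gauss_bd_cmult) 
        (auto simp: numeral_2_eq_2 intro!: gauss_bd_mehler_arg gauss_bd_nth gauss_bd_mehler gauss_bd_mono[OF gauss_bd_mehler] gauss_bd_mono[OF gauss_bd_res_ker] gauss_bd_res_ker_grad[unfolded One_nat_def])
    then show "gauss_bd 2 (?f j)" by (simp add: power2_eq_square algebra_simps)
  qed measurable
  have k: "integrable lborel (\<lambda>x. v x * of_real (((norm x)\<^sup>2 - 2) * res_ker \<theta> x y))"
  proof (intro L2_mult_integrable v gauss_bd_L2)
    have "gauss_bd 2 (\<lambda>x. x $ 1 * (x $ 1 * res_ker \<theta> x y) + x $ 2 * (x $ 2 * res_ker \<theta> x y) - 2 * res_ker \<theta> x y)"
      by (intro gauss_bd_diff gauss_bd_add gauss_bd_cmult) (auto simp: numeral_2_eq_2 intro!: gauss_bd_nth gauss_bd_res_ker gauss_bd_mono[OF gauss_bd_res_ker])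
    then show "gauss_bd 2 (\<lambda>x. ((norm x)\<^sup>2 - 2) * res_ker \<theta> x y)"
      unfolding norm_sq_sum UNIV_2 by (simp add: power2_eq_square algebra_simps)
  qed measurable
  have "(\<Sum>j\<in>UNIV. LINT x|lborel. g j x * of_real (res_ker_grad j \<theta> x y)) = - (\<Sum>j\<in>UNIV. LINT x|lborel. v x * of_real (?f j x))"
    using res_ker_grad_IBP[OF \<theta> v(1) v(2) v(3)] by (simp add: sum_negf)
  also have "\<dots> = - (LINT x|lborel. (\<Sum>j\<in>UNIV. v x * of_real (?f j x)))"
    by (subst Bochner_Integration.integral_sum) (use f in auto)
  finally have "(\<Sum>j\<in>UNIV. LINT x|lborel. g j x * of_real (res_ker_grad j \<theta> x y)) + (LINT x|lborel. v x * of_real (((norm x)\<^sup>2 - 2) * res_ker \<theta> x y))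
     = (LINT x|lborel. v x * of_real (((norm x)\<^sup>2 - 2) * res_ker \<theta> x y) - (\<Sum>j\<in>UNIV. v x * of_real (?f j x)))"
    by (subst Bochner_Integration.integral_diff) (use f k in auto)
  also have "\<dots> = (LINT x|lborel. v x * of_real (((norm x)\<^sup>2 - 2) * res_ker \<theta> x y - (\<Sum>j\<in>UNIV. ?f j x)))"
    by (simp only: of_real_diff of_real_sum right_diff_distrib sum_distrib_left)
  finally show ?thesis unfolding mehler_dtheta_decomp[OF sc(2)] .
qed

section \<open>Integral operators built from the kernel\<close>

abbreviation kint :: "(real \<Rightarrow> real^2 \<Rightarrow> real^2 \<Rightarrow> real) \<Rightarrow> (real^2 \<Rightarrow> complex) \<Rightarrow> real^2 \<Rightarrow> real \<times> (real^2) \<Rightarrow> complex" where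
  "kint m r x p \<equiv> indicator {0<..<pi/2} (fst p) *\<^sub>R (of_real (m (fst p) x (snd p) * exp ((norm (snd p))\<^sup>2 / 4)) * r (snd p))"

abbreviation dual_kint :: "(real \<Rightarrow> real^2 \<Rightarrow> real^2 \<Rightarrow> real) \<Rightarrow> (real^2 \<Rightarrow> complex) \<Rightarrow> (real^2 \<Rightarrow> complex) \<Rightarrow> real \<times> (real^2) \<Rightarrow> complex" where
  "dual_kint m r v p \<equiv> indicator {0<..<pi/2} (fst p) *\<^sub>R (of_real (exp ((norm (snd p))\<^sup>2 / 4)) * r (snd p) * (LINT x|lborel. v x * of_real (m (fst p) x (snd p))))"

text \<open>For \<open>m = res_ker\<close> this is \<open>gauss1\<close> times the reduced resolvent
  applied to exp (-|y|^2 / 4) r y. Angle and y are integrated jointly so that Fubini is available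
  for either order.\<close>

definition ker_int :: "(real \<Rightarrow> real^2 \<Rightarrow> real^2 \<Rightarrow> real) \<Rightarrow> (real^2 \<Rightarrow> complex) \<Rightarrow> real^2 \<Rightarrow> complex" where
  "ker_int m r x = (LINT p|lborel. kint m r x p)"

text \<open>The polynomial factor leaves room for the gradient kernel and for multiplication of
  kernels by x_j or |x|^2 - 2.\<close>

definition ker_bound :: "(real \<Rightarrow> real^2 \<Rightarrow> real^2 \<Rightarrow> real) \<Rightarrow> real \<Rightarrow> bool" where
  "ker_bound m C \<longleftrightarrow> C \<ge> 0 \<and> (\<lambda>p. m (fst p) (fst (snd p)) (snd (snd p))) \<in> borel_measurable borel \<and>
     (\<forall>\<theta> x. 0 < \<theta> \<longrightarrow> \<theta> < pi/2 \<longrightarrow> wint (\<lambda>y. \<bar>m \<theta> x y\<bar>)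
       \<le> ennreal (C * (1 + norm x)\<^sup>2 * exp (- (norm x)\<^sup>2 / 4)))"

definition bdd_by :: "(real^2 \<Rightarrow> complex) \<Rightarrow> real \<Rightarrow> bool" where
  "bdd_by r M \<longleftrightarrow> r \<in> borel_measurable borel \<and> (\<forall>x. norm (r x) \<le> M)"

lemma ker_bound_measurable:
  assumes "ker_bound m C" and [measurable]: "f \<in> borel_measurable M" "g \<in> borel_measurable M" "h \<in> borel_measurable M"
  shows "(\<lambda>x. m (f x) (g x) (h x)) \<in> borel_measurable M"
proof -
  have m: "(\<lambda>p. m (fst p) (fst (snd p)) (snd (snd p))) \<in> borel_measurable borel" using assms by (simp add: ker_bound_def)
  have "(\<lambda>x. (f x, g x, h x)) \<in> M \<rightarrow>\<^sub>M borel" by (simp add: borel_prod[symmetric])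
  from measurable_compose[OF this m] show ?thesis by (simp only: fst_conv snd_conv)
qed

lemma ker_int_nn_bound:
  assumes a: "ker_bound m C" and b: "bdd_by r M"
  shows "(\<integral>\<^sup>+p. ennreal (norm (kint m r x p)) \<partial>lborel)
    \<le> ennreal (pi/2 * M * C * (1 + norm x)\<^sup>2 * exp (- (norm x)\<^sup>2 / 4))"
proof -
  note [measurable] = ker_bound_measurable[OF a]
  have [measurable]: "r \<in> borel_measurable borel" and M: "\<And>x. norm (r x) \<le> M" using b by (auto simp: bdd_by_def)
  have M0: "0 \<le> M" using M[of 0] norm_ge_zero order_trans by blast
  have C0: "0 \<le> C" using a by (simp add: ker_bound_def)
  let ?B = "C * (1 + norm x)\<^sup>2 * exp (- (norm x)\<^sup>2 / 4)"
  have B0: "0 \<le> ?B" using C0 by simp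
  have "(\<integral>\<^sup>+p. ennreal (norm (kint m r x p)) \<partial>lborel)
    \<le> (\<integral>\<^sup>+p. indicator {0<..<pi/2} (fst p) * (ennreal M * ennreal (\<bar>m (fst p) x (snd p)\<bar> * exp ((norm (snd p))\<^sup>2 / 4))) \<partial>lborel)"
  proof (intro nn_integral_mono)
    fix p :: "real \<times> (real^2)"
    have "\<bar>m (fst p) x (snd p)\<bar> * exp ((norm (snd p))\<^sup>2 / 4) * norm (r (snd p)) \<le> \<bar>m (fst p) x (snd p)\<bar> * exp ((norm (snd p))\<^sup>2 / 4) * M"
      using M by (intro mult_left_mono) auto
    then show "ennreal (norm (kint m r x p))
      \<le> indicator {0<..<pi/2} (fst p) * (ennreal M * ennreal (\<bar>m (fst p) x (snd p)\<bar> * exp ((norm (snd p))\<^sup>2 / 4)))"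
      using M0 by (auto simp: indicator_def norm_mult abs_mult mult_ac intro!: ennreal_leI simp flip: ennreal_mult)
  qed
  also have "\<dots> = (\<integral>\<^sup>+\<theta>. \<integral>\<^sup>+y. indicator {0<..<pi/2} \<theta> * (ennreal M * ennreal (\<bar>m \<theta> x y\<bar> * exp ((norm y)\<^sup>2 / 4))) \<partial>lborel \<partial>lborel)"
    unfolding lborel_prod[symmetric] by (subst lborel.nn_integral_fst[symmetric]) (auto simp: borel_prod)
  also have "\<dots> = (\<integral>\<^sup>+\<theta>. indicator {0<..<pi/2} \<theta> * (ennreal M * wint (\<lambda>y. \<bar>m \<theta> x y\<bar>)) \<partial>lborel)"
    by (intro nn_integral_cong) (simp add: nn_integral_cmult)
  also have "\<dots> \<le> (\<integral>\<^sup>+\<theta>. ennreal (M * ?B) * indicator {0<..<pi/2} \<theta> \<partial>lborel)"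
  proof (intro nn_integral_mono)
    fix \<theta> :: real
    show "indicator {0<..<pi/2} \<theta> * (ennreal M * wint (\<lambda>y. \<bar>m \<theta> x y\<bar>)) \<le> ennreal (M * ?B) * indicator {0<..<pi/2} \<theta>"
    proof (cases "0 < \<theta> \<and> \<theta> < pi/2")
      case True
      then have "wint (\<lambda>y. \<bar>m \<theta> x y\<bar>) \<le> ennreal ?B" using a by (simp add: ker_bound_def)
      then have "ennreal M * wint (\<lambda>y. \<bar>m \<theta> x y\<bar>) \<le> ennreal M * ennreal ?B"
        by (intro mult_left_mono) auto
      then show ?thesis unfolding ennreal_mult[OF M0 B0] using True by simp
    qed (auto simp: indicator_def)
  qed
  also have "\<dots> = ennreal (M * ?B) * ennreal (pi/2)" by (subst nn_integral_cmult_indicator) auto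
  also have "\<dots> = ennreal (pi/2 * M * C * (1 + norm x)\<^sup>2 * exp (- (norm x)\<^sup>2 / 4))"
    by (subst ennreal_mult''[symmetric]) (auto simp: mult_ac)
  finally show ?thesis .
qed

lemma ker_int_integrable:
  assumes a: "ker_bound m C" and b: "bdd_by r M"
  shows "integrable lborel (\<lambda>p. kint m r x p)"
proof (rule integrableI_bounded)
  note [measurable] = ker_bound_measurable[OF a]
  have [measurable]: "r \<in> borel_measurable borel" using b by (auto simp: bdd_by_def)
  show "(\<lambda>p. kint m r x p) \<in> borel_measurable lborel"
    unfolding lborel_prod[symmetric] by measurable
qed (rule le_less_trans[OF ker_int_nn_bound[OF a b]], simp)

lemma ker_int_bound:
  assumes a: "ker_bound m C" and b: "bdd_by r M"
  shows "norm (ker_int m r x) \<le> pi/2 * M * C * (1 + norm x)\<^sup>2 * exp (- (norm x)\<^sup>2 / 4)"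
proof -
  have "0 \<le> M" using b norm_ge_zero order_trans unfolding bdd_by_def by blast
  moreover have "C \<ge> 0" using a by (simp add: ker_bound_def)
  ultimately have "0 \<le> pi/2 * M * C * (1 + norm x)\<^sup>2 * exp (- (norm x)\<^sup>2 / 4)" by simp
  moreover have "ennreal (norm (ker_int m r x)) \<le> ennreal (pi/2 * M * C * (1 + norm x)\<^sup>2 * exp (- (norm x)\<^sup>2 / 4))"
    unfolding ker_int_def by (rule order_trans[OF integral_norm_bound_ennreal[OF ker_int_integrable[OF a b]] ker_int_nn_bound[OF a b]])
  ultimately show ?thesis by simp
qed

lemma ker_int_measurable:
  assumes a: "ker_bound m C" and b: "bdd_by r M"
  shows "ker_int m r \<in> borel_measurable borel"
proof -
  note [measurable] = ker_bound_measurable[OF a]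
  have [measurable]: "r \<in> borel_measurable borel" using b by (auto simp: bdd_by_def)
  show ?thesis unfolding ker_int_def[abs_def]
  proof (rule sigma_finite_measure.borel_measurable_lebesgue_integral[OF sigma_finite_lborel])
    show "(\<lambda>(x, p). kint m r x p) \<in> borel_measurable (borel \<Otimes>\<^sub>M lborel)"
      unfolding split_beta' lborel_prod[symmetric] by measurable
  qed
qed

lemma ker_int_L2:
  assumes a: "ker_bound m C" and b: "bdd_by r M"
  shows "ker_int m r \<in> L2"
  by (rule exp_gauss_poly_L2[OF ker_int_measurable[OF a b] ker_int_bound[OF a b]])

text \<open>Turns a pairing with the output of the operator into an integral over (\<theta>, y) of
  pairings with the kernel, where integration by parts at fixed \<theta> and y applies.\<close>

lemma ker_int_Fubini:
  assumes a: "ker_bound m C" and b: "bdd_by r M" and v: "v \<in> L2"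
  shows "(LINT x|lborel. ker_int m r x * v x) = (LINT p|lborel. dual_kint m r v p)" (is "?L = (LINT p|lborel. ?R p)")
    and "integrable lborel (\<lambda>p. dual_kint m r v p)"
proof -
  note [measurable] = ker_bound_measurable[OF a] L2_measurable[OF v]
  have [measurable]: "r \<in> borel_measurable borel" using b by (auto simp: bdd_by_def)
  define F where "F p x = kint m r x p * v x" for p x
  define B where "B x = pi/2 * M * C * (1 + norm x)\<^sup>2 * exp (- (norm x)\<^sup>2 / 4)" for x :: "real^2"
  have "0 \<le> M" using b norm_ge_zero order_trans unfolding bdd_by_def by blast
  moreover have "C \<ge> 0" using a by (simp add: ker_bound_def)
  ultimately have B0: "0 \<le> B x" for x by (simp add: B_def)
  have [measurable]: "case_prod F \<in> borel_measurable (lborel \<Otimes>\<^sub>M lborel)"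
    unfolding F_def[abs_def] lborel_prod[symmetric] split_beta' by measurable
  have int: "integrable (lborel \<Otimes>\<^sub>M lborel) (case_prod F)"
  proof (rule integrableI_bounded)
    have Bv: "integrable lborel (\<lambda>x. norm (complex_of_real (B x) * v x))"
      by (rule integrable_norm[OF L2_mult_integrable[OF exp_gauss_poly_L2[of _ "pi/2 * M * C"] v]])
        (use B0 in \<open>auto simp: B_def abs_of_nonneg simp del: of_real_mult\<close>)
    have "(\<integral>\<^sup>+z. ennreal (norm (case_prod F z)) \<partial>(lborel \<Otimes>\<^sub>M lborel)) = (\<integral>\<^sup>+x. \<integral>\<^sup>+p. ennreal (norm (F p x)) \<partial>lborel \<partial>lborel)"
      by (subst lborel_pair.nn_integral_snd[symmetric]) auto
    also have "\<dots> \<le> (\<integral>\<^sup>+x. ennreal (norm (complex_of_real (B x) * v x)) \<partial>lborel)"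
    proof (intro nn_integral_mono)
      fix x :: "real^2"
      have "(\<integral>\<^sup>+p. ennreal (norm (F p x)) \<partial>lborel) = (\<integral>\<^sup>+p. ennreal (norm (kint m r x p)) * ennreal (norm (v x)) \<partial>lborel)"
        unfolding F_def norm_mult[of _ "v x"] by (simp add: ennreal_mult)
      also have "\<dots> = (\<integral>\<^sup>+p. ennreal (norm (kint m r x p)) \<partial>lborel) * ennreal (norm (v x))"
        unfolding lborel_prod[symmetric] by (rule nn_integral_multc) measurable
      also have "\<dots> \<le> ennreal (B x) * ennreal (norm (v x))"
        unfolding B_def by (intro mult_right_mono ker_int_nn_bound[OF a b]) simp
      also have "\<dots> = ennreal (norm (complex_of_real (B x) * v x))" using B0 by (simp add: norm_mult ennreal_mult)
      finally show "(\<integral>\<^sup>+p. ennreal (norm (F p x)) \<partial>lborel) \<le> ennreal (norm (complex_of_real (B x) * v x))" .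
    qed
    also have "\<dots> < \<infinity>" using Bv by (simp add: integrable_iff_bounded)
    finally show "(\<integral>\<^sup>+z. ennreal (norm (case_prod F z)) \<partial>(lborel \<Otimes>\<^sub>M lborel)) < \<infinity>" .
  qed measurable
  have R: "?R p = (LINT x|lborel. F p x)" for p
  proof -
    have "F p x = (indicator {0<..<pi/2} (fst p) *\<^sub>R (of_real (exp ((norm (snd p))\<^sup>2 / 4)) * r (snd p))) * (v x * of_real (m (fst p) x (snd p)))" for x
      by (simp add: F_def mult_ac)
    then show ?thesis by simp
  qed
  have L: "?L = (LINT x|lborel. LINT p|lborel. F p x)"
    unfolding ker_int_def F_def by (simp only: integral_mult_left_zero)
  show "?L = (LINT p|lborel. ?R p)" unfolding L R by (rule lborel_pair.Fubini_integral[OF int])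
  show "integrable lborel ?R" unfolding R by (rule lborel_pair.integrable_fst[OF int])
qed

section \<open>Admissible kernels and their weak identities\<close>

lemma ker_bound_res_ker: "ker_bound res_ker (256 * gauss4)"
proof -
  have "256 * gauss4 * exp (- (norm x)\<^sup>2 / 4) \<le> 256 * gauss4 * (1 + norm x)\<^sup>2 * exp (- (norm x)\<^sup>2 / 4)" for x :: "real^2"
    using gauss4_nonneg mult_left_mono[of 1 "(1 + norm x)\<^sup>2" "256 * gauss4"] one_le_power[of "1 + norm x" 2] by (intro mult_right_mono) auto
  then show ?thesis
    unfolding ker_bound_def using gauss4_nonneg
    by (auto simp: borel_prod[symmetric] intro!: order_trans[OF res_ker_weight_bound ennreal_leI])
qed

lemma ker_bound_res_ker_grad: "ker_bound (res_ker_grad j) (256 * gauss4)"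
proof -
  have "256 * gauss4 * (1 + norm x) * exp (- (norm x)\<^sup>2 / 4) \<le> 256 * gauss4 * (1 + norm x)\<^sup>2 * exp (- (norm x)\<^sup>2 / 4)" for x :: "real^2"
    using gauss4_nonneg by (intro mult_right_mono mult_left_mono) (auto simp: power2_eq_square algebra_simps)
  then show ?thesis
    unfolding ker_bound_def using gauss4_nonneg
    by (auto simp: borel_prod[symmetric] intro!: order_trans[OF res_ker_grad_weight_bound ennreal_leI])
qed

lemma ker_bound_mult:
  assumes f: "f \<in> borel_measurable borel" "\<And>x. \<bar>f x\<bar> * D x \<le> E * (1 + norm x)\<^sup>2 * exp (- (norm x)\<^sup>2 / 4)" "E \<ge> 0"
    and m: "(\<lambda>p. m (fst p) (fst (snd p)) (snd (snd p))) \<in> borel_measurable borel"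
    and D: "\<And>\<theta> x. 0 < \<theta> \<Longrightarrow> \<theta> < pi/2 \<Longrightarrow> wint (\<lambda>y. \<bar>m \<theta> x y\<bar>) \<le> ennreal (D x)"
  shows "ker_bound (\<lambda>\<theta> x y. f x * m \<theta> x y) E"
proof -
  have [measurable]: "(\<lambda>y. m \<theta> x y) \<in> borel_measurable borel" for \<theta> x
    using measurable_compose[of "\<lambda>y. (\<theta>, x, y)" borel borel, OF _ m] by (simp add: borel_prod[symmetric])
  have "wint (\<lambda>y. \<bar>f x * m \<theta> x y\<bar>) \<le> ennreal (E * (1 + norm x)\<^sup>2 * exp (- (norm x)\<^sup>2 / 4))" if "0 < \<theta>" "\<theta> < pi/2" for \<theta> x
  proof -
    have "wint (\<lambda>y. \<bar>f x * m \<theta> x y\<bar>) = (\<integral>\<^sup>+y. ennreal \<bar>f x\<bar> * ennreal (\<bar>m \<theta> x y\<bar> * exp ((norm y)\<^sup>2 / 4)) \<partial>lborel)"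
      by (intro nn_integral_cong) (simp add: abs_mult mult.assoc flip: ennreal_mult)
    also have "\<dots> = ennreal \<bar>f x\<bar> * wint (\<lambda>y. \<bar>m \<theta> x y\<bar>)"
      by (rule nn_integral_cmult) measurable
    also have "\<dots> \<le> ennreal \<bar>f x\<bar> * ennreal (D x)" by (intro mult_left_mono D that) auto
    also have "\<dots> = ennreal (\<bar>f x\<bar> * D x)" by (simp add: ennreal_mult')
    also have "\<dots> \<le> ennreal (E * (1 + norm x)\<^sup>2 * exp (- (norm x)\<^sup>2 / 4))" by (intro ennreal_leI f)
    finally show ?thesis .
  qed
  moreover have "(\<lambda>p. f (fst (snd p)) * m (fst p) (fst (snd p)) (snd (snd p))) \<in> borel_measurable borel"
    using f(1) by (intro borel_measurable_times[OF _ m]) (simp add: borel_prod[symmetric])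
  ultimately show ?thesis using f(3) by (simp add: ker_bound_def)
qed

lemma ker_bound_nth_res_ker: "ker_bound (\<lambda>\<theta> x y. x $ j * res_ker \<theta> x y) (256 * gauss4)"
proof (rule ker_bound_mult[where D = "\<lambda>x. 256 * gauss4 * exp (- (norm x)\<^sup>2 / 4)"])
  fix x :: "real^2"
  have "\<bar>x $ j\<bar> \<le> (1 + norm x)\<^sup>2"
    using component_le_norm_cart[of x j] mult_right_mono[of 1 "1 + norm x" "1 + norm x"] unfolding power2_eq_square by simp
  then have "\<bar>x $ j\<bar> * (256 * gauss4 * exp (- (norm x)\<^sup>2 / 4)) \<le> (1 + norm x)\<^sup>2 * (256 * gauss4 * exp (- (norm x)\<^sup>2 / 4))"
    using gauss4_nonneg by (intro mult_right_mono) auto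
  then show "\<bar>x $ j\<bar> * (256 * gauss4 * exp (- (norm x)\<^sup>2 / 4)) \<le> 256 * gauss4 * (1 + norm x)\<^sup>2 * exp (- (norm x)\<^sup>2 / 4)"
    by (simp only: mult_ac)
qed (use gauss4_nonneg res_ker_weight_bound in \<open>auto simp: borel_prod[symmetric]\<close>)

lemma ker_bound_nth_res_ker_grad: "ker_bound (\<lambda>\<theta> x y. x $ j * res_ker_grad j \<theta> x y) (256 * gauss4)"
proof (rule ker_bound_mult[where D = "\<lambda>x. 256 * gauss4 * (1 + norm x) * exp (- (norm x)\<^sup>2 / 4)"])
  fix x :: "real^2"
  have "\<bar>x $ j\<bar> * (1 + norm x) \<le> (1 + norm x)\<^sup>2"
    using component_le_norm_cart[of x j] unfolding power2_eq_square by (intro mult_right_mono) auto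
  then have "(\<bar>x $ j\<bar> * (1 + norm x)) * (256 * gauss4 * exp (- (norm x)\<^sup>2 / 4)) \<le> (1 + norm x)\<^sup>2 * (256 * gauss4 * exp (- (norm x)\<^sup>2 / 4))"
    using gauss4_nonneg by (intro mult_right_mono) auto
  then show "\<bar>x $ j\<bar> * (256 * gauss4 * (1 + norm x) * exp (- (norm x)\<^sup>2 / 4)) \<le> 256 * gauss4 * (1 + norm x)\<^sup>2 * exp (- (norm x)\<^sup>2 / 4)"
    by (simp only: mult_ac)
qed (use gauss4_nonneg res_ker_grad_weight_bound in \<open>auto simp: borel_prod[symmetric]\<close>)

lemma ker_bound_sq_res_ker: "ker_bound (\<lambda>\<theta> x y. ((norm x)\<^sup>2 - 2) * res_ker \<theta> x y) (512 * gauss4)"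
proof (rule ker_bound_mult[where D = "\<lambda>x. 256 * gauss4 * exp (- (norm x)\<^sup>2 / 4)"])
  fix x :: "real^2"
  have "\<bar>(norm x)\<^sup>2 - 2\<bar> \<le> 2 * (1 + norm x)\<^sup>2"
    using norm_ge_zero[of x] zero_le_power2[of "norm x"] unfolding power2_sum by (intro abs_leI) auto
  then have "\<bar>(norm x)\<^sup>2 - 2\<bar> * (256 * gauss4 * exp (- (norm x)\<^sup>2 / 4)) \<le> (2 * (1 + norm x)\<^sup>2) * (256 * gauss4 * exp (- (norm x)\<^sup>2 / 4))"
    using gauss4_nonneg by (intro mult_right_mono) auto
  then show "\<bar>(norm x)\<^sup>2 - 2\<bar> * (256 * gauss4 * exp (- (norm x)\<^sup>2 / 4)) \<le> 512 * gauss4 * (1 + norm x)\<^sup>2 * exp (- (norm x)\<^sup>2 / 4)"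
    by (simp add: mult_ac)
qed (use gauss4_nonneg res_ker_weight_bound in \<open>auto simp: borel_prod[symmetric]\<close>)

lemma ker_int_add:
  assumes "ker_bound m C" "ker_bound n D" "bdd_by r M"
  shows "ker_int (\<lambda>\<theta> x y. m \<theta> x y + n \<theta> x y) r x = ker_int m r x + ker_int n r x"
  unfolding ker_int_def
  by (subst Bochner_Integration.integral_add[symmetric, OF ker_int_integrable[OF assms(1,3)] ker_int_integrable[OF assms(2,3)]])
    (simp add: algebra_simps)

lemma ker_int_cmult: "ker_int (\<lambda>\<theta> x y. f x * m \<theta> x y) r x = of_real (f x) * ker_int m r x"
proof -
  have "ker_int (\<lambda>\<theta> x y. f x * m \<theta> x y) r x = (LINT p|lborel. of_real (f x) * (kint m r x p))"
    unfolding ker_int_def by (intro Bochner_Integration.integral_cong) (auto simp: mult_ac)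
  then show ?thesis unfolding ker_int_def by (simp only: integral_mult_right_zero)
qed

lemma ker_bound_add:
  assumes "ker_bound m C" "ker_bound n D"
  shows "ker_bound (\<lambda>\<theta> x y. m \<theta> x y + n \<theta> x y) (C + D)"
proof -
  note [measurable] = ker_bound_measurable[OF assms(1)] ker_bound_measurable[OF assms(2)]
  have "wint (\<lambda>y. \<bar>m \<theta> x y + n \<theta> x y\<bar>) \<le> ennreal ((C + D) * (1 + norm x)\<^sup>2 * exp (- (norm x)\<^sup>2 / 4))" if "0 < \<theta>" "\<theta> < pi/2" for \<theta> x
  proof -
    have "wint (\<lambda>y. \<bar>m \<theta> x y + n \<theta> x y\<bar>)
      \<le> (\<integral>\<^sup>+y. ennreal (\<bar>m \<theta> x y\<bar> * exp ((norm y)\<^sup>2 / 4)) + ennreal (\<bar>n \<theta> x y\<bar> * exp ((norm y)\<^sup>2 / 4)) \<partial>lborel)"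
      by (intro nn_integral_mono) (auto simp flip: ennreal_plus distrib_right intro!: ennreal_leI mult_right_mono)
    also have "\<dots> \<le> ennreal (C * (1 + norm x)\<^sup>2 * exp (- (norm x)\<^sup>2 / 4)) + ennreal (D * (1 + norm x)\<^sup>2 * exp (- (norm x)\<^sup>2 / 4))"
      using assms that unfolding ker_bound_def by (subst nn_integral_add) (auto intro!: add_mono)
    also have "\<dots> = ennreal ((C + D) * (1 + norm x)\<^sup>2 * exp (- (norm x)\<^sup>2 / 4))"
      using assms by (subst ennreal_plus[symmetric]) (auto simp: ker_bound_def algebra_simps)
    finally show ?thesis .
  qed
  then show ?thesis using assms by (auto simp: ker_bound_def borel_prod[symmetric] split_beta' intro!: borel_measurable_add)
qed

lemma ker_int_res_ker_weak:
  assumes b: "bdd_by r M" and v: "v \<in> L2" "g \<in> L2" "has_weak_partial v j g"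
  shows "(LINT x|lborel. ker_int (res_ker_grad j) r x * v x) = - (LINT x|lborel. ker_int res_ker r x * g x)"
proof -
  have "(LINT x|lborel. ker_int (res_ker_grad j) r x * v x) = (LINT p|lborel. - (dual_kint res_ker r g p))"
    unfolding ker_int_Fubini(1)[OF ker_bound_res_ker_grad b v(1)]
    by (intro Bochner_Integration.integral_cong) (auto simp: indicator_def res_ker_IBP[OF _ _ v])
  also have "\<dots> = - (LINT x|lborel. ker_int res_ker r x * g x)"
    unfolding ker_int_Fubini(1)[OF ker_bound_res_ker b v(2)] by simp
  finally show ?thesis .
qed

lemma ker_int_nth_res_ker_weak:
  assumes b: "bdd_by r M" and v: "v \<in> L2" "g \<in> L2" "has_weak_partial v j g"
  shows "(LINT x|lborel. (ker_int res_ker r x + of_real (x $ j) * ker_int (res_ker_grad j) r x) * v x) = - (LINT x|lborel. of_real (x $ j) * ker_int res_ker r x * g x)"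
proof -
  have "(LINT x|lborel. ker_int (\<lambda>\<theta> x y. res_ker \<theta> x y + x $ j * res_ker_grad j \<theta> x y) r x * v x) = (LINT p|lborel. - (indicator {0<..<pi/2} (fst p) *\<^sub>R (of_real (exp ((norm (snd p))\<^sup>2 / 4)) * r (snd p) * (LINT x|lborel. g x * of_real (x $ j * res_ker (fst p) x (snd p))))))"
    unfolding ker_int_Fubini(1)[OF ker_bound_add[OF ker_bound_res_ker ker_bound_nth_res_ker_grad] b v(1)]
    by (intro Bochner_Integration.integral_cong) (auto simp: indicator_def nth_res_ker_IBP[OF _ _ v] simp del: of_real_mult of_real_add)
  also have "\<dots> = - (LINT x|lborel. ker_int (\<lambda>\<theta> x y. x $ j * res_ker \<theta> x y) r x * g x)"
    unfolding ker_int_Fubini(1)[OF ker_bound_nth_res_ker b v(2)] by simp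
  finally show ?thesis unfolding ker_int_add[OF ker_bound_res_ker ker_bound_nth_res_ker_grad b] ker_int_cmult .
qed

text \<open>Integrability over all angles is inherited from the summands on the left. It could not
  come from \<open>mehler_dtheta_weight_bound\<close>, whose factor 1 / cos \<theta> has a divergent
  integral.\<close>

lemma ker_int_res_ker_eq_mehler_dtheta:
  assumes b: "bdd_by r M" and v: "v \<in> L2" "\<And>j. g j \<in> L2" "\<And>j. has_weak_partial v j (g j)"
  shows "(\<Sum>j\<in>UNIV. LINT x|lborel. ker_int (res_ker_grad j) r x * g j x) + (LINT x|lborel. of_real ((norm x)\<^sup>2 - 2) * ker_int res_ker r x * v x)
     = (LINT p|lborel. dual_kint mehler_dtheta r v p)"
      (is "?A + ?B = (LINT p|lborel. ?R p)")
    and "integrable lborel (\<lambda>p. dual_kint mehler_dtheta r v p)"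
proof -
  let ?P = "\<lambda>m u p. dual_kint m r u p"
  have eq: "?R p = (\<Sum>j\<in>UNIV. ?P (res_ker_grad j) (g j) p) + ?P (\<lambda>\<theta> x y. ((norm x)\<^sup>2 - 2) * res_ker \<theta> x y) v p" for p
  proof (cases "0 < fst p \<and> fst p < pi/2")
    case True
    then show ?thesis using mehler_dtheta_IBP[of "fst p" v g "snd p", OF _ _ v, symmetric]
      by (simp add: distrib_left sum_distrib_left del: of_real_mult of_real_diff)
  qed (auto simp: indicator_def)
  note i = ker_int_Fubini(2)[OF ker_bound_res_ker_grad b v(2)] ker_int_Fubini(2)[OF ker_bound_sq_res_ker b v(1)]
  show "integrable lborel ?R" unfolding eq by (intro Bochner_Integration.integrable_add Bochner_Integration.integrable_sum i)
  have "(LINT p|lborel. ?R p) = (\<Sum>j\<in>UNIV. LINT p|lborel. ?P (res_ker_grad j) (g j) p) + (LINT p|lborel. ?P (\<lambda>\<theta> x y. ((norm x)\<^sup>2 - 2) * res_ker \<theta> x y) v p)"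
    unfolding eq by (subst Bochner_Integration.integral_add, intro Bochner_Integration.integrable_sum i, rule i, subst Bochner_Integration.integral_sum, rule i, rule refl)
  then show "?A + ?B = (LINT p|lborel. ?R p)"
    unfolding ker_int_Fubini(1)[OF ker_bound_res_ker_grad b v(2), symmetric] ker_int_Fubini(1)[OF ker_bound_sq_res_ker b v(1), symmetric] ker_int_cmult by simp
qed

section \<open>The reduced resolvent\<close>

text \<open>\<open>gauss1\<close> times the heat flow exp (-s (H - 2)) applied to exp (-|y|^2 / 4) r
  y, at the time with exp (-2 s) = sin \<theta>.\<close>

definition mehler_int :: "real \<Rightarrow> (real^2 \<Rightarrow> complex) \<Rightarrow> real^2 \<Rightarrow> complex" where
  "mehler_int \<theta> r x = (LINT y|lborel. of_real (mehler \<theta> x y * exp ((norm y)\<^sup>2 / 4)) * r y)"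

text \<open>Its value is \<pi>. It plays two roles: the normalization of the Mehler kernel, and the
  squared norm of the ground state exp (-|x|^2 / 2).\<close>

definition gauss1 :: real where "gauss1 = (LINT z|lborel. exp (- (norm (z::real^2))\<^sup>2))"

lemma gauss1_pos: "0 < gauss1"
proof -
  have i: "integrable lborel (\<lambda>z::real^2. exp (- (norm z)\<^sup>2))" using gaussian_integrable[of 1] by simp
  have "gauss1 \<noteq> 0"
  proof
    assume "gauss1 = 0"
    then have "AE z in lborel. exp (- (norm (z::real^2))\<^sup>2) = 0"
      unfolding gauss1_def using integral_nonneg_eq_0_iff_AE[OF i] by simp
    then have "AE z::real^2 in lborel. False" by simp
    then show False by (simp add: AE_iff_measurable[of UNIV])
  qed
  moreover have "gauss1 \<ge> 0" unfolding gauss1_def by (rule Bochner_Integration.integral_nonneg) simp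
  ultimately show ?thesis by simp
qed

lemma lborel_integral_affine:
  fixes F :: "real^2 \<Rightarrow> complex"
  assumes [measurable]: "F \<in> borel_measurable borel" and c: "c \<noteq> 0"
  shows "(LINT x|lborel. F x) = of_real (c\<^sup>2) * (LINT x|lborel. F (t + c *\<^sub>R x))"
  by (subst lborel_affine[OF c, of t]) (simp add: integral_density integral_distr scaleR_conv_of_real[where 'a = complex])

text \<open>In the rotated variable the angle enters only through sine and cosine and nothing
  degenerates as the cosine tends to 0. All limits are taken in this form.\<close>

lemma mehler_int_z:
  assumes c: "cos \<theta> \<noteq> 0" and [measurable]: "r \<in> borel_measurable borel"
  shows "mehler_int \<theta> r x = of_real (exp (- (norm x)\<^sup>2 / 2)) * (LINT z|lborel. of_real (exp (- (norm z)\<^sup>2)) *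
    (of_real (exp ((norm (sin \<theta> *\<^sub>R x + cos \<theta> *\<^sub>R z))\<^sup>2 / 4)) * r (sin \<theta> *\<^sub>R x + cos \<theta> *\<^sub>R z)))"
proof -
  have *: "mehler_arg \<theta> x (sin \<theta> *\<^sub>R x + cos \<theta> *\<^sub>R z) = z" for z using assms by (simp add: mehler_arg_def)
  have "mehler_int \<theta> r x = of_real ((cos \<theta>)\<^sup>2) * (LINT z|lborel. of_real (mehler \<theta> x (sin \<theta> *\<^sub>R x + cos \<theta> *\<^sub>R z) * exp ((norm (sin \<theta> *\<^sub>R x + cos \<theta> *\<^sub>R z))\<^sup>2 / 4)) * r (sin \<theta> *\<^sub>R x + cos \<theta> *\<^sub>R z))"
    unfolding mehler_int_def by (rule lborel_integral_affine[OF _ c]) measurable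
  also have "\<dots> = (LINT z|lborel. of_real ((cos \<theta>)\<^sup>2) * (of_real (mehler \<theta> x (sin \<theta> *\<^sub>R x + cos \<theta> *\<^sub>R z) * exp ((norm (sin \<theta> *\<^sub>R x + cos \<theta> *\<^sub>R z))\<^sup>2 / 4)) * r (sin \<theta> *\<^sub>R x + cos \<theta> *\<^sub>R z)))"
    by (rule integral_mult_right_zero[symmetric])
  also have "\<dots> = (LINT z|lborel. of_real (exp (- (norm x)\<^sup>2 / 2)) * (of_real (exp (- (norm z)\<^sup>2)) *
    (of_real (exp ((norm (sin \<theta> *\<^sub>R x + cos \<theta> *\<^sub>R z))\<^sup>2 / 4)) * r (sin \<theta> *\<^sub>R x + cos \<theta> *\<^sub>R z))))"
    using c by (intro Bochner_Integration.integral_cong) (simp_all add: mehler_def *)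
  also have "\<dots> = of_real (exp (- (norm x)\<^sup>2 / 2)) * (LINT z|lborel. of_real (exp (- (norm z)\<^sup>2)) *
    (of_real (exp ((norm (sin \<theta> *\<^sub>R x + cos \<theta> *\<^sub>R z))\<^sup>2 / 4)) * r (sin \<theta> *\<^sub>R x + cos \<theta> *\<^sub>R z)))"
    by (rule integral_mult_right_zero)
  finally show ?thesis .
qed

lemma mehler_int_integrable_bound:
  assumes c: "cos \<theta> \<noteq> 0" and b: "bdd_by r M"
  shows "integrable lborel (\<lambda>y. of_real (mehler \<theta> x y * exp ((norm y)\<^sup>2 / 4)) * r y)"
    and "norm (mehler_int \<theta> r x) \<le> 16 * gauss4 * M * exp (- (norm x)\<^sup>2 / 4)"
proof -
  have [measurable]: "r \<in> borel_measurable borel" and M: "\<And>x. norm (r x) \<le> M" using b by (auto simp: bdd_by_def)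
  have M0: "0 \<le> M" using M[of 0] norm_ge_zero order_trans by blast
  have nn: "(\<integral>\<^sup>+y. ennreal (norm (of_real (mehler \<theta> x y * exp ((norm y)\<^sup>2 / 4)) * r y)) \<partial>lborel) \<le> ennreal (16 * gauss4 * M * exp (- (norm x)\<^sup>2 / 4))"
  proof -
    have "(\<integral>\<^sup>+y. ennreal (norm (of_real (mehler \<theta> x y * exp ((norm y)\<^sup>2 / 4)) * r y)) \<partial>lborel)
      \<le> (\<integral>\<^sup>+y. ennreal M * ennreal (mehler \<theta> x y * (1 + norm (mehler_arg \<theta> x y))\<^sup>2 * exp ((norm y)\<^sup>2 / 4)) \<partial>lborel)"
    proof (intro nn_integral_mono)
      fix y
      have "mehler \<theta> x y * 1 * exp ((norm y)\<^sup>2 / 4) * norm (r y) \<le> mehler \<theta> x y * (1 + norm (mehler_arg \<theta> x y))\<^sup>2 * exp ((norm y)\<^sup>2 / 4) * M"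
        using mehler_nonneg[of \<theta> x y] M M0 by (intro mult_mono) (auto intro: one_le_power)
      then show "ennreal (norm (of_real (mehler \<theta> x y * exp ((norm y)\<^sup>2 / 4)) * r y)) \<le> ennreal M * ennreal (mehler \<theta> x y * (1 + norm (mehler_arg \<theta> x y))\<^sup>2 * exp ((norm y)\<^sup>2 / 4))"
        using M0 by (subst ennreal_mult'[symmetric]) (auto intro!: ennreal_leI simp: norm_mult abs_mult mehler_nonneg mult_ac)
    qed
    also have "\<dots> \<le> ennreal M * ennreal (16 * gauss4 * exp (- (norm x)\<^sup>2 / 4))"
      using mehler_weight_bound[OF c, of x] by (subst nn_integral_cmult) (auto intro!: mult_left_mono)
    also have "\<dots> = ennreal (16 * gauss4 * M * exp (- (norm x)\<^sup>2 / 4))"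
      using M0 by (subst ennreal_mult'[symmetric]) (auto simp: mult_ac)
    finally show ?thesis .
  qed
  show i: "integrable lborel (\<lambda>y. of_real (mehler \<theta> x y * exp ((norm y)\<^sup>2 / 4)) * r y)"
    by (rule integrableI_bounded) (measurable, rule le_less_trans[OF nn], simp)
  have "ennreal (norm (mehler_int \<theta> r x)) \<le> ennreal (16 * gauss4 * M * exp (- (norm x)\<^sup>2 / 4))"
    unfolding mehler_int_def by (rule order_trans[OF integral_norm_bound_ennreal[OF i] nn])
  then show "norm (mehler_int \<theta> r x) \<le> 16 * gauss4 * M * exp (- (norm x)\<^sup>2 / 4)"
    using M0 gauss4_nonneg by (subst (asm) ennreal_le_iff) auto
qed

lemma rotation_weight_le:
  "exp (- (norm z)\<^sup>2) * exp ((norm (sin \<theta> *\<^sub>R x + cos \<theta> *\<^sub>R z))\<^sup>2 / 4) \<le> exp ((norm x)\<^sup>2 / 4) * exp (- (norm (z::real^2))\<^sup>2 / 4)"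
proof -
  have "- (norm z)\<^sup>2 + (norm (sin \<theta> *\<^sub>R x + cos \<theta> *\<^sub>R z))\<^sup>2 / 4 \<le> (norm x)\<^sup>2 / 4 + - (norm z)\<^sup>2 / 4"
    using norm_rotation_le[of \<theta> x z] zero_le_power2[of "norm z"] by linarith
  then show ?thesis by (simp flip: exp_add)
qed

text \<open>One statement for two limits: continuity in x at a fixed angle, and the return of the
  flow to its datum as the angle tends to \<pi>/2. The rotation bound gives a majorant that does not
  depend on the angle.\<close>

lemma mehler_int_tendsto:
  assumes b: "bdd_by r M" and r: "continuous_on UNIV r"
    and S: "S \<longlonglongrightarrow> a" and C: "C \<longlonglongrightarrow> c" and X: "X \<longlonglongrightarrow> x" and cs: "\<And>n. S n = sin (\<theta> n) \<and> C n = cos (\<theta> n)"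
  shows "(\<lambda>n. LINT z|lborel. of_real (exp (- (norm z)\<^sup>2)) * (of_real (exp ((norm (S n *\<^sub>R X n + C n *\<^sub>R z))\<^sup>2 / 4)) * r (S n *\<^sub>R X n + C n *\<^sub>R z)))
    \<longlonglongrightarrow> (LINT z|lborel. of_real (exp (- (norm z)\<^sup>2)) * (of_real (exp ((norm (a *\<^sub>R x + c *\<^sub>R z))\<^sup>2 / 4)) * r (a *\<^sub>R x + c *\<^sub>R z)))"
proof -
  have [measurable]: "r \<in> borel_measurable borel" and M: "\<And>x. norm (r x) \<le> M" using b by (auto simp: bdd_by_def)
  obtain K where K: "\<And>n. norm (X n) \<le> K" using X convergent_imp_Bseq convergentI Bseq_def by metis
  have K2: "(norm (X n))\<^sup>2 \<le> K\<^sup>2" for n using K by (intro power_mono) auto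
  show ?thesis
  proof (rule integral_dominated_convergence)
    show "integrable lborel (\<lambda>z::real^2. exp (K\<^sup>2 / 4) * exp (- (1/4) * (norm z)\<^sup>2) * M)"
      by (intro integrable_mult_left integrable_mult_right gaussian_integrable) simp
    show "AE z in lborel. (\<lambda>n. of_real (exp (- (norm z)\<^sup>2)) * (of_real (exp ((norm (S n *\<^sub>R X n + C n *\<^sub>R z))\<^sup>2 / 4)) * r (S n *\<^sub>R X n + C n *\<^sub>R z)))
       \<longlonglongrightarrow> of_real (exp (- (norm z)\<^sup>2)) * (of_real (exp ((norm (a *\<^sub>R x + c *\<^sub>R z))\<^sup>2 / 4)) * r (a *\<^sub>R x + c *\<^sub>R z))"
    proof (rule AE_I2)
      fix z :: "real^2"
      have l: "(\<lambda>n. S n *\<^sub>R X n + C n *\<^sub>R z) \<longlonglongrightarrow> a *\<^sub>R x + c *\<^sub>R z" by (intro tendsto_intros S C X)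
      have "(\<lambda>n. r (S n *\<^sub>R X n + C n *\<^sub>R z)) \<longlonglongrightarrow> r (a *\<^sub>R x + c *\<^sub>R z)"
        by (rule continuous_on_tendsto_compose[OF r l]) auto
      then show "(\<lambda>n. of_real (exp (- (norm z)\<^sup>2)) * (of_real (exp ((norm (S n *\<^sub>R X n + C n *\<^sub>R z))\<^sup>2 / 4)) * r (S n *\<^sub>R X n + C n *\<^sub>R z)))
       \<longlonglongrightarrow> of_real (exp (- (norm z)\<^sup>2)) * (of_real (exp ((norm (a *\<^sub>R x + c *\<^sub>R z))\<^sup>2 / 4)) * r (a *\<^sub>R x + c *\<^sub>R z))"
        by (intro tendsto_intros l) auto
    qed
    show "AE z in lborel. norm (of_real (exp (- (norm z)\<^sup>2)) * (of_real (exp ((norm (S n *\<^sub>R X n + C n *\<^sub>R z))\<^sup>2 / 4)) * r (S n *\<^sub>R X n + C n *\<^sub>R z)))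
       \<le> exp (K\<^sup>2 / 4) * exp (- (1/4) * (norm z)\<^sup>2) * M" for n
    proof (rule AE_I2)
      fix z :: "real^2"
      have "exp (- (norm z)\<^sup>2) * exp ((norm (S n *\<^sub>R X n + C n *\<^sub>R z))\<^sup>2 / 4) \<le> exp ((norm (X n))\<^sup>2 / 4) * exp (- (norm z)\<^sup>2 / 4)"
        using cs[of n] rotation_weight_le by simp
      also have "\<dots> \<le> exp (K\<^sup>2 / 4) * exp (- (norm z)\<^sup>2 / 4)" using K2[of n] by (intro mult_right_mono) auto
      finally have "exp (- (norm z)\<^sup>2) * exp ((norm (S n *\<^sub>R X n + C n *\<^sub>R z))\<^sup>2 / 4) * norm (r (S n *\<^sub>R X n + C n *\<^sub>R z)) \<le> exp (K\<^sup>2 / 4) * exp (- (norm z)\<^sup>2 / 4) * M"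
        by (rule mult_mono[OF _ M]) auto
      then show "norm (of_real (exp (- (norm z)\<^sup>2)) * (of_real (exp ((norm (S n *\<^sub>R X n + C n *\<^sub>R z))\<^sup>2 / 4)) * r (S n *\<^sub>R X n + C n *\<^sub>R z)))
       \<le> exp (K\<^sup>2 / 4) * exp (- (1/4) * (norm z)\<^sup>2) * M"
        by (simp add: norm_mult mult_ac)
    qed
  qed measurable
qed

text \<open>Convergence is obtained in two stages: first in z at a fixed angle, through
  \<open>mehler_int_tendsto\<close>, then in the angle, where \<open>res_ker_weight_bound\<close>
  gives a constant majorant.\<close>

lemma ker_int_res_ker_continuous:
  assumes b: "bdd_by r M" and r: "continuous_on UNIV r"
  shows "continuous_on UNIV (ker_int res_ker r)"
proof -
  have [measurable]: "r \<in> borel_measurable borel" using b by (auto simp: bdd_by_def)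
  define V where "V \<theta> x = indicator {0<..<pi/2} \<theta> *\<^sub>R (of_real (cos \<theta> / (2 * sin \<theta>)) * (mehler_int \<theta> r x - mehler_int 0 r x))" for \<theta> x
  define I where "I \<theta> x y = indicator {0<..<pi/2} \<theta> *\<^sub>R (of_real (res_ker \<theta> x y * exp ((norm y)\<^sup>2 / 4)) * r y)" for \<theta> x y
  have VI: "V \<theta> x = (LINT y|lborel. I \<theta> x y)" for \<theta> x
  proof (cases "0 < \<theta> \<and> \<theta> < pi/2")
    case True
    have c: "cos \<theta> \<noteq> 0" using cos_gt_zero_pi[of \<theta>] True by simp
    define k where "k = cos \<theta> / (2 * sin \<theta>)"
    have mkk: "res_ker \<theta> x y = k * (mehler \<theta> x y - mehler 0 x y)" for y by (simp only: res_ker_def k_def)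
    have "V \<theta> x = of_real k * (LINT y|lborel. of_real (mehler \<theta> x y * exp ((norm y)\<^sup>2 / 4)) * r y - of_real (mehler 0 x y * exp ((norm y)\<^sup>2 / 4)) * r y)"
      using True mehler_int_integrable_bound(1)[OF c b, of x] mehler_int_integrable_bound(1)[of 0, OF _ b, of x]
      by (simp add: V_def mehler_int_def k_def)
    also have "\<dots> = (LINT y|lborel. of_real k * (of_real (mehler \<theta> x y * exp ((norm y)\<^sup>2 / 4)) * r y - of_real (mehler 0 x y * exp ((norm y)\<^sup>2 / 4)) * r y))"
      by (rule integral_mult_right_zero[symmetric])
    also have "\<dots> = (LINT y|lborel. I \<theta> x y)"
      using True by (intro Bochner_Integration.integral_cong) (auto simp: I_def mkk algebra_simps)
    finally show ?thesis .
  qed (auto simp: V_def I_def indicator_def)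
  have ker_int: "ker_int res_ker r x = (LINT \<theta>|lborel. V \<theta> x)" for x
  proof -
    have "integrable (lborel \<Otimes>\<^sub>M lborel) (case_prod (\<lambda>\<theta> y. I \<theta> x y))"
      using ker_int_integrable[OF ker_bound_res_ker b, of x] unfolding lborel_prod I_def split_beta' .
    from lborel_pair.integral_fst[OF this] show ?thesis
      unfolding VI ker_int_def lborel_prod I_def split_beta' by simp
  qed
  have Vb: "norm (V \<theta> x) \<le> indicator {0<..<pi/2} \<theta> * (256 * gauss4 * M)" for \<theta> x
  proof (cases "0 < \<theta> \<and> \<theta> < pi/2")
    case True
    have Mb: "\<And>x. norm (r x) \<le> M" using b by (auto simp: bdd_by_def)
    have M0: "0 \<le> M" using Mb[of 0] norm_ge_zero order_trans by blast
    have nn: "(\<integral>\<^sup>+y. ennreal (norm (I \<theta> x y)) \<partial>lborel) \<le> ennreal (256 * gauss4 * M)"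
    proof -
      have "(\<integral>\<^sup>+y. ennreal (norm (I \<theta> x y)) \<partial>lborel) \<le> (\<integral>\<^sup>+y. ennreal M * ennreal (\<bar>res_ker \<theta> x y\<bar> * exp ((norm y)\<^sup>2 / 4)) \<partial>lborel)"
      proof (intro nn_integral_mono)
        fix y
        have "\<bar>res_ker \<theta> x y\<bar> * exp ((norm y)\<^sup>2 / 4) * norm (r y) \<le> \<bar>res_ker \<theta> x y\<bar> * exp ((norm y)\<^sup>2 / 4) * M"
          using Mb by (intro mult_left_mono) auto
        then show "ennreal (norm (I \<theta> x y)) \<le> ennreal M * ennreal (\<bar>res_ker \<theta> x y\<bar> * exp ((norm y)\<^sup>2 / 4))"
          using M0 True by (subst ennreal_mult'[symmetric]) (auto simp: I_def norm_mult abs_mult mult_ac intro!: ennreal_leI)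
      qed
      also have "\<dots> \<le> ennreal M * ennreal (256 * gauss4 * exp (- (norm x)\<^sup>2 / 4))"
        using res_ker_weight_bound[of \<theta> x] True by (subst nn_integral_cmult) (auto intro!: mult_left_mono)
      also have "\<dots> = ennreal (256 * gauss4 * M * exp (- (norm x)\<^sup>2 / 4))"
        using M0 by (subst ennreal_mult'[symmetric]) (auto simp: mult_ac)
      also have "\<dots> \<le> ennreal (256 * gauss4 * M)"
        using M0 gauss4_nonneg by (intro ennreal_leI mult_left_le) auto
      finally show ?thesis .
    qed
    have [measurable]: "(\<lambda>y. I \<theta> x y) \<in> borel_measurable lborel" unfolding I_def by measurable
    have i: "integrable lborel (\<lambda>y. I \<theta> x y)"
      by (rule integrableI_bounded) (measurable, rule le_less_trans[OF nn], simp)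
    have "ennreal (norm (V \<theta> x)) \<le> ennreal (256 * gauss4 * M)"
      unfolding VI by (rule order_trans[OF integral_norm_bound_ennreal[OF i] nn])
    then show ?thesis using True M0 gauss4_nonneg by (subst (asm) ennreal_le_iff) auto
  qed (auto simp: V_def indicator_def)
  show ?thesis unfolding continuous_on_sequentially
  proof (intro allI ballI impI)
    fix X x assume "(\<forall>n. X n \<in> UNIV) \<and> X \<longlonglongrightarrow> (x::real^2)"
    then have X: "X \<longlonglongrightarrow> x" by simp
    have "(\<lambda>n. LINT \<theta>|lborel. V \<theta> (X n)) \<longlonglongrightarrow> (LINT \<theta>|lborel. V \<theta> x)"
    proof (rule integral_dominated_convergence)
      show "integrable lborel (\<lambda>\<theta>. indicator {0<..<pi/2} \<theta> * (256 * gauss4 * M))"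
        by (intro integrable_mult_left) auto
      show "AE \<theta> in lborel. norm (V \<theta> (X n)) \<le> indicator {0<..<pi/2} \<theta> * (256 * gauss4 * M)" for n by (rule AE_I2) (rule Vb)
      show m: "(\<lambda>\<theta>. V \<theta> x) \<in> borel_measurable lborel" for x
        unfolding VI I_def by (rule sigma_finite_measure.borel_measurable_lebesgue_integral[OF sigma_finite_lborel]) measurable
      then show "(\<lambda>\<theta>. V \<theta> (X n)) \<in> borel_measurable lborel" for n .
      show "AE \<theta> in lborel. (\<lambda>n. V \<theta> (X n)) \<longlonglongrightarrow> V \<theta> x"
      proof (rule AE_I2)
        fix \<theta>
        show "(\<lambda>n. V \<theta> (X n)) \<longlonglongrightarrow> V \<theta> x"
        proof (cases "0 < \<theta> \<and> \<theta> < pi/2")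
          case True
          have "(\<lambda>n. mehler_int t r (X n)) \<longlonglongrightarrow> mehler_int t r x" if "cos t \<noteq> 0" for t
            unfolding mehler_int_z[OF that \<open>r \<in> borel_measurable borel\<close>]
            by (intro tendsto_mult tendsto_of_real mehler_int_tendsto[OF b r _ _ X, where \<theta> = "\<lambda>_. t"] tendsto_const tendsto_exp tendsto_divide tendsto_minus tendsto_power tendsto_norm X) auto
          from this[of \<theta>] this[of 0] show ?thesis
            using True cos_gt_zero_pi[of \<theta>] unfolding V_def by (intro tendsto_intros) auto
        qed (auto simp: V_def indicator_def)
      qed
    qed
    then show "(ker_int res_ker r \<circ> X) \<longlonglongrightarrow> ker_int res_ker r x" by (simp add: ker_int comp_def)
  qed
qed

lemma ker_bound_mehler_dtheta_cut:
  assumes s: "0 < s" "s < pi/2"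
  shows "ker_bound (\<lambda>\<theta> x y. indicator {0..s} \<theta> * mehler_dtheta \<theta> x y) (32 * gauss4 / cos s)"
proof -
  have cs: "0 < cos s" using s by (intro cos_gt_zero_pi) auto
  have "wint (\<lambda>y. \<bar>indicator {0..s} \<theta> * mehler_dtheta \<theta> x y\<bar>) \<le> ennreal (32 * gauss4 / cos s * (1 + norm x)\<^sup>2 * exp (- (norm x)\<^sup>2 / 4))"
    if "0 < \<theta>" "\<theta> < pi/2" for \<theta> x
  proof (cases "\<theta> \<le> s")
    case True
    have c: "cos s \<le> cos \<theta>" using True that s by (intro cos_monotone_0_pi_le) auto
    have "wint (\<lambda>y. \<bar>indicator {0..s} \<theta> * mehler_dtheta \<theta> x y\<bar>) = wint (\<lambda>y. \<bar>mehler_dtheta \<theta> x y\<bar>)"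
      using True that by (intro nn_integral_cong) auto
    also have "\<dots> \<le> ennreal (32 * gauss4 / cos \<theta> * (1 + norm x) * exp (- (norm x)\<^sup>2 / 4))"
      using c cs by (intro mehler_dtheta_weight_bound) auto
    also have "\<dots> \<le> ennreal (32 * gauss4 / cos s * (1 + norm x)\<^sup>2 * exp (- (norm x)\<^sup>2 / 4))"
      using c cs gauss4_nonneg by (intro ennreal_leI mult_mono divide_left_mono) (auto simp: power2_eq_square algebra_simps)
    finally show ?thesis .
  qed (auto simp: indicator_def)
  then show ?thesis using gauss4_nonneg cs unfolding ker_bound_def by (auto simp: borel_prod[symmetric])
qed

text \<open>The integral of an angular derivative telescopes. Cutting at s < \<pi>/2 provides the
  absolute integrability that exchanging the order of integration requires.\<close>

lemma ker_int_mehler_dtheta_cut: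
  assumes s: "0 < s" "s < pi/2" and b: "bdd_by r M"
  shows "ker_int (\<lambda>\<theta> x y. indicator {0..s} \<theta> * mehler_dtheta \<theta> x y) r x = mehler_int s r x - mehler_int 0 r x"
proof -
  define I where "I \<theta> y = indicator {0<..<pi/2} \<theta> *\<^sub>R (of_real (indicator {0..s} \<theta> * mehler_dtheta \<theta> x y * exp ((norm y)\<^sup>2 / 4)) * r y)" for \<theta> y
  have c: "cos s \<noteq> 0" using cos_gt_zero_pi[of s] s by simp
  have "integrable (lborel \<Otimes>\<^sub>M lborel) (case_prod I)"
    using ker_int_integrable[OF ker_bound_mehler_dtheta_cut[OF s] b, of x] unfolding lborel_prod I_def split_beta' .
  note int = lborel_pair.integral_snd[OF this]
  have inner: "(LINT \<theta>|lborel. I \<theta> y) = of_real (mehler s x y * exp ((norm y)\<^sup>2 / 4)) * r y - of_real (mehler 0 x y * exp ((norm y)\<^sup>2 / 4)) * r y" for y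
  proof -
    have "(LINT \<theta>|lborel. I \<theta> y) = (LINT \<theta>|lborel. of_real (indicator {0..s} \<theta> *\<^sub>R mehler_dtheta \<theta> x y) * (of_real (exp ((norm y)\<^sup>2 / 4)) * r y))"
    proof (rule integral_cong_AE)
      \<comment> \<open>The two indicators combine to that of (0, s], which differs from that of
        [0, s] only at 0.\<close>
      have "AE \<theta> in lborel. \<theta> \<noteq> (0::real)" by (rule AE_lborel_singleton)
      then show "AE \<theta> in lborel. I \<theta> y = of_real (indicator {0..s} \<theta> *\<^sub>R mehler_dtheta \<theta> x y) * (of_real (exp ((norm y)\<^sup>2 / 4)) * r y)"
        by eventually_elim (use s in \<open>auto simp: I_def indicator_def\<close>)
    qed (auto simp: I_def)
    also have "\<dots> = of_real (LINT \<theta>|lborel. indicator {0..s} \<theta> *\<^sub>R mehler_dtheta \<theta> x y) * (of_real (exp ((norm y)\<^sup>2 / 4)) * r y)"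
      by (simp only: integral_mult_left_zero integral_complex_of_real)
    also have "(LINT \<theta>|lborel. indicator {0..s} \<theta> *\<^sub>R mehler_dtheta \<theta> x y) = mehler s x y - mehler 0 x y"
      using mehler_FTC[of s x y] s by (simp add: has_bochner_integral_iff)
    finally show ?thesis by (simp add: algebra_simps)
  qed
  from int
  have "ker_int (\<lambda>\<theta> x y. indicator {0..s} \<theta> * mehler_dtheta \<theta> x y) r x = (LINT y|lborel. LINT \<theta>|lborel. I \<theta> y)"
    unfolding ker_int_def lborel_prod I_def split_beta' by simp
  also have "\<dots> = (LINT y|lborel. of_real (mehler s x y * exp ((norm y)\<^sup>2 / 4)) * r y - of_real (mehler 0 x y * exp ((norm y)\<^sup>2 / 4)) * r y)"
    by (simp only: inner)
  finally show ?thesis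
    using mehler_int_integrable_bound(1)[OF c b, of x] mehler_int_integrable_bound(1)[of 0, OF _ b, of x] by (simp add: mehler_int_def)
qed

lemma mehler_int_0:
  assumes "bdd_by r M"
  shows "mehler_int 0 r x = of_real (exp (- (norm x)\<^sup>2 / 2)) * (LINT y|lborel. of_real (exp (- 3 * (norm y)\<^sup>2 / 4)) * r y)"
proof -
  have "mehler 0 x y * exp ((norm y)\<^sup>2 / 4) = exp (- (norm x)\<^sup>2 / 2) * exp (- 3 * (norm y)\<^sup>2 / 4)" for y
    by (simp add: mehler_def mehler_arg_def flip: exp_add)
  then have "mehler_int 0 r x = (LINT y|lborel. of_real (exp (- (norm x)\<^sup>2 / 2)) * (of_real (exp (- 3 * (norm y)\<^sup>2 / 4)) * r y))"
    by (simp only: mehler_int_def of_real_mult mult.assoc)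
  then show ?thesis by (simp only: integral_mult_right_zero)
qed

text \<open>The weak form of (H - 2) R = 1 - P for the reduced resolvent R and the projection P onto
  the ground state, up to the factor \<open>gauss1\<close>.\<close>

lemma ker_int_weak_equation:
  assumes b: "bdd_by r M" and r: "continuous_on UNIV r"
    and v: "v \<in> L2" "\<And>j. g j \<in> L2" "\<And>j. has_weak_partial v j (g j)"
  shows "(\<Sum>j\<in>UNIV. LINT x|lborel. ker_int (res_ker_grad j) r x * g j x) + (LINT x|lborel. of_real ((norm x)\<^sup>2 - 2) * ker_int res_ker r x * v x)
     = of_real gauss1 * (LINT x|lborel. of_real (exp (- (norm x)\<^sup>2 / 4)) * r x * v x)
       - (LINT y|lborel. of_real (exp (- 3 * (norm y)\<^sup>2 / 4)) * r y) * (LINT x|lborel. of_real (exp (- (norm x)\<^sup>2 / 2)) * v x)"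
proof -
  have [measurable]: "r \<in> borel_measurable borel" "v \<in> borel_measurable borel" using b L2_measurable[OF v(1)] by (auto simp: bdd_by_def)
  let ?R = "\<lambda>p. dual_kint mehler_dtheta r v p"
  define s where "s n = pi/2 - inverse (real (Suc n))" for n
  have s: "0 < s n" "s n < pi/2" for n
  proof -
    have "inverse (real (Suc n)) \<le> 1" by (simp add: field_simps)
    then show "0 < s n" using pi_gt3 by (simp add: s_def)
  qed (simp add: s_def)
  have c: "cos (s n) \<noteq> 0" for n using cos_gt_zero_pi[of "s n"] s[of n] by simp
  have slim: "s \<longlonglongrightarrow> pi/2" unfolding s_def using tendsto_diff[OF tendsto_const LIMSEQ_inverse_real_of_nat, of "pi/2"] by simp
  \<comment> \<open>The integral is cut at s n, where it can be evaluated; the full integrand is the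
    majorant for removing the cut.\<close>
  have A: "(\<lambda>n. LINT p|lborel. indicator {..s n} (fst p) *\<^sub>R ?R p) \<longlonglongrightarrow> (LINT p|lborel. ?R p)"
  proof (rule integral_dominated_convergence)
    show "integrable lborel (\<lambda>p. norm (?R p))" by (intro integrable_norm ker_int_res_ker_eq_mehler_dtheta(2)[OF b v])
    show [measurable]: "?R \<in> borel_measurable lborel" using ker_int_res_ker_eq_mehler_dtheta(2)[OF b v] by simp
    show "(\<lambda>p. indicator {..s n} (fst p) *\<^sub>R ?R p) \<in> borel_measurable lborel" for n
    proof (rule borel_measurable_scaleR)
      show "(\<lambda>p::real \<times> (real^2). indicator {..s n} (fst p) :: real) \<in> borel_measurable lborel"
        unfolding lborel_prod[symmetric] by measurable
    qed measurable
    show "AE p in lborel. norm (indicator {..s n} (fst p) *\<^sub>R ?R p) \<le> norm (?R p)" for n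
      by (rule AE_I2) (simp add: indicator_def)
    show "AE p in lborel. (\<lambda>n. indicator {..s n} (fst p) *\<^sub>R ?R p) \<longlonglongrightarrow> ?R p"
    proof (rule AE_I2)
      fix p :: "real \<times> (real^2)"
      show "(\<lambda>n. indicator {..s n} (fst p) *\<^sub>R ?R p) \<longlonglongrightarrow> ?R p"
      proof (cases "fst p < pi/2")
        case True
        have "eventually (\<lambda>n. fst p < s n) sequentially" using slim True by (rule order_tendstoD)
        then have "eventually (\<lambda>n. indicator {..s n} (fst p) *\<^sub>R ?R p = ?R p) sequentially"
          by eventually_elim (simp add: indicator_def)
        then show ?thesis by (rule tendsto_eventually)
      qed (simp add: indicator_def)
    qed
  qed
  have An: "(LINT p|lborel. indicator {..s n} (fst p) *\<^sub>R ?R p) = (LINT x|lborel. (mehler_int (s n) r x - mehler_int 0 r x) * v x)" for n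
  proof -
    have "(LINT x|lborel. (mehler_int (s n) r x - mehler_int 0 r x) * v x) = (LINT x|lborel. ker_int (\<lambda>\<theta> x y. indicator {0..s n} \<theta> * mehler_dtheta \<theta> x y) r x * v x)"
      by (simp add: ker_int_mehler_dtheta_cut[OF s b])
    also have "\<dots> = (LINT p|lborel. indicator {..s n} (fst p) *\<^sub>R ?R p)"
      unfolding ker_int_Fubini(1)[OF ker_bound_mehler_dtheta_cut[OF s] b v(1)]
      by (intro Bochner_Integration.integral_cong) (auto simp: indicator_def)
    finally show ?thesis ..
  qed
  have MFm[measurable]: "mehler_int t r \<in> borel_measurable borel" for t
    unfolding mehler_int_def[abs_def] by (rule sigma_finite_measure.borel_measurable_lebesgue_integral[OF sigma_finite_lborel]) measurable
  let ?w = "\<lambda>x::real^2. exp (- (norm x)\<^sup>2 / 4)"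
  have wL2: "(\<lambda>x. complex_of_real (?w x)) \<in> L2" by (rule exp_gauss_L2[of _ 1]) auto
  have int: "integrable lborel (\<lambda>x. f x * v x)" if "f \<in> borel_measurable borel" "\<And>x. norm (f x) \<le> K * ?w x" for f :: "real^2 \<Rightarrow> complex" and K
    by (rule L2_mult_integrable[OF exp_gauss_L2[OF that] v(1)])
  \<comment> \<open>As the angle tends to \<pi>/2 the time tends to 0 and the flow returns its
    datum, here \<open>gauss1\<close> times the weighted r.\<close>
  have B: "(\<lambda>n. LINT x|lborel. (mehler_int (s n) r x - mehler_int 0 r x) * v x) \<longlonglongrightarrow> (LINT x|lborel. (of_real gauss1 * (of_real (?w x) * r x) - mehler_int 0 r x) * v x)"
  proof (rule integral_dominated_convergence)
    have "integrable lborel (\<lambda>x. complex_of_real (32 * gauss4 * M * ?w x) * v x)"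
      unfolding of_real_mult mult.assoc[symmetric] using L2_mult_integrable[OF wL2 v(1)] by (simp add: mult.assoc)
    then show "integrable lborel (\<lambda>x. norm (complex_of_real (32 * gauss4 * M * ?w x) * v x))" by (rule integrable_norm)
    have M0: "0 \<le> M" using b norm_ge_zero order_trans unfolding bdd_by_def by blast
    show "AE x in lborel. norm ((mehler_int (s n) r x - mehler_int 0 r x) * v x) \<le> norm (complex_of_real (32 * gauss4 * M * ?w x) * v x)" for n
    proof (rule AE_I2)
      fix x
      have "norm (mehler_int (s n) r x - mehler_int 0 r x) \<le> 16 * gauss4 * M * ?w x + 16 * gauss4 * M * ?w x"
        by (rule order_trans[OF norm_triangle_ineq4 add_mono[OF mehler_int_integrable_bound(2)[OF c b] mehler_int_integrable_bound(2)[OF _ b]]]) simp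
      also have "\<dots> = norm (complex_of_real (32 * gauss4 * M * ?w x))" using M0 gauss4_nonneg by (simp add: abs_mult norm_mult)
      finally show "norm ((mehler_int (s n) r x - mehler_int 0 r x) * v x) \<le> norm (complex_of_real (32 * gauss4 * M * ?w x) * v x)"
        unfolding norm_mult[of _ "v x"] by (rule mult_right_mono) simp
    qed
    show "AE x in lborel. (\<lambda>n. (mehler_int (s n) r x - mehler_int 0 r x) * v x) \<longlonglongrightarrow> (of_real gauss1 * (of_real (?w x) * r x) - mehler_int 0 r x) * v x"
    proof (rule AE_I2, intro tendsto_mult tendsto_diff tendsto_const)
      fix x
      have sc: "(\<lambda>n. sin (s n)) \<longlonglongrightarrow> 1" "(\<lambda>n. cos (s n)) \<longlonglongrightarrow> 0"
        using tendsto_sin[OF slim] tendsto_cos[OF slim] by auto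
      have "(\<lambda>n. mehler_int (s n) r x) \<longlonglongrightarrow> of_real (exp (- (norm x)\<^sup>2 / 2)) * (LINT z|lborel. of_real (exp (- (norm (z::real^2))\<^sup>2)) * (of_real (exp ((norm (1 *\<^sub>R x + 0 *\<^sub>R z))\<^sup>2 / 4)) * r (1 *\<^sub>R x + 0 *\<^sub>R z)))"
        unfolding mehler_int_z[OF c \<open>r \<in> borel_measurable borel\<close>]
        by (intro tendsto_mult tendsto_const mehler_int_tendsto[OF b r sc, where \<theta> = s]) auto
      also have "of_real (exp (- (norm x)\<^sup>2 / 2)) * (LINT z|lborel. of_real (exp (- (norm (z::real^2))\<^sup>2)) * (of_real (exp ((norm (1 *\<^sub>R x + 0 *\<^sub>R z))\<^sup>2 / 4)) * r (1 *\<^sub>R x + 0 *\<^sub>R z)))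
         = of_real (exp (- (norm x)\<^sup>2 / 2) * exp ((norm x)\<^sup>2 / 4)) * of_real gauss1 * r x"
        by (simp add: gauss1_def integral_complex_of_real)
      also have "exp (- (norm x)\<^sup>2 / 2) * exp ((norm x)\<^sup>2 / 4) = ?w x" by (simp flip: exp_add)
      finally show "(\<lambda>n. mehler_int (s n) r x) \<longlonglongrightarrow> of_real gauss1 * (of_real (?w x) * r x)" by (simp add: mult_ac)
    qed
  qed measurable
  have "(LINT p|lborel. ?R p) = (LINT x|lborel. (of_real gauss1 * (of_real (?w x) * r x) - mehler_int 0 r x) * v x)"
    using LIMSEQ_unique[OF A[unfolded An] B] .
  also have "\<dots> = (LINT x|lborel. of_real gauss1 * (of_real (?w x) * r x * v x) - mehler_int 0 r x * v x)"
    by (simp add: algebra_simps)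
  also have "\<dots> = (LINT x|lborel. of_real gauss1 * (of_real (?w x) * r x * v x)) - (LINT x|lborel. mehler_int 0 r x * v x)"
  proof (rule Bochner_Integration.integral_diff)
    show "integrable lborel (\<lambda>x. of_real gauss1 * (of_real (?w x) * r x * v x))"
      by (rule integrable_mult_right, rule int[of _ M]) (use b in \<open>auto simp: bdd_by_def norm_mult mult.commute intro!: mult_right_mono\<close>)
    show "integrable lborel (\<lambda>x. mehler_int 0 r x * v x)"
      by (rule int[OF MFm mehler_int_integrable_bound(2)[OF _ b]]) simp
  qed
  also have "(LINT x|lborel. mehler_int 0 r x * v x) = (LINT y|lborel. of_real (exp (- 3 * (norm y)\<^sup>2 / 4)) * r y) * (LINT x|lborel. of_real (exp (- (norm x)\<^sup>2 / 2)) * v x)"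
  proof -
    have "(LINT x|lborel. mehler_int 0 r x * v x) = (LINT x|lborel. (LINT y|lborel. of_real (exp (- 3 * (norm y)\<^sup>2 / 4)) * r y) * (of_real (exp (- (norm x)\<^sup>2 / 2)) * v x))"
      unfolding mehler_int_0[OF b] by (intro Bochner_Integration.integral_cong) (simp_all only: mult_ac)
    then show ?thesis by (simp only: integral_mult_right_zero)
  qed
  finally show ?thesis unfolding ker_int_res_ker_eq_mehler_dtheta(1)[OF b v] by (simp only: integral_mult_right_zero)
qed

section \<open>Weak equation and energy of the ansatz\<close>

lemma ker_bound_poly_res_ker: "ker_bound (\<lambda>\<theta> x y. (1 + norm x)\<^sup>2 * res_ker \<theta> x y) (256 * gauss4)"
  by (rule ker_bound_mult[where D = "\<lambda>x. 256 * gauss4 * exp (- (norm x)\<^sup>2 / 4)"])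
    (use gauss4_nonneg res_ker_weight_bound in \<open>auto simp: borel_prod[symmetric]\<close>)

lemma ker_bound_norm_res_ker: "ker_bound (\<lambda>\<theta> x y. norm x * res_ker \<theta> x y) (256 * gauss4)"
proof (rule ker_bound_mult[where D = "\<lambda>x. 256 * gauss4 * exp (- (norm x)\<^sup>2 / 4)"])
  fix x :: "real^2"
  have "norm x \<le> (1 + norm x)\<^sup>2"
    using mult_right_mono[of 1 "1 + norm x" "1 + norm x"] unfolding power2_eq_square by simp
  then have "\<bar>norm x\<bar> * (256 * gauss4 * exp (- (norm x)\<^sup>2 / 4)) \<le> (1 + norm x)\<^sup>2 * (256 * gauss4 * exp (- (norm x)\<^sup>2 / 4))"
    using gauss4_nonneg by (intro mult_right_mono) auto
  then show "\<bar>norm x\<bar> * (256 * gauss4 * exp (- (norm x)\<^sup>2 / 4)) \<le> 256 * gauss4 * (1 + norm x)\<^sup>2 * exp (- (norm x)\<^sup>2 / 4)"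
    by (simp only: mult_ac)
qed (use gauss4_nonneg res_ker_weight_bound in \<open>auto simp: borel_prod[symmetric]\<close>)

text \<open>Multiplying the kernel by the square of 1 + |x| costs nothing in
  \<open>ker_bound\<close>, since \<open>res_ker_weight_bound\<close> has no polynomial factor.
  Dividing afterwards removes the polynomial from \<open>ker_int_bound\<close>.\<close>

lemma ker_int_res_ker_bound:
  assumes b: "bdd_by r M"
  shows "norm (ker_int res_ker r x) \<le> 128 * pi * gauss4 * M * exp (- (norm x)\<^sup>2 / 4)"
proof -
  have p: "(0::real) < (1 + norm x)\<^sup>2" by (rule zero_less_power) (simp add: add_pos_nonneg)
  have "norm (complex_of_real ((1 + norm x)\<^sup>2) * ker_int res_ker r x) \<le> pi/2 * M * (256 * gauss4) * (1 + norm x)\<^sup>2 * exp (- (norm x)\<^sup>2 / 4)"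
    using ker_int_bound[OF ker_bound_poly_res_ker b, of x] unfolding ker_int_cmult .
  then have "(1 + norm x)\<^sup>2 * norm (ker_int res_ker r x) \<le> (1 + norm x)\<^sup>2 * (128 * pi * gauss4 * M * exp (- (norm x)\<^sup>2 / 4))"
    unfolding norm_mult norm_of_real using p by (simp add: mult_ac)
  then show ?thesis using p by (simp only: mult_le_cancel_left_pos)
qed

section \<open>The ansatz: weak gradient, weak equation and energy\<close>

lemma C_k_cnj: "C_k k f \<Longrightarrow> C_k k (\<lambda>x. cnj (f x))"
proof (induction k arbitrary: f)
  case 0
  then show ?case by (auto intro: continuous_on_cnj)
next
  case (Suc k)
  show ?case
  proof (rule C_k_SucI)
    show "((\<lambda>x. cnj (f x)) has_derivative (\<lambda>h. cnj (frechet_derivative f (at x) h))) (at x)" for x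
      using Suc.prems by (intro has_derivative_cnj C_k_has_derivative)
    show "C_k k (\<lambda>x. cnj (frechet_derivative f (at x) w))" for w
      using Suc by auto
  qed
qed

lemma test_function_cnj: "test_function f \<Longrightarrow> test_function (\<lambda>x. cnj (f x))"
  by (simp add: test_function_def C_k_cnj)

text \<open>The weak identities so far are bilinear, whereas the dual pairings are conjugate-linear
  in the second argument; this passes from one to the other.\<close>

lemma has_weak_partial_cnj:
  assumes "has_weak_partial u j g"
  shows "has_weak_partial (\<lambda>x. cnj (u x)) j (\<lambda>x. cnj (g x))"
proof -
  have loc: "locally_integrable (\<lambda>x. cnj (u x))" if "locally_integrable u" for u
  proof -
    have "integrable lborel (\<lambda>x. indicator K x *\<^sub>R cnj (u x))" if "compact K" for K
    proof -
      have "integrable lborel (\<lambda>x. cnj (indicator K x *\<^sub>R u x))"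
        using \<open>locally_integrable u\<close> that by (simp add: locally_integrable_def set_integrable_def del: complex_cnj_scaleR)
      then show ?thesis by simp
    qed
    then show ?thesis using that
      by (auto simp: locally_integrable_def set_integrable_def intro: borel_measurable_continuous_on[OF continuous_on_cnj[OF continuous_on_id]])
  qed
  have "(LINT x|lborel. cnj (u x) * frechet_derivative p (at x) (axis j 1)) = - (LINT x|lborel. cnj (g x) * p x)" if p: "test_function p" for p
  proof -
    let ?q = "\<lambda>x. cnj (p x)"
    have "frechet_derivative ?q (at x) = (\<lambda>h. cnj (frechet_derivative p (at x) h))" for x
      by (intro frechet_derivative_eqI has_derivative_cnj test_function_has_derivative p)
    then have "(LINT x|lborel. u x * cnj (frechet_derivative p (at x) (axis j 1))) = - (LINT x|lborel. g x * cnj (p x))"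
      using assms test_function_cnj[OF p] by (auto simp: has_weak_partial_def)
    then have "cnj (LINT x|lborel. u x * cnj (frechet_derivative p (at x) (axis j 1))) = - cnj (LINT x|lborel. g x * cnj (p x))" by simp
    moreover have "cnj (LINT x|lborel. f x * cnj (h x)) = (LINT x|lborel. cnj (f x) * h x)" for f h :: "real^2 \<Rightarrow> complex"
      by (subst Bochner_Integration.integral_cnj[symmetric]) simp
    ultimately show ?thesis by simp
  qed
  then show ?thesis using assms loc by (auto simp: has_weak_partial_def)
qed

lemma test_function_L2:
  assumes f: "continuous_on UNIV f" "\<And>x. norm x > B \<Longrightarrow> f x = (0::complex)"
  shows "f \<in> L2"
proof -
  have "integrable lborel (\<lambda>x. indicator (cball 0 B) x *\<^sub>R (norm (f x))\<^sup>2)"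
    using f(1) by (intro borel_integrable_compact) (auto intro!: continuous_intros intro: continuous_on_subset)
  also have "(\<lambda>x. indicator (cball 0 B) x *\<^sub>R (norm (f x))\<^sup>2) = (\<lambda>x. (norm (f x))\<^sup>2)"
    using f(2) by (force simp: fun_eq_iff indicator_def not_le)
  finally show ?thesis using f(1) by (auto simp: L2_def intro: borel_measurable_continuous_onI)
qed

lemma phi_weak:
  assumes v: "v \<in> L2" "g \<in> L2" "has_weak_partial v j g"
  shows "(LINT x|lborel. of_real (- x $ j * exp (- (norm x)\<^sup>2 / 2)) * v x) = - (LINT x|lborel. of_real (exp (- (norm x)\<^sup>2 / 2)) * g x)"
    and "(LINT x|lborel. of_real (exp (- (norm x)\<^sup>2 / 2) - (x $ j)\<^sup>2 * exp (- (norm x)\<^sup>2 / 2)) * v x) = - (LINT x|lborel. of_real (x $ j * exp (- (norm x)\<^sup>2 / 2)) * g x)"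
proof -
  \<comment> \<open>The ground state is the kernel at \<theta> = 0 and y = 0, so smoothness, decay
    and derivative are inherited from it.\<close>
  have phi: "mehler 0 x 0 = exp (- (norm x)\<^sup>2 / 2)" for x by (simp add: mehler_def mehler_arg_def)
  have D: "((\<lambda>x. mehler 0 x 0) has_derivative (\<lambda>h. - (x \<bullet> h) * mehler 0 x 0)) (at x)" for x
    using mehler_has_derivative[of 0 0 x] by (simp add: mult.commute)
  have bd: "gauss_bd 0 (\<lambda>x. mehler 0 x 0)" by (rule gauss_bd_mehler)
  have bds: "gauss_bd 2 (\<lambda>x. mehler 0 x 0)" "gauss_bd 2 (\<lambda>x. x $ j * mehler 0 x 0)" "gauss_bd 2 (\<lambda>x. x $ j * (x $ j * mehler 0 x 0))"
    using gauss_bd_mono[OF bd] gauss_bd_mono[OF gauss_bd_nth[OF bd]] gauss_bd_nth[OF gauss_bd_nth[OF bd]] by (auto simp: numeral_2_eq_2)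
  have bd2: "gauss_bd 2 (\<lambda>x. - x $ j * mehler 0 x 0)" using gauss_bd_cmult[OF bds(2), of "-1"] by simp
  have bd3: "gauss_bd 2 (\<lambda>x. x $ j * (- x $ j * mehler 0 x 0) + mehler 0 x 0)"
    using gauss_bd_add[OF gauss_bd_cmult[OF bds(3), of "-1"] bds(1)] by simp
  show "(LINT x|lborel. of_real (- x $ j * exp (- (norm x)\<^sup>2 / 2)) * v x) = - (LINT x|lborel. of_real (exp (- (norm x)\<^sup>2 / 2)) * g x)"
    using weak_partial_IBP[OF v C_k_mehler[of 0 _ 0] gauss_bd_L2[OF bds(1)] has_derivative_of_real[OF D]] gauss_bd_L2[OF bd2]
    unfolding inner_axis_1 phi by (simp add: mult.commute)
  have C: "C_k k (\<lambda>x. complex_of_real (x $ j * mehler 0 x 0))" for k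
    unfolding of_real_mult by (intro C_k_mult C_k_nth C_k_mehler) simp
  show "(LINT x|lborel. of_real (exp (- (norm x)\<^sup>2 / 2) - (x $ j)\<^sup>2 * exp (- (norm x)\<^sup>2 / 2)) * v x) = - (LINT x|lborel. of_real (x $ j * exp (- (norm x)\<^sup>2 / 2)) * g x)"
    using weak_partial_IBP[OF v C gauss_bd_L2[OF bds(2)] has_derivative_of_real[OF has_derivative_mult[OF nth_has_derivative[OF has_derivative_ident] D]]] gauss_bd_L2[OF bd3]
    unfolding inner_axis_1 phi by (simp add: mult.commute power2_eq_square axis_def mult.assoc)
qed

text \<open>A multiple of the ground state plus a resolvent term. With both coefficients free, the
  class is closed under multiplication by the phase and amplitude of the wave, see
  \<open>ansatz_scale\<close>.\<close>

definition ansatz :: "complex \<Rightarrow> complex \<Rightarrow> (real^2 \<Rightarrow> complex) \<Rightarrow> real^2 \<Rightarrow> complex" where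
  "ansatz a b r x = a * of_real (exp (- (norm x)\<^sup>2 / 2)) + b * ker_int res_ker r x"

definition ansatz_partial :: "complex \<Rightarrow> complex \<Rightarrow> (real^2 \<Rightarrow> complex) \<Rightarrow> 2 \<Rightarrow> real^2 \<Rightarrow> complex" where
  "ansatz_partial a b r j x = a * of_real (- x $ j * exp (- (norm x)\<^sup>2 / 2)) + b * ker_int (res_ker_grad j) r x"

lemma phi_poly_L2:
  assumes "f \<in> borel_measurable borel" "\<And>x. \<bar>f x\<bar> \<le> C * (1 + norm x)\<^sup>2"
  shows "(\<lambda>x. complex_of_real (f x * exp (- (norm x)\<^sup>2 / 2))) \<in> L2"
proof (rule gauss_bd_L2)
  have "gauss_bd (0 + 2) (\<lambda>x. f x * mehler 0 x 0)" using assms(2) by (intro gauss_bd_mult gauss_bd_mehler)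
  then show "gauss_bd 2 (\<lambda>x. f x * exp (- (norm x)\<^sup>2 / 2))" by (simp only: add_0) (simp add: mehler_def mehler_arg_def)
qed (use assms in measurable)

lemma norm_le_sq: "norm (x::real^2) \<le> 1 * (1 + norm x)\<^sup>2"
  using mult_right_mono[of 1 "1 + norm x" "1 + norm x"] unfolding power2_eq_square by simp

lemma nth_le_sq: "\<bar>(x::real^2) $ j\<bar> \<le> 1 * (1 + norm x)\<^sup>2"
  using component_le_norm_cart norm_le_sq order_trans by blast

lemma ansatz_L2:
  assumes b: "bdd_by r M"
  shows "ansatz a b r \<in> L2" "ansatz_partial a b r j \<in> L2" "(\<lambda>x. norm x *\<^sub>R ansatz a b r x) \<in> L2" "(\<lambda>x. of_real (x $ j) * ansatz a b r x) \<in> L2"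
proof -
  have "(\<lambda>x. of_real (1 * exp (- (norm x)\<^sup>2 / 2))) \<in> L2" by (rule phi_poly_L2[of _ 1]) (auto intro: one_le_power)
  then show "ansatz a b r \<in> L2" unfolding ansatz_def[abs_def] by (intro L2_add L2_cmult ker_int_L2[OF ker_bound_res_ker b]) simp
  have "(\<lambda>x. of_real (- x $ j * exp (- (norm x)\<^sup>2 / 2))) \<in> L2" by (rule phi_poly_L2[of _ 1]) (use nth_le_sq in auto)
  then show "ansatz_partial a b r j \<in> L2" unfolding ansatz_partial_def[abs_def] by (intro L2_add L2_cmult ker_int_L2[OF ker_bound_res_ker_grad b])
  have "(\<lambda>x. a * of_real (norm x * exp (- (norm x)\<^sup>2 / 2)) + b * ker_int (\<lambda>\<theta> x y. norm x * res_ker \<theta> x y) r x) \<in> L2"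
    by (intro L2_add L2_cmult ker_int_L2[OF ker_bound_norm_res_ker b] phi_poly_L2[of _ 1]) (use norm_le_sq in auto)
  moreover have "(\<lambda>x. a * of_real (norm x * exp (- (norm x)\<^sup>2 / 2)) + b * ker_int (\<lambda>\<theta> x y. norm x * res_ker \<theta> x y) r x) = (\<lambda>x. norm x *\<^sub>R ansatz a b r x)"
    unfolding ker_int_cmult ansatz_def by (simp add: fun_eq_iff scaleR_conv_of_real algebra_simps)
  ultimately show "(\<lambda>x. norm x *\<^sub>R ansatz a b r x) \<in> L2" by simp
  have "(\<lambda>x. a * of_real (x $ j * exp (- (norm x)\<^sup>2 / 2)) + b * ker_int (\<lambda>\<theta> x y. x $ j * res_ker \<theta> x y) r x) \<in> L2"
    by (intro L2_add L2_cmult ker_int_L2[OF ker_bound_nth_res_ker b] phi_poly_L2[of _ 1]) (use nth_le_sq in auto)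
  moreover have "(\<lambda>x. a * of_real (x $ j * exp (- (norm x)\<^sup>2 / 2)) + b * ker_int (\<lambda>\<theta> x y. x $ j * res_ker \<theta> x y) r x) = (\<lambda>x. of_real (x $ j) * ansatz a b r x)"
    unfolding ker_int_cmult ansatz_def by (simp add: fun_eq_iff algebra_simps)
  ultimately show "(\<lambda>x. of_real (x $ j) * ansatz a b r x) \<in> L2" by simp
qed

lemma integral_lin_comb:
  fixes f g :: "real^2 \<Rightarrow> complex"
  assumes "integrable lborel f" "integrable lborel g" "\<And>x. h x = a * f x + b * g x"
  shows "(LINT x|lborel. h x) = a * (LINT x|lborel. f x) + b * (LINT x|lborel. g x)"
  using assms by simp

lemma ansatz_weak:
  assumes b: "bdd_by r M" and v: "v \<in> L2" "g \<in> L2" "has_weak_partial v j g"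
  shows "(LINT x|lborel. ansatz_partial a b r j x * v x) = - (LINT x|lborel. ansatz a b r x * g x)"
    and "(LINT x|lborel. (ansatz a b r x + of_real (x $ j) * ansatz_partial a b r j x) * v x) = - (LINT x|lborel. of_real (x $ j) * ansatz a b r x * g x)"
proof -
  have p0: "(\<lambda>x. complex_of_real (exp (- (norm (x::real^2))\<^sup>2 / 2))) \<in> L2"
    using phi_poly_L2[of "\<lambda>x. 1" 1] by (auto intro: one_le_power)
  have p1: "(\<lambda>x. complex_of_real (x $ j * exp (- (norm (x::real^2))\<^sup>2 / 2))) \<in> L2"
    by (rule phi_poly_L2[of _ 1]) (use nth_le_sq in auto)
  have p1': "(\<lambda>x. complex_of_real (- x $ j * exp (- (norm (x::real^2))\<^sup>2 / 2))) \<in> L2"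
    by (rule phi_poly_L2[of _ 1]) (use nth_le_sq in auto)
  have p2: "(\<lambda>x. complex_of_real (exp (- (norm x)\<^sup>2 / 2) - (x $ j)\<^sup>2 * exp (- (norm x)\<^sup>2 / 2))) \<in> L2"
  proof -
    have "(x $ j)\<^sup>2 \<le> 1 * (1 + norm x)\<^sup>2" for x :: "real^2"
      using component_le_norm_cart[of x j] power_mono[of "\<bar>x $ j\<bar>" "1 + norm x" 2] by simp
    then have "(\<lambda>x. complex_of_real ((x $ j)\<^sup>2 * exp (- (norm x)\<^sup>2 / 2))) \<in> L2"
      by (intro phi_poly_L2[of _ 1]) auto
    from L2_diff[OF p0 this] show ?thesis by simp
  qed
  have "(LINT x|lborel. ansatz_partial a b r j x * v x) = a * (LINT x|lborel. of_real (- x $ j * exp (- (norm x)\<^sup>2 / 2)) * v x) + b * (LINT x|lborel. ker_int (res_ker_grad j) r x * v x)"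
    by (rule integral_lin_comb[OF L2_mult_integrable[OF p1' v(1)] L2_mult_integrable[OF ker_int_L2[OF ker_bound_res_ker_grad b] v(1)]]) (simp add: ansatz_partial_def algebra_simps)
  also have "\<dots> = - (a * (LINT x|lborel. of_real (exp (- (norm x)\<^sup>2 / 2)) * g x) + b * (LINT x|lborel. ker_int res_ker r x * g x))"
    unfolding phi_weak(1)[OF v] ker_int_res_ker_weak[OF b v] by simp
  also have "a * (LINT x|lborel. of_real (exp (- (norm x)\<^sup>2 / 2)) * g x) + b * (LINT x|lborel. ker_int res_ker r x * g x) = (LINT x|lborel. ansatz a b r x * g x)"
    by (rule integral_lin_comb[OF L2_mult_integrable[OF p0 v(2)] L2_mult_integrable[OF ker_int_L2[OF ker_bound_res_ker b] v(2)], symmetric]) (simp add: ansatz_def algebra_simps)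
  finally show "(LINT x|lborel. ansatz_partial a b r j x * v x) = - (LINT x|lborel. ansatz a b r x * g x)" .
  have k1: "(\<lambda>x. ker_int res_ker r x + of_real (x $ j) * ker_int (res_ker_grad j) r x) \<in> L2"
    using ker_int_L2[OF ker_bound_add[OF ker_bound_res_ker ker_bound_nth_res_ker_grad] b] unfolding ker_int_add[OF ker_bound_res_ker ker_bound_nth_res_ker_grad b, abs_def] ker_int_cmult .
  have k2: "(\<lambda>x. of_real (x $ j) * ker_int res_ker r x) \<in> L2"
    using ker_int_L2[OF ker_bound_nth_res_ker b] unfolding ker_int_cmult[abs_def] .
  have "(LINT x|lborel. (ansatz a b r x + of_real (x $ j) * ansatz_partial a b r j x) * v x) = a * (LINT x|lborel. of_real (exp (- (norm x)\<^sup>2 / 2) - (x $ j)\<^sup>2 * exp (- (norm x)\<^sup>2 / 2)) * v x) + b * (LINT x|lborel. (ker_int res_ker r x + of_real (x $ j) * ker_int (res_ker_grad j) r x) * v x)"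
    by (rule integral_lin_comb[OF L2_mult_integrable[OF p2 v(1)] L2_mult_integrable[OF k1 v(1)]]) (simp add: ansatz_def ansatz_partial_def power2_eq_square algebra_simps)
  also have "\<dots> = - (a * (LINT x|lborel. of_real (x $ j * exp (- (norm x)\<^sup>2 / 2)) * g x) + b * (LINT x|lborel. of_real (x $ j) * ker_int res_ker r x * g x))"
    unfolding phi_weak(2)[OF v] ker_int_nth_res_ker_weak[OF b v] by simp
  also have "a * (LINT x|lborel. of_real (x $ j * exp (- (norm x)\<^sup>2 / 2)) * g x) + b * (LINT x|lborel. of_real (x $ j) * ker_int res_ker r x * g x) = (LINT x|lborel. of_real (x $ j) * ansatz a b r x * g x)"
    by (rule integral_lin_comb[OF L2_mult_integrable[OF p1 v(2)] L2_mult_integrable[OF k2 v(2)], symmetric]) (simp add: ansatz_def algebra_simps)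
  finally show "(LINT x|lborel. (ansatz a b r x + of_real (x $ j) * ansatz_partial a b r j x) * v x) = - (LINT x|lborel. of_real (x $ j) * ansatz a b r x * g x)" .
qed

lemma ansatz_has_weak_partial:
  assumes b: "bdd_by r M"
  shows "has_weak_partial (ansatz a b r) j (ansatz_partial a b r j)"
proof -
  have "(LINT x|lborel. ansatz a b r x * frechet_derivative p (at x) (axis j 1)) = - (LINT x|lborel. ansatz_partial a b r j x * p x)" if p: "test_function p" for p
  proof -
    obtain B where B: "\<And>x. norm x > B \<Longrightarrow> p x = 0" using test_function_supp[OF p] by metis
    have "p \<in> L2" "(\<lambda>x. frechet_derivative p (at x) (axis j 1)) \<in> L2"
      using test_function_L2[OF test_function_continuous[OF p] B] test_function_L2[OF test_function_deriv_continuous[OF p] test_function_deriv_supp[OF p B]] by auto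
    from ansatz_weak(1)[OF b this has_weak_partialI_test[OF p]] show ?thesis by simp
  qed
  then show ?thesis using ansatz_L2(1,2)[OF b] by (auto simp: has_weak_partial_def L2_locally_integrable)
qed

lemma ansatz_Sigma: "bdd_by r M \<Longrightarrow> ansatz a b r \<in> Sigma_space"
  using ansatz_L2 ansatz_has_weak_partial by (fastforce simp: Sigma_space_def H1_def)

lemma ansatz_weak_equation:
  assumes bd: "bdd_by r M" and r: "continuous_on UNIV r"
    and v: "v \<in> L2" "\<And>j. g j \<in> L2" "\<And>j. has_weak_partial v j (g j)"
  shows "(\<Sum>j\<in>UNIV. LINT x|lborel. ansatz_partial a b r j x * g j x) + (LINT x|lborel. of_real ((norm x)\<^sup>2 - 2) * ansatz a b r x * v x)
     = b * (of_real gauss1 * (LINT x|lborel. of_real (exp (- (norm x)\<^sup>2 / 4)) * r x * v x)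
       - (LINT y|lborel. of_real (exp (- 3 * (norm y)\<^sup>2 / 4)) * r y) * (LINT x|lborel. of_real (exp (- (norm x)\<^sup>2 / 2)) * v x))"
proof -
  let ?phi = "\<lambda>x::real^2. exp (- (norm x)\<^sup>2 / 2)"
  have q2: "(x $ j)\<^sup>2 \<le> (1 + norm x)\<^sup>2" for x :: "real^2" and j
    using component_le_norm_cart[of x j] power_mono[of "\<bar>x $ j\<bar>" "1 + norm x" 2] by simp
  have p1': "(\<lambda>x. complex_of_real (- x $ j * ?phi x)) \<in> L2" for j
    by (rule phi_poly_L2[of _ 1]) (use nth_le_sq in auto)
  have pj: "(\<lambda>x. complex_of_real (?phi x - (x $ j)\<^sup>2 * ?phi x)) \<in> L2" for j
  proof -
    have "\<bar>1 - (x $ j)\<^sup>2\<bar> \<le> 1 * (1 + norm x)\<^sup>2" for x :: "real^2"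
      unfolding mult_1 by (rule abs_leI) (use q2[of x j] one_le_power[of "1 + norm x" 2] zero_le_power2[of "x $ j"] norm_ge_zero[of x] in linarith)+
    then have "(\<lambda>x. complex_of_real ((1 - (x $ j)\<^sup>2) * ?phi x)) \<in> L2" by (intro phi_poly_L2[of _ 1]) auto
    then show ?thesis by (simp only: left_diff_distrib mult_1)
  qed
  have p2: "(\<lambda>x. complex_of_real (((norm x)\<^sup>2 - 2) * ?phi x)) \<in> L2"
  proof -
    have "\<bar>(norm x)\<^sup>2 - 2\<bar> \<le> 2 * (1 + norm x)\<^sup>2" for x :: "real^2"
      using norm_ge_zero[of x] zero_le_power2[of "norm x"] unfolding power2_sum by (intro abs_leI) auto
    then show ?thesis by (intro phi_poly_L2[of _ 2]) auto
  qed
  have k2: "(\<lambda>x. of_real ((norm x)\<^sup>2 - 2) * ker_int res_ker r x) \<in> L2" using ker_int_L2[OF ker_bound_sq_res_ker bd] unfolding ker_int_cmult[abs_def] .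
  have j: "(LINT x|lborel. ansatz_partial a b r j x * g j x) = a * (LINT x|lborel. of_real (- x $ j * ?phi x) * g j x) + b * (LINT x|lborel. ker_int (res_ker_grad j) r x * g j x)" for j
    by (rule integral_lin_comb[OF L2_mult_integrable[OF p1' v(2)] L2_mult_integrable[OF ker_int_L2[OF ker_bound_res_ker_grad bd] v(2)]]) (simp add: ansatz_partial_def algebra_simps)
  have 2: "(LINT x|lborel. of_real ((norm x)\<^sup>2 - 2) * ansatz a b r x * v x) = a * (LINT x|lborel. of_real (((norm x)\<^sup>2 - 2) * ?phi x) * v x) + b * (LINT x|lborel. of_real ((norm x)\<^sup>2 - 2) * ker_int res_ker r x * v x)"
    by (rule integral_lin_comb[OF L2_mult_integrable[OF p2 v(1)] L2_mult_integrable[OF k2 v(1)]]) (simp add: ansatz_def algebra_simps)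
  \<comment> \<open>The ground state is annihilated by H - 2: the functions \<phi> - x_j^2 \<phi>
    sum to (2 - |x|^2) \<phi>.\<close>
  have "(\<Sum>j\<in>UNIV. LINT x|lborel. of_real (- x $ j * ?phi x) * g j x) + (LINT x|lborel. of_real (((norm x)\<^sup>2 - 2) * ?phi x) * v x) = 0"
  proof -
    have "(LINT x|lborel. of_real (- x $ j * ?phi x) * g j x) = (LINT x|lborel. of_real (?phi x - (x $ j)\<^sup>2 * ?phi x) * v x)" for j
      using phi_weak(2)[OF v(1) v(2)[of j] v(3)[of j]] by simp
    then have "(\<Sum>j\<in>UNIV. LINT x|lborel. of_real (- x $ j * ?phi x) * g j x) = (LINT x|lborel. (\<Sum>j\<in>UNIV. of_real (?phi x - (x $ j)\<^sup>2 * ?phi x) * v x))"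
      by (simp only: Bochner_Integration.integral_sum[OF L2_mult_integrable[OF pj v(1)]])
    also have "(\<lambda>x. \<Sum>j\<in>UNIV. of_real (?phi x - (x $ j)\<^sup>2 * ?phi x) * v x) = (\<lambda>x. - (of_real (((norm x)\<^sup>2 - 2) * ?phi x) * v x))"
      unfolding norm_sq_sum[of x for x] UNIV_2 by (auto simp: fun_eq_iff algebra_simps)
    finally show ?thesis by simp
  qed
  then have "a * ((\<Sum>j\<in>UNIV. LINT x|lborel. of_real (- x $ j * ?phi x) * g j x) + (LINT x|lborel. of_real (((norm x)\<^sup>2 - 2) * ?phi x) * v x)) = 0" by simp
  moreover have "(\<Sum>j\<in>UNIV. LINT x|lborel. ansatz_partial a b r j x * g j x) + (LINT x|lborel. of_real ((norm x)\<^sup>2 - 2) * ansatz a b r x * v x)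
    = a * ((\<Sum>j\<in>UNIV. LINT x|lborel. of_real (- x $ j * ?phi x) * g j x) + (LINT x|lborel. of_real (((norm x)\<^sup>2 - 2) * ?phi x) * v x))
      + b * ((\<Sum>j\<in>UNIV. LINT x|lborel. ker_int (res_ker_grad j) r x * g j x) + (LINT x|lborel. of_real ((norm x)\<^sup>2 - 2) * ker_int res_ker r x * v x))"
    unfolding j 2 by (simp only: sum.distrib sum_distrib_left distrib_left) (simp only: add_ac)
  ultimately show ?thesis unfolding ker_int_weak_equation[OF bd r v] by (simp only: add_0)
qed

text \<open>The left-hand side is the sum over \<open>j\<close> of the squared norms of \<open>(\<partial>\<^sub>j + x\<^sub>j) U\<close>.\<close>

lemma ansatz_energy_nonneg:
  fixes a b :: complex and r :: "real^2 \<Rightarrow> complex"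
  assumes b: "bdd_by r M"
  defines "U \<equiv> ansatz a b r" and "Uj \<equiv> ansatz_partial a b r"
  shows "(\<Sum>j\<in>UNIV. LINT x|lborel. Uj j x * cnj (Uj j x)) + (LINT x|lborel. of_real ((norm x)\<^sup>2 - 2) * U x * cnj (U x)) \<in> {z. Im z = 0 \<and> 0 \<le> Re z}"
proof -
  note L = ansatz_L2[OF b, where a = a and b = b, folded U_def Uj_def]
  have i: "integrable lborel (\<lambda>x. Uj j x * cnj (Uj j x))" "integrable lborel (\<lambda>x. U x * cnj (U x))"
     "integrable lborel (\<lambda>x. of_real (x $ j) * U x * cnj (Uj j x))" "integrable lborel (\<lambda>x. Uj j x * cnj (of_real (x $ j) * U x))"
     "integrable lborel (\<lambda>x. of_real (x $ j) * U x * cnj (of_real (x $ j) * U x))" for j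
    by (intro L2_pairing_integrable L)+
  have w: "(LINT x|lborel. (U x + of_real (x $ j) * Uj j x) * cnj (U x)) = - (LINT x|lborel. of_real (x $ j) * U x * cnj (Uj j x))" for j
    unfolding U_def Uj_def
    by (rule ansatz_weak(2)[OF b L2_cnj[OF ansatz_L2(1)[OF b]] L2_cnj[OF ansatz_L2(2)[OF b]] has_weak_partial_cnj[OF ansatz_has_weak_partial[OF b]]])
  have w': "(LINT x|lborel. U x * cnj (U x)) + (LINT x|lborel. Uj j x * cnj (of_real (x $ j) * U x)) = - (LINT x|lborel. of_real (x $ j) * U x * cnj (Uj j x))" for j
    unfolding w[symmetric] using i by (subst Bochner_Integration.integral_add[symmetric]) (auto simp: algebra_simps)
  have alg: "s = - p - q" if "p + q = - s" for p q s :: complex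
    using arg_cong[OF that, of uminus] by simp
  \<comment> \<open>The cross terms of the square form x_j times the derivative of |U|^2 in x_j,
    whose integral is minus that of |U|^2.\<close>
  have nn: "(LINT x|lborel. (Uj j x + of_real (x $ j) * U x) * cnj (Uj j x + of_real (x $ j) * U x))
     = (LINT x|lborel. Uj j x * cnj (Uj j x)) + (LINT x|lborel. of_real (x $ j) * U x * cnj (of_real (x $ j) * U x)) - (LINT x|lborel. U x * cnj (U x))" for j
  proof -
    have "(LINT x|lborel. (Uj j x + of_real (x $ j) * U x) * cnj (Uj j x + of_real (x $ j) * U x))
      = (LINT x|lborel. (Uj j x * cnj (Uj j x) + of_real (x $ j) * U x * cnj (of_real (x $ j) * U x)) + (Uj j x * cnj (of_real (x $ j) * U x) + of_real (x $ j) * U x * cnj (Uj j x)))"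
      by (intro Bochner_Integration.integral_cong) (simp_all add: algebra_simps)
    also have "\<dots> = ((LINT x|lborel. Uj j x * cnj (Uj j x)) + (LINT x|lborel. of_real (x $ j) * U x * cnj (of_real (x $ j) * U x))) + ((LINT x|lborel. Uj j x * cnj (of_real (x $ j) * U x)) + (LINT x|lborel. of_real (x $ j) * U x * cnj (Uj j x)))"
      by (simp only: Bochner_Integration.integral_add Bochner_Integration.integrable_add i)
    also have "(LINT x|lborel. of_real (x $ j) * U x * cnj (Uj j x)) = - (LINT x|lborel. U x * cnj (U x)) - (LINT x|lborel. Uj j x * cnj (of_real (x $ j) * U x))"
      by (rule alg[OF w'])
    finally show ?thesis by simp
  qed
  have "(LINT x|lborel. of_real ((norm x)\<^sup>2 - 2) * U x * cnj (U x))
     = (\<Sum>j\<in>UNIV. (LINT x|lborel. of_real (x $ j) * U x * cnj (of_real (x $ j) * U x)) - (LINT x|lborel. U x * cnj (U x)))"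
  proof -
    have "of_real ((norm x)\<^sup>2 - 2) * U x * cnj (U x) = (\<Sum>j\<in>UNIV. of_real (x $ j) * U x * cnj (of_real (x $ j) * U x) - U x * cnj (U x))" for x
      unfolding norm_sq_sum[of x] UNIV_2 by (simp add: algebra_simps power2_eq_square)
    then have "(LINT x|lborel. of_real ((norm x)\<^sup>2 - 2) * U x * cnj (U x)) = (\<Sum>j\<in>UNIV. (LINT x|lborel. of_real (x $ j) * U x * cnj (of_real (x $ j) * U x) - U x * cnj (U x)))"
      by (simp only: Bochner_Integration.integral_sum Bochner_Integration.integrable_diff i)
    then show ?thesis by (simp only: Bochner_Integration.integral_diff i)
  qed
  then have "(\<Sum>j\<in>UNIV. LINT x|lborel. Uj j x * cnj (Uj j x)) + (LINT x|lborel. of_real ((norm x)\<^sup>2 - 2) * U x * cnj (U x))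
    = (\<Sum>j\<in>UNIV. LINT x|lborel. (Uj j x + of_real (x $ j) * U x) * cnj (Uj j x + of_real (x $ j) * U x))"
    unfolding nn by (simp only: sum.distrib[symmetric]) (simp only: add_diff_eq)
  also have "\<dots> = of_real (\<Sum>j\<in>UNIV. LINT x|lborel. (norm (Uj j x + of_real (x $ j) * U x))\<^sup>2)"
    unfolding complex_norm_square[symmetric] of_real_sum by (simp only: of_real_power[symmetric] integral_complex_of_real)
  finally show ?thesis by (simp add: sum_nonneg)
qed

section \<open>The fixed point\<close>

text \<open>The square root of the ground state. Solutions and sources are both measured relative to
  it, so in these variables the ground state itself is \<open>wt\<close>.\<close>

definition wt :: "real^2 \<Rightarrow> real" where "wt x = exp (- (norm x)\<^sup>2 / 4)"

lemma wt_pos: "0 < wt x" and wt_le_1: "wt x \<le> 1" and wt_nonneg: "0 \<le> wt x" and wt_nz: "wt x \<noteq> 0"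
  by (auto simp: wt_def)

lemma wt_continuous: "continuous_on A wt"
  unfolding wt_def by (intro continuous_intros) auto

lemma wt_measurable [measurable]: "wt \<in> borel_measurable borel"
  by (intro borel_measurable_continuous_onI wt_continuous)

lemma wt_power: "wt x ^ n = exp (- (real n / 4) * (norm x)\<^sup>2)"
  by (simp add: wt_def flip: exp_of_nat_mult)

lemma wt_power_integrable: "n > 0 \<Longrightarrow> integrable lborel (\<lambda>x. wt x ^ n)"
  unfolding wt_power by (rule gaussian_integrable) simp

lemma wt_2: "wt x ^ 2 = exp (- (norm x)\<^sup>2 / 2)" and wt_3: "wt x ^ 3 = exp (- 3 * (norm x)\<^sup>2 / 4)" and wt_4: "wt x ^ 4 = exp (- (norm x)\<^sup>2)"
  by (simp_all add: wt_power)

text \<open>The inner product of \<open>wt * f\<close> with the ground state \<open>wt^2\<close>,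
  hence the third power.\<close>

definition ground_coeff :: "(real^2 \<Rightarrow> complex) \<Rightarrow> complex" where
  "ground_coeff f = (LINT x|lborel. of_real (wt x ^ 3) * f x)"

text \<open>Conjugation with the weight: up to the factor \<open>gauss1\<close>, the resolvent maps
  the source \<open>wt * f\<close> to \<open>wt * res_wt f\<close>, and bounded continuous f to
  bounded continuous functions.\<close>

definition res_wt :: "(real^2 \<Rightarrow> complex) \<Rightarrow> real^2 \<Rightarrow> complex" where
  "res_wt f x = ker_int res_ker f x / of_real (wt x)"

text \<open>The outer division undoes the normalization of the kernel, and subtracting the component
  along \<open>wt\<close> makes the result orthogonal to the ground state by construction.\<close>

definition res_perp :: "(real^2 \<Rightarrow> complex) \<Rightarrow> real^2 \<Rightarrow> complex" where
  "res_perp f x = (res_wt f x - ground_coeff (res_wt f) / of_real gauss1 * of_real (wt x)) / of_real gauss1"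

lemma ground_coeff_integrable: "bdd_by f M \<Longrightarrow> integrable lborel (\<lambda>x. of_real (wt x ^ 3) * f x)"
proof -
  assume b: "bdd_by f M"
  have [measurable]: "f \<in> borel_measurable borel" using b by (simp add: bdd_by_def)
  have "integrable lborel (\<lambda>x. wt x ^ 3 * M)" by (intro integrable_mult_left wt_power_integrable) simp
  then show ?thesis
  proof (rule Bochner_Integration.integrable_bound)
    have "0 \<le> M" using b norm_ge_zero order_trans unfolding bdd_by_def by blast
    then show "AE x in lborel. norm (of_real (wt x ^ 3) * f x) \<le> norm (wt x ^ 3 * M)"
      using b by (intro AE_I2) (auto simp: bdd_by_def norm_mult abs_mult norm_power wt_nonneg intro!: mult_left_mono)
  qed measurable
qed

lemma ground_coeff_bound: "bdd_by f M \<Longrightarrow> norm (ground_coeff f) \<le> (LINT x|lborel. wt x ^ 3) * M"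
proof -
  assume b: "bdd_by f M"
  have "norm (ground_coeff f) \<le> (LINT x|lborel. norm (of_real (wt x ^ 3) * f x))"
    unfolding ground_coeff_def by (rule integral_norm_bound)
  also have "\<dots> \<le> (LINT x|lborel. wt x ^ 3 * M)"
  proof (rule integral_mono)
    show "integrable lborel (\<lambda>x. norm (of_real (wt x ^ 3) * f x))" by (intro integrable_norm ground_coeff_integrable[OF b])
    show "integrable lborel (\<lambda>x. wt x ^ 3 * M)" by (intro integrable_mult_left wt_power_integrable) simp
    show "norm (of_real (wt x ^ 3) * f x) \<le> wt x ^ 3 * M" for x
      using b by (auto simp: bdd_by_def norm_mult norm_power wt_nonneg intro!: mult_left_mono)
  qed
  finally show ?thesis by simp
qed

lemma ground_coeff_diff: "bdd_by f M \<Longrightarrow> bdd_by g N \<Longrightarrow> ground_coeff (\<lambda>x. f x - g x) = ground_coeff f - ground_coeff g"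
  unfolding ground_coeff_def right_diff_distrib by (intro Bochner_Integration.integral_diff ground_coeff_integrable)

lemma ground_coeff_cmult: "ground_coeff (\<lambda>x. c * f x) = c * ground_coeff f"
  unfolding ground_coeff_def mult.left_commute[of _ c] by simp

lemma bdd_by_diff: "bdd_by f M \<Longrightarrow> bdd_by g N \<Longrightarrow> bdd_by (\<lambda>x. f x - g x) (M + N)"
  by (auto simp: bdd_by_def intro!: order_trans[OF norm_triangle_ineq4] add_mono)

lemma bdd_funI: "continuous_on UNIV f \<Longrightarrow> (\<And>x. norm (f x) \<le> M) \<Longrightarrow> bdd_by f M"
  by (auto simp: bdd_by_def intro: borel_measurable_continuous_onI)

lemma res_wt_bdd:
  assumes b: "bdd_by r M" and r: "continuous_on UNIV r"
  shows "continuous_on UNIV (res_wt r)" "bdd_by (res_wt r) (128 * pi * gauss4 * M)"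
proof -
  show c: "continuous_on UNIV (res_wt r)"
    unfolding res_wt_def[abs_def] by (intro continuous_intros ker_int_res_ker_continuous[OF b r] wt_continuous) (simp add: wt_nz)
  show "bdd_by (res_wt r) (128 * pi * gauss4 * M)"
  proof (rule bdd_funI[OF c])
    fix x
    have "norm (res_wt r x) = norm (ker_int res_ker r x) / wt x" using wt_nonneg[of x] by (simp add: res_wt_def norm_divide)
    also have "\<dots> \<le> (128 * pi * gauss4 * M * wt x) / wt x"
      using ker_int_res_ker_bound[OF b, of x] wt_nonneg unfolding wt_def by (intro divide_right_mono) auto
    finally show "norm (res_wt r x) \<le> 128 * pi * gauss4 * M" using wt_nz[of x] by simp
  qed
qed

lemma res_wt_diff: "bdd_by f M \<Longrightarrow> bdd_by g N \<Longrightarrow> res_wt (\<lambda>x. f x - g x) x = res_wt f x - res_wt g x"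
proof -
  assume f: "bdd_by f M" "bdd_by g N"
  have "ker_int res_ker (\<lambda>x. f x - g x) x = ker_int res_ker f x - ker_int res_ker g x"
    unfolding ker_int_def right_diff_distrib scaleR_diff_right
    by (intro Bochner_Integration.integral_diff ker_int_integrable[OF ker_bound_res_ker f(1)] ker_int_integrable[OF ker_bound_res_ker f(2)])
  then show ?thesis by (simp add: res_wt_def diff_divide_distrib)
qed

lemma res_perp_diff:
  assumes "bdd_by f M" "continuous_on UNIV f" "bdd_by g N" "continuous_on UNIV g"
  shows "res_perp (\<lambda>x. f x - g x) x = res_perp f x - res_perp g x"
proof -
  have "res_wt (\<lambda>x. f x - g x) = (\<lambda>x. res_wt f x - res_wt g x)" by (rule ext) (rule res_wt_diff[OF assms(1,3)])
  then have G: "ground_coeff (res_wt (\<lambda>x. f x - g x)) = ground_coeff (res_wt f) - ground_coeff (res_wt g)"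
    using ground_coeff_diff[OF res_wt_bdd(2)[OF assms(1,2)] res_wt_bdd(2)[OF assms(3,4)]] by simp
  show ?thesis unfolding res_perp_def G res_wt_diff[OF assms(1,3)] by (simp add: diff_divide_distrib left_diff_distrib)
qed

definition res_perp_const :: real where
  "res_perp_const = (128 * pi * gauss4 + (LINT x|lborel. wt x ^ 3) * (128 * pi * gauss4) / gauss1) / gauss1"

lemma res_perp_const_nonneg: "0 \<le> res_perp_const"
proof -
  have "0 \<le> (LINT x|lborel. wt x ^ 3)" by (rule Bochner_Integration.integral_nonneg) (simp add: wt_nonneg)
  then show ?thesis using gauss1_pos gauss4_nonneg by (simp add: res_perp_const_def)
qed

lemma res_perp_bound:
  assumes b: "bdd_by r M" and r: "continuous_on UNIV r"
  shows "continuous_on UNIV (res_perp r)" "norm (res_perp r x) \<le> res_perp_const * M"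
proof -
  show "continuous_on UNIV (res_perp r)"
    unfolding res_perp_def[abs_def] using gauss1_pos by (intro continuous_intros res_wt_bdd[OF b r] wt_continuous) auto
  let ?c = "128 * pi * gauss4" and ?I = "LINT x|lborel. wt x ^ 3"
  have M0: "0 \<le> M" using b norm_ge_zero order_trans unfolding bdd_by_def by blast
  have I0: "0 \<le> ?I" by (rule Bochner_Integration.integral_nonneg) (simp add: wt_nonneg)
  have T: "norm (res_wt r x) \<le> ?c * M" using res_wt_bdd(2)[OF b r] by (simp add: bdd_by_def)
  have "norm (ground_coeff (res_wt r) / of_real gauss1 * of_real (wt x)) = norm (ground_coeff (res_wt r)) / gauss1 * wt x"
    using gauss1_pos wt_nonneg[of x] by (simp add: norm_mult norm_divide)
  also have "\<dots> \<le> (?I * (?c * M)) / gauss1 * 1"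
    using ground_coeff_bound[OF res_wt_bdd(2)[OF b r]] gauss1_pos wt_le_1[of x] wt_nonneg[of x] I0 M0 gauss4_nonneg
    by (intro mult_mono divide_right_mono) auto
  finally have "norm (res_wt r x - ground_coeff (res_wt r) / of_real gauss1 * of_real (wt x)) \<le> ?c * M + (?I * (?c * M)) / gauss1 * 1"
    using T by (intro order_trans[OF norm_triangle_ineq4] add_mono)
  then have "norm (res_perp r x) \<le> (?c * M + (?I * (?c * M)) / gauss1 * 1) / gauss1"
    unfolding res_perp_def norm_divide using gauss1_pos by (simp add: divide_right_mono)
  also have "\<dots> = res_perp_const * M" by (simp add: res_perp_const_def add_divide_distrib distrib_left mult_ac)
  finally show "norm (res_perp r x) \<le> res_perp_const * M" .
qed

lemma ground_coeff_wt: "ground_coeff (\<lambda>x. of_real (wt x)) = of_real gauss1"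
proof -
  have "ground_coeff (\<lambda>x. of_real (wt x)) = (LINT x|lborel. of_real (wt x ^ 4))"
    unfolding ground_coeff_def by (intro Bochner_Integration.integral_cong) (simp_all add: numeral_eq_Suc mult_ac)
  also have "\<dots> = of_real gauss1" unfolding integral_complex_of_real wt_4 gauss1_def ..
  finally show ?thesis .
qed

lemma bdd_by_wt: "bdd_by (\<lambda>x. of_real (wt x)) 1"
  by (auto simp: bdd_by_def wt_nonneg wt_le_1)

lemma bdd_by_cmult_wt: "bdd_by (\<lambda>x. c * of_real (wt x)) (norm c)"
  by (auto simp: bdd_by_def norm_mult wt_nonneg wt_le_1 intro!: mult_left_le)

lemma ground_coeff_res_perp:
  assumes b: "bdd_by r M" and r: "continuous_on UNIV r"
  shows "ground_coeff (res_perp r) = 0"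
proof -
  have eq: "res_perp r = (\<lambda>x. inverse (of_real gauss1) * (res_wt r x - ground_coeff (res_wt r) / of_real gauss1 * of_real (wt x)))"
    by (simp add: fun_eq_iff res_perp_def divide_inverse mult.commute)
  have "ground_coeff (\<lambda>x. res_wt r x - ground_coeff (res_wt r) / of_real gauss1 * of_real (wt x)) = 0"
    unfolding ground_coeff_diff[OF res_wt_bdd(2)[OF b r] bdd_by_cmult_wt] ground_coeff_cmult ground_coeff_wt using gauss1_pos by simp
  then show ?thesis unfolding eq ground_coeff_cmult by simp
qed

section \<open>Lipschitz dependence on the profile and the contraction\<close>

type_synonym bcf = "(real^2) \<Rightarrow>\<^sub>C complex"

text \<open>Boundedness and Lipschitz continuity, uniform in the space variable. Scalar functionals are treated
  as constant functions of that variable.\<close>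

definition bdd_lip :: "bcf set \<Rightarrow> (bcf \<Rightarrow> real^2 \<Rightarrow> complex) \<Rightarrow> bool" where
  "bdd_lip S F \<longleftrightarrow> (\<exists>C\<ge>0. \<forall>h\<in>S. \<forall>x. norm (F h x) \<le> C \<and> (\<forall>h'\<in>S. norm (F h x - F h' x) \<le> C * dist h h'))"

lemma blipI:
  assumes "C \<ge> 0" "\<And>h x. h \<in> S \<Longrightarrow> norm (F h x) \<le> C" "D \<ge> 0" "\<And>h h' x. h \<in> S \<Longrightarrow> h' \<in> S \<Longrightarrow> norm (F h x - F h' x) \<le> D * dist h h'"
  shows "bdd_lip S F"
  unfolding bdd_lip_def
proof (intro exI[of _ "max C D"] conjI ballI allI)
  fix h x h' assume h: "h \<in> S" "h' \<in> S"
  show "norm (F h x - F h' x) \<le> max C D * dist h h'"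
    by (rule order_trans[OF assms(4)[OF h]]) (intro mult_right_mono, auto)
qed (use assms in \<open>auto intro: le_max_iff_disj[THEN iffD2]\<close>)

lemma blipE:
  assumes "bdd_lip S F"
  obtains C where "C \<ge> 0" "\<And>h x. h \<in> S \<Longrightarrow> norm (F h x) \<le> C" "\<And>h h' x. h \<in> S \<Longrightarrow> h' \<in> S \<Longrightarrow> norm (F h x - F h' x) \<le> C * dist h h'"
  using assms unfolding bdd_lip_def by blast

lemma bdd_lip_const: "(\<And>x. norm (g x) \<le> C) \<Longrightarrow> bdd_lip S (\<lambda>h. g)"
  by (rule blipI[of C _ _ 0]) (auto intro: order_trans[OF norm_ge_zero])

lemma bdd_lip_id: "bdd_lip (cball h0 R) apply_bcontfun"
proof (rule blipI[of "norm h0 + \<bar>R\<bar>" _ _ 1])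
  fix h x assume "h \<in> cball h0 R"
  then have "norm h \<le> norm h0 + \<bar>R\<bar>" using norm_triangle_ineq2[of h h0] by (auto simp: dist_norm norm_minus_commute)
  then show "norm (h x) \<le> norm h0 + \<bar>R\<bar>" using norm_bounded[of h x] by linarith
next
  fix h h' :: bcf and x
  show "norm (h x - h' x) \<le> 1 * dist h h'" using dist_bounded[of h x h'] by (simp add: dist_norm)
qed auto

lemma bdd_lip_add: "bdd_lip S F \<Longrightarrow> bdd_lip S G \<Longrightarrow> bdd_lip S (\<lambda>h x. F h x + G h x)"
proof -
  assume "bdd_lip S F" "bdd_lip S G"
  then obtain C D where C: "C \<ge> 0" "\<And>h x. h \<in> S \<Longrightarrow> norm (F h x) \<le> C" "\<And>h h' x. h \<in> S \<Longrightarrow> h' \<in> S \<Longrightarrow> norm (F h x - F h' x) \<le> C * dist h h'"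
    and D: "D \<ge> 0" "\<And>h x. h \<in> S \<Longrightarrow> norm (G h x) \<le> D" "\<And>h h' x. h \<in> S \<Longrightarrow> h' \<in> S \<Longrightarrow> norm (G h x - G h' x) \<le> D * dist h h'"
    by (elim blipE) blast
  show ?thesis
  proof (rule blipI[of "C + D" _ _ "C + D"])
    fix h h' x assume h: "h \<in> S" "h' \<in> S"
    have "norm ((F h x - F h' x) + (G h x - G h' x)) \<le> C * dist h h' + D * dist h h'"
      by (intro order_trans[OF norm_triangle_ineq] add_mono C D h)
    then show "norm (F h x + G h x - (F h' x + G h' x)) \<le> (C + D) * dist h h'" by (simp add: algebra_simps)
  qed (use C D in \<open>auto intro!: order_trans[OF norm_triangle_ineq] add_mono\<close>)
qed

lemma bdd_lip_mult: "bdd_lip S F \<Longrightarrow> bdd_lip S G \<Longrightarrow> bdd_lip S (\<lambda>h x. F h x * G h x)"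
proof -
  assume "bdd_lip S F" "bdd_lip S G"
  then obtain C D where C: "C \<ge> 0" "\<And>h x. h \<in> S \<Longrightarrow> norm (F h x) \<le> C" "\<And>h h' x. h \<in> S \<Longrightarrow> h' \<in> S \<Longrightarrow> norm (F h x - F h' x) \<le> C * dist h h'"
    and D: "D \<ge> 0" "\<And>h x. h \<in> S \<Longrightarrow> norm (G h x) \<le> D" "\<And>h h' x. h \<in> S \<Longrightarrow> h' \<in> S \<Longrightarrow> norm (G h x - G h' x) \<le> D * dist h h'"
    by (elim blipE) blast
  show ?thesis
  proof (rule blipI[of "C * D" _ _ "C * D + C * D"])
    fix h h' x assume h: "h \<in> S" "h' \<in> S"
    have "norm (F h x * (G h x - G h' x) + (F h x - F h' x) * G h' x) \<le> C * (D * dist h h') + (C * dist h h') * D"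
      unfolding norm_mult using C(1) D(1)
      by (intro order_trans[OF norm_triangle_ineq] add_mono) (auto simp: norm_mult intro!: mult_mono C D h)
    then show "norm (F h x * G h x - F h' x * G h' x) \<le> (C * D + C * D) * dist h h'" by (simp add: algebra_simps)
  qed (use C D in \<open>auto simp: norm_mult intro!: mult_mono\<close>)
qed

lemma bdd_lip_cmult: "bdd_lip S F \<Longrightarrow> bdd_lip S (\<lambda>h x. c * F h x)"
  by (intro bdd_lip_mult bdd_lip_const[of _ "norm c"]) auto

lemma bdd_lip_uminus: "bdd_lip S F \<Longrightarrow> bdd_lip S (\<lambda>h x. - F h x)"
  using bdd_lip_cmult[of S F "-1"] by simp

lemma bdd_lip_diff: "bdd_lip S F \<Longrightarrow> bdd_lip S G \<Longrightarrow> bdd_lip S (\<lambda>h x. F h x - G h x)"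
  using bdd_lip_add[OF _ bdd_lip_uminus, of S F G] by simp

lemma bdd_lip_cnj: "bdd_lip S F \<Longrightarrow> bdd_lip S (\<lambda>h x. cnj (F h x))"
  unfolding bdd_lip_def by (simp flip: complex_cnj_diff)

lemma bdd_lip_Re: "bdd_lip S F \<Longrightarrow> bdd_lip S (\<lambda>h x. of_real (Re (F h x)))"
proof (elim blipE)
  fix C assume C: "C \<ge> 0" "\<And>h x. h \<in> S \<Longrightarrow> norm (F h x) \<le> C" "\<And>h h' x. h \<in> S \<Longrightarrow> h' \<in> S \<Longrightarrow> norm (F h x - F h' x) \<le> C * dist h h'"
  show ?thesis
  proof (rule blipI[OF C(1) _ C(1)])
    show "norm (complex_of_real (Re (F h x))) \<le> C" if "h \<in> S" for h x
      using order_trans[OF abs_Re_le_cmod C(2)[OF that]] by simp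
    show "norm (complex_of_real (Re (F h x)) - complex_of_real (Re (F h' x))) \<le> C * dist h h'" if "h \<in> S" "h' \<in> S" for h h' x
      using order_trans[OF abs_Re_le_cmod C(3)[OF that, of x]] by (simp flip: of_real_diff)
  qed
qed

lemma bdd_lip_inverse:
  assumes "bdd_lip S F" "c > 0" "\<And>h x. h \<in> S \<Longrightarrow> norm (F h x) \<ge> c"
  shows "bdd_lip S (\<lambda>h x. inverse (F h x))"
proof -
  obtain C where C: "C \<ge> 0" "\<And>h h' x. h \<in> S \<Longrightarrow> h' \<in> S \<Longrightarrow> norm (F h x - F h' x) \<le> C * dist h h'" using assms(1) by (elim blipE) blast
  have inv: "norm (inverse (F h x)) \<le> inverse c" if "h \<in> S" for h x
    using assms(2,3) that by (simp add: norm_inverse le_imp_inverse_le)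
  show ?thesis
  proof (rule blipI[of "inverse c" _ _ "inverse c * C * inverse c"])
    fix h h' x assume h: "h \<in> S" "h' \<in> S"
    have "F h x \<noteq> 0" using assms(2) assms(3)[OF h(1), of x] by auto
    moreover have "F h' x \<noteq> 0" using assms(2) assms(3)[OF h(2), of x] by auto
    ultimately have "inverse (F h x) - inverse (F h' x) = - (inverse (F h x) * (F h x - F h' x) * inverse (F h' x))" by (rule inverse_diff_inverse)
    then have "norm (inverse (F h x) - inverse (F h' x)) = norm (inverse (F h x)) * norm (F h x - F h' x) * norm (inverse (F h' x))"
      by (simp add: norm_mult)
    also have "\<dots> \<le> inverse c * (C * dist h h') * inverse c"
      using assms(2) C(1) by (intro mult_mono inv C h) auto
    finally show "norm (inverse (F h x) - inverse (F h' x)) \<le> inverse c * C * inverse c * dist h h'" by (simp add: mult_ac)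
  qed (use assms(2) C(1) inv in auto)
qed

lemma bdd_lip_integral:
  assumes F: "bdd_lip S F" and k: "integrable lborel k" "\<And>y. 0 \<le> k y" and m: "\<And>h. h \<in> S \<Longrightarrow> F h \<in> borel_measurable borel"
  shows "bdd_lip S (\<lambda>h x. LINT y|lborel. of_real (k y) * F h y)"
proof -
  obtain C where C: "C \<ge> 0" "\<And>h x. h \<in> S \<Longrightarrow> norm (F h x) \<le> C" "\<And>h h' x. h \<in> S \<Longrightarrow> h' \<in> S \<Longrightarrow> norm (F h x - F h' x) \<le> C * dist h h'"
    using F by (elim blipE) blast
  have [measurable]: "k \<in> borel_measurable borel" using k(1) by auto
  have *: "integrable lborel (\<lambda>y. of_real (k y) * f y)" "norm (LINT y|lborel. of_real (k y) * f y) \<le> (LINT y|lborel. k y) * B"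
    if f: "f \<in> borel_measurable borel" "\<And>y. norm (f y) \<le> B" for f :: "real^2 \<Rightarrow> complex" and B
  proof -
    have [measurable]: "f \<in> borel_measurable borel" by fact
    have B: "0 \<le> B" using order_trans[OF norm_ge_zero f(2)] by blast
    have le: "norm (of_real (k y) * f y) \<le> k y * B" for y using f(2) k(2) by (auto simp: norm_mult intro!: mult_left_mono)
    have kB: "integrable lborel (\<lambda>y. k y * B)" using k(1) by (rule integrable_mult_left)
    show i: "integrable lborel (\<lambda>y. of_real (k y) * f y)"
      by (rule Bochner_Integration.integrable_bound[OF kB]) (use le k(2) B in \<open>auto simp: abs_mult\<close>)
    have "norm (LINT y|lborel. of_real (k y) * f y) \<le> (LINT y|lborel. norm (of_real (k y) * f y))" by (rule integral_norm_bound)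
    also have "\<dots> \<le> (LINT y|lborel. k y * B)" by (intro integral_mono integrable_norm i kB le)
    finally show "norm (LINT y|lborel. of_real (k y) * f y) \<le> (LINT y|lborel. k y) * B" by simp
  qed
  have I0: "0 \<le> (LINT y|lborel. k y)" by (rule Bochner_Integration.integral_nonneg) (rule k)
  show ?thesis
  proof (rule blipI[of "(LINT y|lborel. k y) * C" _ _ "(LINT y|lborel. k y) * C"])
    fix h h' x assume h: "h \<in> S" "h' \<in> S"
    have "(LINT y|lborel. of_real (k y) * F h y) - (LINT y|lborel. of_real (k y) * F h' y) = (LINT y|lborel. of_real (k y) * (F h y - F h' y))"
      using *(1)[OF m[OF h(1)] C(2)[OF h(1)]] *(1)[OF m[OF h(2)] C(2)[OF h(2)]] by (simp add: right_diff_distrib)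
    also have "norm \<dots> \<le> (LINT y|lborel. k y) * (C * dist h h')"
      using h by (intro * C borel_measurable_diff m)
    finally show "norm ((LINT y|lborel. of_real (k y) * F h y) - (LINT y|lborel. of_real (k y) * F h' y)) \<le> (LINT y|lborel. k y) * C * dist h h'"
      by (simp add: mult.assoc)
  qed (use C I0 m * in auto)
qed

lemma fixed_point_exists:
  fixes A B :: "bcf \<Rightarrow> real^2 \<Rightarrow> complex"
  assumes A: "bdd_lip (cball h0 \<rho>) A" and B: "bdd_lip (cball h0 \<rho>) B" and \<rho>: "0 < \<rho>"
    and cA: "\<And>h. h \<in> cball h0 \<rho> \<Longrightarrow> continuous_on UNIV (A h)"
    and cB: "\<And>h. h \<in> cball h0 \<rho> \<Longrightarrow> continuous_on UNIV (B h)"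
  shows "\<exists>\<eta>>0. \<forall>\<delta> \<epsilon>. 0 \<le> \<delta> \<longrightarrow> 0 \<le> \<epsilon> \<longrightarrow> \<delta> + \<epsilon> < \<eta> \<longrightarrow>
     (\<exists>h\<in>cball h0 \<rho>. \<forall>x. apply_bcontfun h x = apply_bcontfun h0 x + res_perp (\<lambda>x. of_real \<delta> * A h x + of_real \<epsilon> * B h x) x)"
proof -
  let ?S = "cball h0 \<rho>"
  obtain CA CB where CA: "CA \<ge> 0" "\<And>h x. h \<in> ?S \<Longrightarrow> norm (A h x) \<le> CA" "\<And>h h' x. h \<in> ?S \<Longrightarrow> h' \<in> ?S \<Longrightarrow> norm (A h x - A h' x) \<le> CA * dist h h'"
    and CB: "CB \<ge> 0" "\<And>h x. h \<in> ?S \<Longrightarrow> norm (B h x) \<le> CB" "\<And>h h' x. h \<in> ?S \<Longrightarrow> h' \<in> ?S \<Longrightarrow> norm (B h x - B h' x) \<le> CB * dist h h'"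
    using A B by (elim blipE) blast
  define C where "C = CA + CB + 1"
  define L where "L = res_perp_const * C"
  have L0: "0 \<le> L" using res_perp_const_nonneg CA CB by (simp add: L_def C_def)
  \<comment> \<open>Makes L (\<delta> + \<epsilon>) at most \<rho>, so that the ball is mapped into
    itself, and at most 1/2, the contraction factor. The summand 1 guards against L = 0.\<close>
  define \<eta> where "\<eta> = min \<rho> (1/2) / (L + 1)"
  have \<eta>: "0 < \<eta>" using \<rho> L0 by (simp add: \<eta>_def)
  show ?thesis
  proof (intro exI[of _ \<eta>] conjI allI impI \<eta>)
    fix \<delta> \<epsilon> :: real assume \<delta>: "0 \<le> \<delta>" "0 \<le> \<epsilon>" "\<delta> + \<epsilon> < \<eta>"
    have Ls: "L * (\<delta> + \<epsilon>) \<le> min \<rho> (1/2)"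
    proof -
      have "(L + 1) * (\<delta> + \<epsilon>) \<le> (L + 1) * \<eta>" using \<delta> L0 by (intro mult_left_mono) auto
      also have "\<dots> = min \<rho> (1/2)" using L0 by (simp add: \<eta>_def)
      finally show ?thesis using \<delta> by (simp add: distrib_right)
    qed
    define r where "r h x = of_real \<delta> * A h x + of_real \<epsilon> * B h x" for h x
    have rc: "continuous_on UNIV (r h)" if "h \<in> ?S" for h
      unfolding r_def[abs_def] using that by (intro continuous_intros cA cB)
    have est: "norm (of_real \<delta> * a + of_real \<epsilon> * b) \<le> (\<delta> + \<epsilon>) * C * d" if "norm a \<le> CA * d" "norm b \<le> CB * d" "0 \<le> d" for a b :: complex and d
    proof -
      have "norm (of_real \<delta> * a + of_real \<epsilon> * b) \<le> \<delta> * norm a + \<epsilon> * norm b"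
        using \<delta> by (intro order_trans[OF norm_triangle_ineq]) (simp add: norm_mult)
      also have "\<dots> \<le> \<delta> * (C * d) + \<epsilon> * (C * d)"
        using \<delta> that CA(1) CB(1) by (intro add_mono mult_left_mono) (auto simp: C_def algebra_simps intro: order_trans)
      finally show ?thesis by (simp add: algebra_simps)
    qed
    have rb: "bdd_by (r h) ((\<delta> + \<epsilon>) * C * 1)" if "h \<in> ?S" for h
      unfolding r_def using that CA(2) CB(2) by (intro bdd_funI rc[unfolded r_def[abs_def]] est) auto
    define P where "P h = Bcontfun (\<lambda>x. h0 x + res_perp (r h) x)" for h
    have P: "apply_bcontfun (P h) = (\<lambda>x. h0 x + res_perp (r h) x)" if "h \<in> ?S" for h
    proof -
      have "(\<lambda>x. h0 x + res_perp (r h) x) \<in> bcontfun"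
      proof (rule bcontfun_normI)
        show "continuous_on UNIV (\<lambda>x. h0 x + res_perp (r h) x)"
          using res_perp_bound(1)[OF rb rc] that by (intro continuous_intros) auto
        show "norm (h0 x + res_perp (r h) x) \<le> norm h0 + res_perp_const * ((\<delta> + \<epsilon>) * C * 1)" for x
          by (intro order_trans[OF norm_triangle_ineq] add_mono norm_bounded res_perp_bound(2)[OF rb rc] that)
      qed
      then show ?thesis unfolding P_def by (rule Bcontfun_inverse)
    qed
    have "\<exists>!h\<in>?S. P h = h"
    proof (rule Banach_fix[OF closed_cball[of h0 \<rho>, folded complete_eq_closed], where c = "1/2"])
      show "?S \<noteq> {}" using \<rho> by auto
      show "P ` ?S \<subseteq> ?S"
      proof safe
        fix h assume h: "h \<in> ?S"
        have "dist (P h) h0 \<le> \<rho>"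
        proof (rule dist_bound)
          fix x
          have "norm (res_perp (r h) x) \<le> res_perp_const * ((\<delta> + \<epsilon>) * C * 1)" by (rule res_perp_bound(2)[OF rb rc]) fact+
          also have "\<dots> \<le> \<rho>" using Ls by (simp add: L_def mult_ac)
          finally show "dist (P h x) (h0 x) \<le> \<rho>" by (simp add: P[OF h] dist_norm)
        qed
        then show "P h \<in> ?S" by (simp add: dist_commute)
      qed
      fix h h' assume h: "h \<in> ?S" "h' \<in> ?S"
      show "dist (P h) (P h') \<le> 1/2 * dist h h'"
      proof (rule dist_bound)
        fix x
        have c: "continuous_on UNIV (\<lambda>x. r h x - r h' x)" by (intro continuous_intros rc h)
        have "r h x - r h' x = of_real \<delta> * (A h x - A h' x) + of_real \<epsilon> * (B h x - B h' x)" for x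
          by (simp add: r_def algebra_simps)
        then have b: "bdd_by (\<lambda>x. r h x - r h' x) ((\<delta> + \<epsilon>) * C * dist h h')"
          using CA(3)[OF h] CB(3)[OF h] by (intro bdd_funI c) (simp add: est)
        have "dist (P h x) (P h' x) = norm (res_perp (\<lambda>x. r h x - r h' x) x)"
          unfolding res_perp_diff[OF rb[OF h(1)] rc[OF h(1)] rb[OF h(2)] rc[OF h(2)]] P[OF h(1)] P[OF h(2)] by (simp add: dist_norm)
        also have "\<dots> \<le> res_perp_const * ((\<delta> + \<epsilon>) * C * dist h h')" by (rule res_perp_bound(2)[OF b c])
        also have "\<dots> = L * (\<delta> + \<epsilon>) * dist h h'" by (simp add: L_def mult_ac)
        also have "\<dots> \<le> 1/2 * dist h h'" using Ls by (intro mult_right_mono) auto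
        finally show "dist (P h x) (P h' x) \<le> 1/2 * dist h h'" .
      qed
    qed auto
    then obtain h where h: "h \<in> ?S" "P h = h" by blast
    have "apply_bcontfun h = (\<lambda>x. h0 x + res_perp (r h) x)" using P[OF h(1)] h(2) by simp
    then show "\<exists>h\<in>?S. \<forall>x. apply_bcontfun h x = apply_bcontfun h0 x + res_perp (\<lambda>x. of_real \<delta> * A h x + of_real \<epsilon> * B h x) x"
      using h(1) by (intro bexI[of _ h]) (auto simp: r_def[abs_def])
  qed
qed

section \<open>From profiles to standing waves\<close>

lemma integral_continuous_pos:
  fixes f :: "real^2 \<Rightarrow> real"
  assumes f: "continuous_on UNIV f" "\<And>x. 0 \<le> f x" "0 < f x0" and i: "integrable lborel f"
  shows "0 < (LINT x|lborel. f x)"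
proof -
  have "(LINT x|lborel. f x) \<noteq> 0"
  proof
    assume "(LINT x|lborel. f x) = 0"
    then have "AE x in lborel. f x = 0"
      using integral_nonneg_eq_0_iff_AE[OF i] f(2) by simp
    then have "AE x in lborel. x \<notin> {x. 0 < f x}" by eventually_elim simp
    moreover have op: "open {x. 0 < f x}" using f(1) by (intro open_Collect_less continuous_intros)
    ultimately have "emeasure lborel {x. 0 < f x} = 0" by (subst (asm) AE_iff_measurable[of "{x. 0 < f x}"]) auto
    then have "{x. 0 < f x} \<in> null_sets lborel" using op by auto
    then have "negligible {x. 0 < f x}" by (simp add: negligible_iff_null_sets null_sets_completionI)
    then show False using open_not_negligible[OF op] f(3) by auto
  qed
  moreover have "0 \<le> (LINT x|lborel. f x)" by (rule Bochner_Integration.integral_nonneg) (rule f)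
  ultimately show ?thesis by simp
qed

text \<open>What the dual norm requires is a bound linear in the norm b of v. It comes from
  integrating 2 b |Q| |v| \<le> b^2 |Q|^2 + |v|^2, and the case b = 0 is treated separately because
  b is divided out.\<close>

lemma norm_L2_pairing_le:
  assumes Q: "Q \<in> L2" and v: "v \<in> L2"
  shows "norm (L2_pairing Q v) \<le> ((LINT x|lborel. (norm (Q x))\<^sup>2) + 1) / 2 * sqrt (LINT x|lborel. (norm (v x))\<^sup>2)"
proof -
  define A B where "A = (LINT x|lborel. (norm (Q x))\<^sup>2)" and "B = (LINT x|lborel. (norm (v x))\<^sup>2)"
  define b where "b = sqrt B"
  have B0: "0 \<le> B" unfolding B_def by (rule Bochner_Integration.integral_nonneg) simp
  then have b: "0 \<le> b" "b\<^sup>2 = B" by (auto simp: b_def)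
  have i: "integrable lborel (\<lambda>x. norm (Q x * cnj (v x)))" by (intro integrable_norm L2_pairing_integrable Q v)
  have I: "norm (L2_pairing Q v) \<le> (LINT x|lborel. norm (Q x * cnj (v x)))"
    unfolding L2_pairing_def by (rule integral_norm_bound)
  show ?thesis
  proof (cases "b = 0")
    case True
    then have "(LINT x|lborel. (norm (v x))\<^sup>2) = 0" using b B_def by simp
    then have "AE x in lborel. (norm (v x))\<^sup>2 = 0"
      using integral_nonneg_eq_0_iff_AE[OF L2_integrable[OF v]] by simp
    then have "AE x in lborel. Q x * cnj (v x) = 0" by eventually_elim simp
    then have "L2_pairing Q v = 0" unfolding L2_pairing_def by (rule integral_eq_zero_AE)
    then show ?thesis using B0 by (simp add: A_def[symmetric] B_def[symmetric]) (simp add: A_def)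
  next
    case False
    then have b0: "0 < b" using b by simp
    have "2 * b * (LINT x|lborel. norm (Q x * cnj (v x))) = (LINT x|lborel. 2 * b * norm (Q x * cnj (v x)))" by simp
    also have "\<dots> \<le> (LINT x|lborel. b\<^sup>2 * (norm (Q x))\<^sup>2 + (norm (v x))\<^sup>2)"
    proof (rule integral_mono)
      show "integrable lborel (\<lambda>x. 2 * b * norm (Q x * cnj (v x)))" using i by (rule integrable_mult_right)
      show "integrable lborel (\<lambda>x. b\<^sup>2 * (norm (Q x))\<^sup>2 + (norm (v x))\<^sup>2)"
        by (intro Bochner_Integration.integrable_add integrable_mult_right L2_integrable Q v)
      show "2 * b * norm (Q x * cnj (v x)) \<le> b\<^sup>2 * (norm (Q x))\<^sup>2 + (norm (v x))\<^sup>2" for x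
        using zero_le_power2[of "b * norm (Q x) - norm (v x)"] by (simp add: norm_mult power2_diff power_mult_distrib)
    qed
    also have "\<dots> = b\<^sup>2 * A + b\<^sup>2"
      unfolding b(2) A_def using L2_integrable[OF Q] L2_integrable[OF v] by (simp add: B_def)
    finally have "2 * b * (LINT x|lborel. norm (Q x * cnj (v x))) \<le> 2 * b * ((A + 1) / 2 * b)"
      by (simp add: power2_eq_square algebra_simps)
    then have "(LINT x|lborel. norm (Q x * cnj (v x))) \<le> (A + 1) / 2 * b"
      using b0 by (subst (asm) mult_le_cancel_left_pos) auto
    then show ?thesis using I by (simp add: A_def B_def b_def)
  qed
qed

lemma L2_norm_le_Sigma_norm: "sqrt (LINT x|lborel. (norm (v x))\<^sup>2) \<le> Sigma_norm v"
  unfolding Sigma_norm_def by (intro real_sqrt_le_mono) (simp add: add_nonneg_nonneg sum_nonneg)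

lemma ansatz_scale: "ansatz (z * a) (z * b) r x = z * ansatz a b r x" "ansatz_partial (z * a) (z * b) r j x = z * ansatz_partial a b r j x"
  by (simp_all add: ansatz_def ansatz_partial_def algebra_simps)

lemma ansatz_scale_Sigma:
  assumes b: "bdd_by r M"
  shows "(\<lambda>x. z * ansatz a b r x) \<in> Sigma_space" "has_weak_partial (\<lambda>x. z * ansatz a b r x) j (\<lambda>x. z * ansatz_partial a b r j x)"
  using ansatz_Sigma[OF b, of "z * a" "z * b"] ansatz_has_weak_partial[OF b, of "z * a" "z * b" j]
  unfolding ansatz_scale[abs_def] by auto

lemma ansatz_scale_AE:
  assumes b: "bdd_by r M"
  shows "AE x in lborel. weak_partial j (\<lambda>x. z * ansatz a b r x) x = z * ansatz_partial a b r j x"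
  by (rule Sigma_space_weak_partial_AE[OF ansatz_scale_Sigma[OF b]])

text \<open>Homogeneity is not immediate from the definition, since \<open>weak_partial\<close>
  makes a separate choice for every z. Each choice agrees almost everywhere with z times
  \<open>ansatz_partial\<close>.\<close>

lemma ansatz_Sigma_norm:
  assumes b: "bdd_by r M"
  shows "\<exists>K. \<forall>z. Sigma_norm (\<lambda>x. z * ansatz a b r x) = norm z * K"
proof (intro exI allI)
  fix z
  have [measurable]: "ansatz_partial a b r j \<in> borel_measurable borel" for j using ansatz_L2(2)[OF b] by (rule L2_measurable)
  have [measurable]: "weak_partial j (\<lambda>x. z * ansatz a b r x) \<in> borel_measurable borel" for j
    using Sigma_space_weak_partial(2)[OF ansatz_scale_Sigma(1)[OF b]] by (rule L2_measurable)
  have j: "(LINT x|lborel. (norm (weak_partial j (\<lambda>x. z * ansatz a b r x) x))\<^sup>2) = (norm z)\<^sup>2 * (LINT x|lborel. (norm (ansatz_partial a b r j x))\<^sup>2)" for j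
  proof -
    have "(LINT x|lborel. (norm (weak_partial j (\<lambda>x. z * ansatz a b r x) x))\<^sup>2) = (LINT x|lborel. (norm z)\<^sup>2 * (norm (ansatz_partial a b r j x))\<^sup>2)"
    proof (rule integral_cong_AE)
      show "AE x in lborel. (norm (weak_partial j (\<lambda>x. z * ansatz a b r x) x))\<^sup>2 = (norm z)\<^sup>2 * (norm (ansatz_partial a b r j x))\<^sup>2"
        using ansatz_scale_AE[OF b, of j z a b] by eventually_elim (simp add: norm_mult power_mult_distrib)
    qed measurable
    then show ?thesis by simp
  qed
  have "(norm (norm x *\<^sub>R (z * ansatz a b r x)))\<^sup>2 = (norm z)\<^sup>2 * (norm (norm x *\<^sub>R ansatz a b r x))\<^sup>2"
    "(norm (z * ansatz a b r x))\<^sup>2 = (norm z)\<^sup>2 * (norm (ansatz a b r x))\<^sup>2" for x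
    by (simp_all add: norm_mult power_mult_distrib)
  then have "Sigma_norm (\<lambda>x. z * ansatz a b r x) = sqrt ((norm z)\<^sup>2 * ((\<Sum>j\<in>UNIV. LINT x|lborel. (norm (ansatz_partial a b r j x))\<^sup>2)
      + (LINT x|lborel. (norm (norm x *\<^sub>R ansatz a b r x))\<^sup>2) + (LINT x|lborel. (norm (ansatz a b r x))\<^sup>2)))"
    unfolding Sigma_norm_def j by (simp only: integral_mult_right_zero distrib_left sum_distrib_left)
  then show "Sigma_norm (\<lambda>x. z * ansatz a b r x) = norm z * sqrt ((\<Sum>j\<in>UNIV. LINT x|lborel. (norm (ansatz_partial a b r j x))\<^sup>2)
      + (LINT x|lborel. (norm (norm x *\<^sub>R ansatz a b r x))\<^sup>2) + (LINT x|lborel. (norm (ansatz a b r x))\<^sup>2))"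
    by (simp add: real_sqrt_mult)
qed

lemma exp_quotient_tendsto:
  fixes c :: complex
  shows "((\<lambda>h::real. (exp (c * of_real (t + h)) - exp (c * of_real t)) / of_real h) \<longlongrightarrow> c * exp (c * of_real t)) (at 0)"
proof -
  have "((\<lambda>z. exp (c * (of_real t + z))) has_field_derivative c * exp (c * of_real t)) (at 0)"
    by (auto intro!: derivative_eq_intros)
  then have "((\<lambda>z. (exp (c * (of_real t + z)) - exp (c * of_real t)) / z) \<longlongrightarrow> c * exp (c * of_real t)) (at 0)"
    by (simp add: has_field_derivative_iff)
  moreover have "filterlim (\<lambda>h::real. complex_of_real h) (at 0) (at 0)"
    by (rule filterlim_atI) (auto intro!: tendsto_eq_intros simp: eventually_at_filter)
  ultimately show ?thesis by (auto dest: filterlim_compose)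
qed

text \<open>Time only turns the phase, so \<open>eq\<close> is assumed on the whole circle of radius
  \<open>\<kappa>\<close>. All differences in time factor into a scalar and a fixed profile, which
  reduces continuity and the dual derivative to limits of the exponential, uniformly over v.\<close>

lemma standing_wave_solves_evolution:
  assumes b: "bdd_by r M"
    and eq: "\<And>z v. norm z = \<kappa> \<Longrightarrow> v \<in> Sigma_space \<Longrightarrow> GP_functional \<sigma> \<epsilon> \<alpha> (\<lambda>x. z * ansatz a b r x) v = of_real \<mu> * L2_pairing (\<lambda>x. z * ansatz a b r x) v"
    and \<kappa>: "0 \<le> \<kappa>"
  shows "solves_evolution \<sigma> \<epsilon> \<alpha> (\<lambda>t x. exp (- \<i> * of_real (t * \<mu>)) * (of_real \<kappa> * ansatz a b r x))"
proof -
  define e where "e t = exp (- \<i> * of_real \<mu> * of_real t)" for t :: real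
  have e: "exp (- \<i> * of_real (t * \<mu>)) * (of_real \<kappa> * ansatz a b r x) = (e t * of_real \<kappa>) * ansatz a b r x" for t x
    by (simp add: e_def mult_ac)
  have ne: "norm (e t) = 1" for t by (simp add: e_def norm_exp_eq_Re)
  obtain K where K: "\<And>z. Sigma_norm (\<lambda>x. z * ansatz a b r x) = norm z * K" using ansatz_Sigma_norm[OF b] by blast
  have ec: "(e \<longlongrightarrow> e t) (at t)" for t
    unfolding e_def by (intro tendsto_intros)
  have 1: "((\<lambda>s. Sigma_norm (\<lambda>x. (e s * of_real \<kappa>) * ansatz a b r x - (e t * of_real \<kappa>) * ansatz a b r x)) \<longlongrightarrow> 0) (at t)" for t
  proof -
    have "((\<lambda>s. norm (e s * of_real \<kappa> - e t * of_real \<kappa>) * K) \<longlongrightarrow> norm (e t * of_real \<kappa> - e t * of_real \<kappa>) * K) (at t)"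
      by (intro tendsto_intros ec)
    then show ?thesis unfolding left_diff_distrib[symmetric] K by simp
  qed
  have 2: "\<exists>D. has_dual_time_derivative (\<lambda>t x. (e t * of_real \<kappa>) * ansatz a b r x) D t \<and>
        (\<forall>v\<in>Sigma_space. \<i> * D v = GP_functional \<sigma> \<epsilon> \<alpha> (\<lambda>x. (e t * of_real \<kappa>) * ansatz a b r x) v)" for t
  proof (intro exI conjI ballI)
    define Q where "Q x = of_real \<kappa> * ansatz a b r x" for x
    let ?D = "\<lambda>v. (- \<i> * of_real \<mu> * e t) * L2_pairing Q v"
    have lp: "L2_pairing (\<lambda>x. (e s * of_real \<kappa>) * ansatz a b r x) v = e s * L2_pairing Q v" for s v
      unfolding L2_pairing_def Q_def by (simp add: mult.assoc)
    fix v assume v: "v \<in> Sigma_space"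
    show "\<i> * ?D v = GP_functional \<sigma> \<epsilon> \<alpha> (\<lambda>x. (e t * of_real \<kappa>) * ansatz a b r x) v"
    proof -
      have "GP_functional \<sigma> \<epsilon> \<alpha> (\<lambda>x. (e t * of_real \<kappa>) * ansatz a b r x) v = of_real \<mu> * (e t * L2_pairing Q v)"
        using \<kappa> ne v unfolding lp[symmetric] by (intro eq) (auto simp: norm_mult)
      then show ?thesis by (simp add: mult.assoc[symmetric])
    qed
  next
    define Q where "Q x = of_real \<kappa> * ansatz a b r x" for x
    have QL: "Q \<in> L2" unfolding Q_def[abs_def] by (intro L2_cmult ansatz_L2[OF b])
    have lp: "L2_pairing (\<lambda>x. (e s * of_real \<kappa>) * ansatz a b r x) v = e s * L2_pairing Q v" for s v
      unfolding L2_pairing_def Q_def by (simp add: mult.assoc)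
    define A where "A = ((LINT x|lborel. (norm (Q x))\<^sup>2) + 1) / 2"
    have A0: "0 < A" unfolding A_def by (intro divide_pos_pos add_nonneg_pos Bochner_Integration.integral_nonneg) auto
    have A: "norm (L2_pairing Q v) \<le> A * Sigma_norm v" if "v \<in> Sigma_space" for v
    proof -
      have "norm (L2_pairing Q v) \<le> A * sqrt (LINT x|lborel. (norm (v x))\<^sup>2)"
        unfolding A_def by (rule norm_L2_pairing_le[OF QL Sigma_space_L2[OF that]])
      also have "\<dots> \<le> A * Sigma_norm v" using A0 by (intro mult_left_mono L2_norm_le_Sigma_norm) auto
      finally show ?thesis .
    qed
    have "has_dual_time_derivative (\<lambda>t x. (e t * of_real \<kappa>) * ansatz a b r x) (\<lambda>v. (- \<i> * of_real \<mu> * e t) * L2_pairing Q v) t"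
      unfolding has_dual_time_derivative_def
    proof (intro allI impI)
      fix d :: real assume d: "0 < d"
      have lim: "((\<lambda>h. (e (t + h) - e t) / of_real h - (- \<i> * of_real \<mu> * e t)) \<longlongrightarrow> 0) (at 0)"
        using exp_quotient_tendsto[of "- \<i> * of_real \<mu>" t] unfolding e_def by (rule LIM_zero)
      have "\<forall>\<^sub>F h in at 0. norm ((e (t + h) - e t) / of_real h - (- \<i> * of_real \<mu> * e t)) < d / A"
        using tendstoD[OF lim divide_pos_pos[OF d A0]] by (simp only: dist_norm diff_0_right)
      then show "\<forall>\<^sub>F h in at 0. \<forall>v\<in>Sigma_space. norm ((L2_pairing (\<lambda>x. (e (t + h) * of_real \<kappa>) * ansatz a b r x) v - L2_pairing (\<lambda>x. (e t * of_real \<kappa>) * ansatz a b r x) v) / of_real h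
          - (- \<i> * of_real \<mu> * e t) * L2_pairing Q v) \<le> d * Sigma_norm v"
      proof eventually_elim
        case (elim h)
        show ?case
        proof
          fix v assume v: "v \<in> Sigma_space"
          have "(L2_pairing (\<lambda>x. (e (t + h) * of_real \<kappa>) * ansatz a b r x) v - L2_pairing (\<lambda>x. (e t * of_real \<kappa>) * ansatz a b r x) v) / of_real h
            - (- \<i> * of_real \<mu> * e t) * L2_pairing Q v = ((e (t + h) - e t) / of_real h - (- \<i> * of_real \<mu> * e t)) * L2_pairing Q v"
            unfolding lp by (simp add: diff_divide_distrib algebra_simps)
          also have "norm \<dots> \<le> d / A * (A * Sigma_norm v)"
            unfolding norm_mult using elim A[OF v] d A0 by (intro mult_mono) auto
          also have "\<dots> = d * Sigma_norm v" using A0 by simp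
          finally show "norm ((L2_pairing (\<lambda>x. (e (t + h) * of_real \<kappa>) * ansatz a b r x) v - L2_pairing (\<lambda>x. (e t * of_real \<kappa>) * ansatz a b r x) v) / of_real h
          - (- \<i> * of_real \<mu> * e t) * L2_pairing Q v) \<le> d * Sigma_norm v" .
        qed
      qed
    qed
    then show "has_dual_time_derivative (\<lambda>t x. (e t * of_real \<kappa>) * ansatz a b r x) (\<lambda>v. (- \<i> * of_real \<mu> * e t) * L2_pairing (\<lambda>x. of_real \<kappa> * ansatz a b r x) v) t"
      unfolding Q_def[abs_def] .
  qed
  show ?thesis unfolding solves_evolution_def e
    using ansatz_scale_Sigma(1)[OF b] 1 2 by blast
qed

lemma sq_wt_L2:
  assumes "U \<in> borel_measurable borel" "\<And>x. norm (U x) \<le> C * wt x"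
  shows "(\<lambda>x. of_real ((norm x)\<^sup>2) * U x) \<in> L2"
proof (rule exp_gauss_poly_L2[of _ C])
  fix x
  have C: "0 \<le> C * wt x" using order_trans[OF norm_ge_zero assms(2)] .
  have "(norm x)\<^sup>2 * norm (U x) \<le> (1 + norm x)\<^sup>2 * (C * wt x)"
    using assms(2) C by (intro mult_mono power_mono) auto
  then show "norm (of_real ((norm x)\<^sup>2) * U x) \<le> C * (1 + norm x)\<^sup>2 * exp (- (norm x)\<^sup>2 / 4)"
    unfolding norm_mult norm_of_real wt_def by (simp add: mult_ac)
qed (use assms(1) in measurable)

text \<open>The function \<open>wt * r\<close> is the right-hand side of the equation for U, and
  \<open>ground_coeff r = 0\<close> is its solvability condition, which removes the projection.
  Scaling by z turns \<open>\<delta> \<beta> |U|^2\<close> into the square of the solution, and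
  \<open>\<alpha> * \<delta> = 1\<close> then turns \<beta> |U|^2 into \<alpha> times it.\<close>

lemma stationary_of_profile:
  fixes r :: "real^2 \<Rightarrow> complex"
  assumes bd: "bdd_by r M" and rc: "continuous_on UNIV r"
    and \<sigma>: "\<sigma> \<in> borel_measurable borel" "\<And>x. \<bar>\<sigma> x\<bar> \<le> Sg"
    and U: "\<And>x. norm (ansatz a (1 / of_real gauss1) r x) \<le> C * wt x"
    and Gr: "ground_coeff r = 0"
    and r: "\<And>x. of_real (wt x) * r x = of_real m * ansatz a (1 / of_real gauss1) r x - of_real (\<delta> * \<beta> * (norm (ansatz a (1 / of_real gauss1) r x))\<^sup>2) * ansatz a (1 / of_real gauss1) r x
        - \<i> * of_real \<epsilon> * (of_real (\<sigma> x - \<beta> * (norm (ansatz a (1 / of_real gauss1) r x))\<^sup>2) * ansatz a (1 / of_real gauss1) r x)"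
    and \<kappa>: "\<kappa>\<^sup>2 = \<delta> * \<beta>" "\<alpha> * \<delta> = 1" and z: "norm z = \<kappa>" and v: "v \<in> Sigma_space"
  shows "GP_functional \<sigma> \<epsilon> \<alpha> (\<lambda>x. z * ansatz a (1 / of_real gauss1) r x) v = of_real (2 + m) * L2_pairing (\<lambda>x. z * ansatz a (1 / of_real gauss1) r x) v"
proof -
  define b where "b = 1 / complex_of_real gauss1"
  define U where "U = ansatz a b r"
  note [measurable] = \<sigma>(1)
  have UL: "U \<in> L2" unfolding U_def by (rule ansatz_L2[OF bd])
  have [measurable]: "U \<in> borel_measurable borel" using UL by (rule L2_measurable)
  have vL: "v \<in> L2" using v by (rule Sigma_space_L2)
  note [measurable] = L2_measurable[OF vL]
  have Ub: "norm (U x) \<le> C * wt x" for x using assms(5) by (simp add: U_def b_def)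
  have C0: "0 \<le> C" using order_trans[OF norm_ge_zero Ub[of 0]] by (simp add: wt_def)
  have UC: "(norm (U x))\<^sup>2 \<le> C\<^sup>2" for x
    using order_trans[OF Ub[of x] mult_left_le[OF wt_le_1 C0]] by (intro power_mono) auto
  have i1: "integrable lborel (\<lambda>x. U x * cnj (v x))" by (intro L2_pairing_integrable UL vL)
  have i2: "integrable lborel (\<lambda>x. of_real ((norm (U x))\<^sup>2) * U x * cnj (v x))"
    by (intro L2_pairing_integrable L2_bounded_mult[OF UL, of _ "C\<^sup>2"] vL) (use UC in \<open>auto simp: norm_power\<close>)
  have i3: "integrable lborel (\<lambda>x. of_real (\<sigma> x) * U x * cnj (v x))"
    by (intro L2_pairing_integrable L2_bounded_mult[OF UL, of _ Sg] vL) (use \<sigma>(2) in auto)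
  have i4: "integrable lborel (\<lambda>x. of_real ((norm x)\<^sup>2) * U x * cnj (v x))"
    by (intro L2_pairing_integrable sq_wt_L2[OF _ Ub] vL) measurable
  define I1 I2 I3 I4 where "I1 = (LINT x|lborel. U x * cnj (v x))" and "I2 = (LINT x|lborel. of_real ((norm (U x))\<^sup>2) * U x * cnj (v x))"
    and "I3 = (LINT x|lborel. of_real (\<sigma> x) * U x * cnj (v x))" and "I4 = (LINT x|lborel. of_real ((norm x)\<^sup>2) * U x * cnj (v x))"
  define J where "J = (\<Sum>j\<in>UNIV. LINT x|lborel. ansatz_partial a b r j x * cnj (weak_partial j v x))"
  note wv = Sigma_space_weak_partial[OF v]
  have J: "J + (I4 - 2 * I1) = of_real m * I1 - of_real (\<delta> * \<beta>) * I2 - \<i> * of_real \<epsilon> * (I3 - of_real \<beta> * I2)"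
  proof -
    have "J + (LINT x|lborel. of_real ((norm x)\<^sup>2 - 2) * U x * cnj (v x)) = b * (of_real gauss1 * (LINT x|lborel. of_real (exp (- (norm x)\<^sup>2 / 4)) * r x * cnj (v x))
       - (LINT y|lborel. of_real (exp (- 3 * (norm y)\<^sup>2 / 4)) * r y) * (LINT x|lborel. of_real (exp (- (norm x)\<^sup>2 / 2)) * cnj (v x)))"
      unfolding J_def U_def by (rule ansatz_weak_equation[OF bd rc L2_cnj[OF vL] L2_cnj[OF wv(2)] has_weak_partial_cnj[OF wv(1)]])
    also have "\<dots> = (LINT x|lborel. of_real (wt x) * r x * cnj (v x))"
      using gauss1_pos unfolding Gr[unfolded ground_coeff_def wt_3] wt_def by (simp add: b_def)
    also have "\<dots> = (LINT x|lborel. of_real m * (U x * cnj (v x)) - of_real (\<delta> * \<beta>) * (of_real ((norm (U x))\<^sup>2) * U x * cnj (v x))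
        - \<i> * of_real \<epsilon> * (of_real (\<sigma> x) * U x * cnj (v x) - of_real \<beta> * (of_real ((norm (U x))\<^sup>2) * U x * cnj (v x))))"
      unfolding r U_def[symmetric] b_def[symmetric] by (intro Bochner_Integration.integral_cong) (simp_all add: algebra_simps)
    also have "\<dots> = of_real m * I1 - of_real (\<delta> * \<beta>) * I2 - \<i> * of_real \<epsilon> * (I3 - of_real \<beta> * I2)"
      by (simp only: I1_def I2_def I3_def Bochner_Integration.integral_diff Bochner_Integration.integrable_diff integrable_mult_right integral_mult_right_zero i1 i2 i3)
    also have "(LINT x|lborel. of_real ((norm x)\<^sup>2 - 2) * U x * cnj (v x)) = (LINT x|lborel. of_real ((norm x)\<^sup>2) * U x * cnj (v x) - 2 * (U x * cnj (v x)))"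
      by (intro Bochner_Integration.integral_cong) (simp_all add: algebra_simps)
    also have "\<dots> = I4 - 2 * I1"
      by (simp only: I1_def I4_def Bochner_Integration.integral_diff integrable_mult_right integral_mult_right_zero i1 i4)
    finally show ?thesis .
  qed
  have G1: "L2_pairing (weak_partial j (\<lambda>x. z * U x)) (weak_partial j v) = z * (LINT x|lborel. ansatz_partial a b r j x * cnj (weak_partial j v x))" for j
  proof -
    note [measurable] = L2_measurable[OF wv(2)] L2_measurable[OF ansatz_L2(2)[OF bd]]
      L2_measurable[OF Sigma_space_weak_partial(2)[OF ansatz_scale_Sigma(1)[OF bd]]]
    have "(LINT x|lborel. weak_partial j (\<lambda>x. z * U x) x * cnj (weak_partial j v x)) = (LINT x|lborel. z * (ansatz_partial a b r j x * cnj (weak_partial j v x)))"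
    proof (rule integral_cong_AE)
      show "AE x in lborel. weak_partial j (\<lambda>x. z * U x) x * cnj (weak_partial j v x) = z * (ansatz_partial a b r j x * cnj (weak_partial j v x))"
        using ansatz_scale_AE[OF bd, of j z a b] unfolding U_def by eventually_elim simp
      have [measurable]: "(\<lambda>x. cnj (weak_partial j v x)) \<in> borel_measurable borel" using L2_cnj[OF wv(2)] by (rule L2_measurable)
      show "(\<lambda>x. weak_partial j (\<lambda>x. z * U x) x * cnj (weak_partial j v x)) \<in> borel_measurable lborel" unfolding U_def by measurable
      show "(\<lambda>x. z * (ansatz_partial a b r j x * cnj (weak_partial j v x))) \<in> borel_measurable lborel" by measurable
    qed
    then show ?thesis by (simp add: L2_pairing_def)
  qed
  have nz: "(norm (z * U x))\<^sup>2 = \<delta> * \<beta> * (norm (U x))\<^sup>2" for x using z \<kappa> by (simp add: norm_mult power_mult_distrib)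
  have G2: "L2_pairing (\<lambda>x. of_real ((norm x)\<^sup>2 + (norm (z * U x))\<^sup>2) * (z * U x)) v = z * (I4 + of_real (\<delta> * \<beta>) * I2)"
  proof -
    have "L2_pairing (\<lambda>x. of_real ((norm x)\<^sup>2 + (norm (z * U x))\<^sup>2) * (z * U x)) v
      = (LINT x|lborel. z * (of_real ((norm x)\<^sup>2) * U x * cnj (v x) + of_real (\<delta> * \<beta>) * (of_real ((norm (U x))\<^sup>2) * U x * cnj (v x))))"
      unfolding L2_pairing_def nz by (intro Bochner_Integration.integral_cong) (simp_all add: algebra_simps)
    then show ?thesis
      by (simp only: I2_def I4_def Bochner_Integration.integral_add integrable_mult_right integral_mult_right_zero i2 i4)
  qed
  have ab: "\<alpha> * (\<delta> * \<beta> * t) = \<beta> * t" for t using \<kappa>(2) by (simp add: mult.assoc[symmetric])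
  have G3: "L2_pairing (\<lambda>x. of_real (\<sigma> x - \<alpha> * (norm (z * U x))\<^sup>2) * (z * U x)) v = z * (I3 - of_real \<beta> * I2)"
  proof -
    have "L2_pairing (\<lambda>x. of_real (\<sigma> x - \<alpha> * (norm (z * U x))\<^sup>2) * (z * U x)) v
      = (LINT x|lborel. z * (of_real (\<sigma> x) * U x * cnj (v x) - of_real \<beta> * (of_real ((norm (U x))\<^sup>2) * U x * cnj (v x))))"
      unfolding L2_pairing_def nz ab by (intro Bochner_Integration.integral_cong) (simp_all add: algebra_simps)
    then show ?thesis
      by (simp only: I2_def I3_def Bochner_Integration.integral_diff integrable_mult_right integral_mult_right_zero i2 i3)
  qed
  have G4: "L2_pairing (\<lambda>x. z * U x) v = z * I1"
    unfolding L2_pairing_def I1_def by (simp only: mult.assoc integral_mult_right_zero)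
  have J': "J = of_real m * I1 - of_real (\<delta> * \<beta>) * I2 - \<i> * of_real \<epsilon> * (I3 - of_real \<beta> * I2) - (I4 - 2 * I1)"
    using J by (simp only: eq_diff_eq)
  have "GP_functional \<sigma> \<epsilon> \<alpha> (\<lambda>x. z * U x) v = z * J + z * (I4 + of_real (\<delta> * \<beta>) * I2) + \<i> * of_real \<epsilon> * (z * (I3 - of_real \<beta> * I2))"
    unfolding GP_functional_def G1 G2 G3 J_def sum_distrib_left ..
  also have "\<dots> = of_real (2 + m) * (z * I1)" unfolding J' by (simp add: algebra_simps)
  finally show ?thesis unfolding G4[symmetric] U_def b_def .
qed

section \<open>Bifurcation from the ground state\<close>

definition wt_bcf :: bcf where "wt_bcf = Bcontfun (\<lambda>x. of_real (wt x))"

lemma wt_bcf_apply: "apply_bcontfun wt_bcf = (\<lambda>x. of_real (wt x))"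
  unfolding wt_bcf_def
  by (rule Bcontfun_inverse, rule bcontfun_normI[of _ 1])
    (auto intro!: continuous_intros wt_continuous simp: wt_nonneg wt_le_1)

text \<open>For U = wt h this and \<open>loss\<close> are the integrals of \<sigma> |U|^2 and |U|^4,
  the linear gain and cubic loss of mass.\<close>

definition gain :: "(real^2 \<Rightarrow> real) \<Rightarrow> bcf \<Rightarrow> real" where
  "gain \<sigma> h = (LINT x|lborel. wt x ^ 2 * (\<sigma> x * (norm (h x))\<^sup>2))"

definition loss :: "bcf \<Rightarrow> real" where
  "loss h = (LINT x|lborel. wt x ^ 4 * (norm (h x)) ^ 4)"

definition beta :: "(real^2 \<Rightarrow> real) \<Rightarrow> bcf \<Rightarrow> real" where
  "beta \<sigma> h = gain \<sigma> h / loss h"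

text \<open>This and \<open>gain_term\<close> are \<beta> |U|^2 U and
  \<open>\<i> (\<sigma> - \<beta> |U|^2) U\<close> divided by \<open>wt\<close>, for U = wt h.
  Writing |h|^2 as \<open>h x * cnj (h x)\<close> makes the product rules for \<open>bdd_lip\<close>
  applicable.\<close>

definition cubic_term :: "(real^2 \<Rightarrow> real) \<Rightarrow> bcf \<Rightarrow> real^2 \<Rightarrow> complex" where
  "cubic_term \<sigma> h x = of_real (beta \<sigma> h) * (of_real (wt x ^ 2) * (h x * cnj (h x))) * h x"

definition gain_term :: "(real^2 \<Rightarrow> real) \<Rightarrow> bcf \<Rightarrow> real^2 \<Rightarrow> complex" where
  "gain_term \<sigma> h x = \<i> * ((of_real (\<sigma> x) - of_real (beta \<sigma> h) * (of_real (wt x ^ 2) * (h x * cnj (h x)))) * h x)"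

text \<open>The multiple of \<open>h\<close> is chosen such that the coefficient of \<open>balance F h\<close> along the ground state
  is purely imaginary when \<open>ground_coeff h = gauss1\<close>.\<close>

definition balance :: "(bcf \<Rightarrow> real^2 \<Rightarrow> complex) \<Rightarrow> bcf \<Rightarrow> real^2 \<Rightarrow> complex" where
  "balance F h x = of_real (1 / gauss1) * of_real (Re (ground_coeff (F h))) * h x - F h x"

lemma bcf_measurable [measurable]: "apply_bcontfun (h::bcf) \<in> borel_measurable borel"
  by (intro borel_measurable_continuous_onI continuous_on_apply_bcontfun)

lemma bdd_lip_wt: "bdd_lip S (\<lambda>h x. of_real (wt x ^ n))"
  by (rule bdd_lip_const[of _ 1]) (simp add: norm_power wt_nonneg wt_le_1 power_le_one)

lemma bdd_lip_gain:
  assumes \<sigma>: "continuous_on UNIV \<sigma>" "\<And>x. \<bar>\<sigma> x\<bar> \<le> Sg"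
  shows "bdd_lip (cball h0 R) (\<lambda>h x. of_real (gain \<sigma> h))"
proof -
  have [measurable]: "\<sigma> \<in> borel_measurable borel" using \<sigma>(1) by (rule borel_measurable_continuous_onI)
  have "of_real (gain \<sigma> h) = (LINT x|lborel. of_real (wt x ^ 2) * (of_real (\<sigma> x) * (h x * cnj (h x))))" for h
    unfolding gain_def integral_complex_of_real[symmetric] complex_norm_square[symmetric] by simp
  moreover have "bdd_lip (cball h0 R) (\<lambda>h x. LINT x|lborel. of_real (wt x ^ 2) * (of_real (\<sigma> x) * (apply_bcontfun h x * cnj (apply_bcontfun h x))))"
  proof (rule bdd_lip_integral)
    show "(\<lambda>x. of_real (\<sigma> x) * (apply_bcontfun h x * cnj (apply_bcontfun h x))) \<in> borel_measurable borel" for h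
      using \<sigma>(1) by (intro borel_measurable_continuous_onI continuous_intros) auto
  qed (use \<sigma> in \<open>auto intro!: bdd_lip_mult bdd_lip_cnj bdd_lip_id bdd_lip_const[of _ Sg] wt_power_integrable\<close>)
  ultimately show ?thesis by simp
qed

lemma bdd_lip_loss: "bdd_lip (cball h0 R) (\<lambda>h x. of_real (loss h))"
proof -
  have "of_real (loss h) = (LINT x|lborel. of_real (wt x ^ 4) * ((h x * cnj (h x)) * (h x * cnj (h x))))" for h
    unfolding loss_def integral_complex_of_real[symmetric] complex_norm_square[symmetric]
    by (simp add: power_mult_distrib flip: power_mult power_add)
  moreover have "bdd_lip (cball h0 R) (\<lambda>h x. LINT x|lborel. of_real (wt x ^ 4) * ((apply_bcontfun h x * cnj (apply_bcontfun h x)) * (apply_bcontfun h x * cnj (apply_bcontfun h x))))"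
  proof (rule bdd_lip_integral)
    show "(\<lambda>x. (apply_bcontfun h x * cnj (apply_bcontfun h x)) * (apply_bcontfun h x * cnj (apply_bcontfun h x))) \<in> borel_measurable borel" for h
      by (intro borel_measurable_continuous_onI continuous_intros) auto
  qed (auto intro!: bdd_lip_mult bdd_lip_cnj bdd_lip_id wt_power_integrable simp: wt_nonneg)
  ultimately show ?thesis by simp
qed

text \<open>Applied to \<open>gain\<close> and \<open>loss\<close>: close to the ground state both
  stay away from 0, so their quotient \<open>beta\<close> is positive and Lipschitz.\<close>

lemma bdd_lip_lower_bound:
  assumes "bdd_lip (cball h0 1) (\<lambda>h x. of_real (F h))" "F h0 > 0"
  shows "\<exists>\<rho>>0. \<rho> \<le> 1 \<and> (\<forall>h\<in>cball h0 \<rho>. F h \<ge> F h0 / 2)"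
proof -
  obtain C where C: "C \<ge> 0" "\<And>h h'. h \<in> cball h0 1 \<Longrightarrow> h' \<in> cball h0 1 \<Longrightarrow> norm (complex_of_real (F h) - of_real (F h')) \<le> C * dist h h'"
    using assms(1) by (elim blipE) blast
  define \<rho> where "\<rho> = min 1 (F h0 / (2 * (C + 1)))"
  have \<rho>: "0 < \<rho>" "\<rho> \<le> 1" using assms(2) C(1) by (auto simp: \<rho>_def)
  have "F h \<ge> F h0 / 2" if h: "h \<in> cball h0 \<rho>" for h
  proof -
    have "\<bar>F h0 - F h\<bar> \<le> C * dist h0 h" using C(2)[of h0 h] h \<rho> by (simp flip: of_real_diff)
    also have "\<dots> \<le> (C + 1) * (F h0 / (2 * (C + 1)))" using h C(1) by (intro mult_mono) (auto simp: \<rho>_def)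
    also have "\<dots> = F h0 / 2" using C(1) by (simp add: divide_simps)
    finally show ?thesis by linarith
  qed
  then show ?thesis using \<rho> by blast
qed

lemma bdd_by_bdd_lip:
  assumes "bdd_lip S F" "h \<in> S" "continuous_on UNIV (F h)"
  shows "\<exists>M. bdd_by (F h) M"
  using assms by (elim blipE) (blast intro: bdd_funI)

lemma bdd_lip_balance:
  assumes F: "bdd_lip (cball h0 R) F" and c: "\<And>h. h \<in> cball h0 R \<Longrightarrow> continuous_on UNIV (F h)"
  shows "bdd_lip (cball h0 R) (balance F)"
  unfolding balance_def[abs_def] ground_coeff_def
  by (intro bdd_lip_diff bdd_lip_mult bdd_lip_Re bdd_lip_id F bdd_lip_integral bdd_lip_const[of _ "norm (complex_of_real (1 / gauss1))"])
    (auto intro!: wt_power_integrable borel_measurable_continuous_onI c simp: wt_nonneg)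

lemma balance_continuous: "continuous_on UNIV (F h) \<Longrightarrow> continuous_on UNIV (balance F h)"
  unfolding balance_def[abs_def] by (intro continuous_intros) auto

lemma term_continuous:
  assumes "continuous_on UNIV \<sigma>"
  shows "continuous_on UNIV (cubic_term \<sigma> h)" "continuous_on UNIV (gain_term \<sigma> h)"
  unfolding cubic_term_def[abs_def] gain_term_def[abs_def] using assms by (auto intro!: continuous_intros wt_continuous)

lemma term_bdd_lip:
  assumes \<sigma>: "continuous_on UNIV \<sigma>" "\<And>x. \<bar>\<sigma> x\<bar> \<le> Sg" and D: "0 < d" "\<And>h. h \<in> cball h0 R \<Longrightarrow> d \<le> loss h"
  shows "bdd_lip (cball h0 R) (cubic_term \<sigma>)" "bdd_lip (cball h0 R) (gain_term \<sigma>)"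
proof -
  have "bdd_lip (cball h0 R) (\<lambda>h x. of_real (gain \<sigma> h) * inverse (of_real (loss h)))"
    by (intro bdd_lip_mult bdd_lip_gain[OF \<sigma>] bdd_lip_inverse[OF bdd_lip_loss D(1)]) (use D in force)
  then have b: "bdd_lip (cball h0 R) (\<lambda>h x. of_real (beta \<sigma> h))" by (simp add: beta_def divide_inverse)
  show "bdd_lip (cball h0 R) (cubic_term \<sigma>)" "bdd_lip (cball h0 R) (gain_term \<sigma>)"
    unfolding cubic_term_def[abs_def] gain_term_def[abs_def]
    by (intro bdd_lip_diff bdd_lip_mult bdd_lip_cmult bdd_lip_cnj bdd_lip_id b bdd_lip_wt bdd_lip_const[of _ Sg]; simp add: \<sigma>)+
qed

text \<open>The fixed point h solves the equation only modulo the ground state. What remains is to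
  show that the leftover coefficient \<open>ground_coeff r\<close> vanishes and that m, which
  becomes \<mu> - 2, is positive.\<close>

lemma profile_exists:
  assumes \<sigma>: "continuous_on UNIV \<sigma>" "\<And>x. \<bar>\<sigma> x\<bar> \<le> Sg" "\<And>x. 0 \<le> \<sigma> x" "\<sigma> x0 \<noteq> 0"
  shows "\<exists>\<eta>>0. \<forall>\<delta> \<epsilon>. 0 < \<delta> \<longrightarrow> 0 < \<epsilon> \<longrightarrow> \<delta> + \<epsilon> < \<eta> \<longrightarrow>
     (\<exists>h a r M m. bdd_by r M \<and> continuous_on UNIV r \<and> (\<forall>x. ansatz a (1 / of_real gauss1) r x = of_real (wt x) * apply_bcontfun h x) \<and>
       0 < loss h \<and> 0 < gain \<sigma> h \<and> 0 < m \<and> ground_coeff r = 0 \<and>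
       (\<forall>x. r x = of_real m * h x - of_real \<delta> * cubic_term \<sigma> h x - of_real \<epsilon> * gain_term \<sigma> h x))"
proof -
  have [measurable]: "\<sigma> \<in> borel_measurable borel" using \<sigma>(1) by (rule borel_measurable_continuous_onI)
  have N0: "0 < gain \<sigma> wt_bcf"
  proof -
    have eq: "gain \<sigma> wt_bcf = (LINT x|lborel. \<sigma> x * wt x ^ 4)"
      unfolding gain_def wt_bcf_apply by (intro Bochner_Integration.integral_cong) (simp_all add: wt_nonneg mult_ac flip: power_add)
    have i: "integrable lborel (\<lambda>x. \<sigma> x * wt x ^ 4)"
    proof (rule Bochner_Integration.integrable_bound)
      show "integrable lborel (\<lambda>x. Sg * wt x ^ 4)" by (intro integrable_mult_right wt_power_integrable) simp
      show "AE x in lborel. norm (\<sigma> x * wt x ^ 4) \<le> norm (Sg * wt x ^ 4)"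
        using \<sigma>(2) by (intro AE_I2) (auto simp: abs_mult wt_nonneg intro!: mult_right_mono order_trans[OF \<sigma>(2) abs_ge_self])
    qed measurable
    have "0 < \<sigma> x0" using \<sigma>(3)[of x0] \<sigma>(4) by simp
    then show ?thesis unfolding eq using wt_pos
      by (intro integral_continuous_pos[OF _ _ _ i, of x0] continuous_intros \<sigma>(1) wt_continuous) (auto simp: \<sigma>(3) wt_nonneg intro!: mult_pos_pos zero_less_power)
  qed
  have D0: "0 < loss wt_bcf"
  proof -
    have eq: "loss wt_bcf = (LINT x|lborel. wt x ^ 8)"
      unfolding loss_def wt_bcf_apply by (intro Bochner_Integration.integral_cong) (simp_all add: wt_nonneg flip: power_add)
    show ?thesis unfolding eq using wt_pos
      by (intro integral_continuous_pos[of _ 0] continuous_intros wt_continuous wt_power_integrable) (auto simp: wt_nonneg wt_nz)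
  qed
  obtain \<rho>1 where \<rho>1: "0 < \<rho>1" "\<rho>1 \<le> 1" "\<And>h. h \<in> cball wt_bcf \<rho>1 \<Longrightarrow> gain \<sigma> wt_bcf / 2 \<le> gain \<sigma> h"
    using bdd_lip_lower_bound[OF bdd_lip_gain[OF \<sigma>(1,2)] N0] by blast
  obtain \<rho>2 where \<rho>2: "0 < \<rho>2" "\<rho>2 \<le> 1" "\<And>h. h \<in> cball wt_bcf \<rho>2 \<Longrightarrow> loss wt_bcf / 2 \<le> loss h"
    using bdd_lip_lower_bound[OF bdd_lip_loss D0] by blast
  define \<rho> where "\<rho> = min \<rho>1 \<rho>2"
  let ?S = "cball wt_bcf \<rho>"
  have \<rho>: "0 < \<rho>" using \<rho>1 \<rho>2 by (simp add: \<rho>_def)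
  have N: "gain \<sigma> wt_bcf / 2 \<le> gain \<sigma> h" and D: "loss wt_bcf / 2 \<le> loss h" if "h \<in> ?S" for h
    using \<rho>1(3) \<rho>2(3) that by (auto simp: \<rho>_def)
  note bl = term_bdd_lip[OF \<sigma>(1,2) half_gt_zero[OF D0] D]
  note ct = term_continuous[OF \<sigma>(1)]
  obtain \<eta> where \<eta>: "\<eta> > 0" "\<And>\<delta> \<epsilon>. 0 \<le> \<delta> \<Longrightarrow> 0 \<le> \<epsilon> \<Longrightarrow> \<delta> + \<epsilon> < \<eta> \<Longrightarrow>
     (\<exists>h\<in>?S. \<forall>x. apply_bcontfun h x = apply_bcontfun wt_bcf x + res_perp (\<lambda>x. of_real \<delta> * balance (cubic_term \<sigma>) h x + of_real \<epsilon> * balance (gain_term \<sigma>) h x) x)"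
    using fixed_point_exists[OF bdd_lip_balance[OF bl(1) ct(1)] bdd_lip_balance[OF bl(2) ct(2)] \<rho> balance_continuous[of "cubic_term \<sigma>", OF ct(1)] balance_continuous[of "gain_term \<sigma>", OF ct(2)]] by blast
  show ?thesis
  proof (intro exI[of _ \<eta>] conjI allI impI \<eta>(1))
    fix \<delta> \<epsilon> :: real assume \<delta>: "0 < \<delta>" and \<epsilon>: "0 < \<epsilon>" and "\<delta> + \<epsilon> < \<eta>"
    then obtain h where h: "h \<in> ?S" "\<And>x. apply_bcontfun h x = of_real (wt x) + res_perp (\<lambda>x. of_real \<delta> * balance (cubic_term \<sigma>) h x + of_real \<epsilon> * balance (gain_term \<sigma>) h x) x"
      using \<eta>(2)[of \<delta> \<epsilon>] unfolding wt_bcf_apply by auto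
    define r where "r x = of_real \<delta> * balance (cubic_term \<sigma>) h x + of_real \<epsilon> * balance (gain_term \<sigma>) h x" for x
    \<comment> \<open>Written as a difference so that \<open>bdd_by_diff\<close> and
      \<open>ground_coeff_diff\<close> apply.\<close>
    define s where "s x = of_real \<delta> * cubic_term \<sigma> h x - (- of_real \<epsilon>) * gain_term \<sigma> h x" for x
    \<comment> \<open>Collects the multiples of h that the two \<open>balance\<close> terms
      contribute.\<close>
    define m where "m = (\<delta> * Re (ground_coeff (cubic_term \<sigma> h)) + \<epsilon> * Re (ground_coeff (gain_term \<sigma> h))) / gauss1"
    have r_eq: "r x = of_real m * h x - s x" for x
      by (simp add: r_def s_def m_def balance_def algebra_simps add_divide_distrib)
    have rc: "continuous_on UNIV r" unfolding r_def[abs_def] by (intro continuous_intros balance_continuous ct)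
    obtain MA MB where MA: "bdd_by (cubic_term \<sigma> h) MA" and MB: "bdd_by (gain_term \<sigma> h) MB"
      using bdd_by_bdd_lip[OF bl(1) h(1) ct(1)] bdd_by_bdd_lip[OF bl(2) h(1) ct(2)] by blast
    have cm: "bdd_by (\<lambda>x. c * f x) (norm c * M)" if "bdd_by f M" for c :: complex and f M
      using that by (auto simp: bdd_by_def norm_mult intro!: mult_left_mono)
    have hb: "bdd_by (apply_bcontfun h) (norm h)" by (rule bdd_funI) (auto intro: norm_bounded)
    obtain MS where sb: "bdd_by s MS" unfolding s_def[abs_def] using bdd_by_diff[OF cm[OF MA] cm[OF MB]] by blast
    have "r = (\<lambda>x. of_real m * h x - s x)" by (rule ext) (rule r_eq)
    then obtain M where rb: "bdd_by r M" using bdd_by_diff[OF cm[OF hb] sb] by metis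
    have hr: "apply_bcontfun h x = of_real (wt x) + res_perp r x" for x using h(2)[of x] by (simp add: r_def[abs_def])
    \<comment> \<open>The correction \<open>res_perp r\<close> has no component along the ground
      state, so h keeps the component of \<open>wt\<close>. This is the normalization under which
      \<open>balance\<close> cancels the real part.\<close>
    have Gh: "ground_coeff (apply_bcontfun h) = of_real gauss1"
    proof -
      have "ground_coeff (\<lambda>x. h x - of_real (wt x)) = ground_coeff (apply_bcontfun h) - of_real gauss1"
        using ground_coeff_diff[OF hb bdd_by_wt] by (simp add: ground_coeff_wt)
      moreover have "(\<lambda>x. h x - of_real (wt x)) = res_perp r" by (simp add: hr fun_eq_iff)
      ultimately show ?thesis using ground_coeff_res_perp[OF rb rc] by simp
    qed
    have Gs: "ground_coeff s = of_real \<delta> * ground_coeff (cubic_term \<sigma> h) + of_real \<epsilon> * ground_coeff (gain_term \<sigma> h)"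
      unfolding s_def[abs_def] ground_coeff_diff[OF cm[OF MA] cm[OF MB]] ground_coeff_cmult by simp
    have Gr: "ground_coeff r = of_real m * of_real gauss1 - ground_coeff s"
    proof -
      have "ground_coeff r = ground_coeff (\<lambda>x. of_real m * h x - s x)" by (simp add: r_eq[abs_def])
      also have "\<dots> = of_real m * ground_coeff (apply_bcontfun h) - ground_coeff s" unfolding ground_coeff_diff[OF cm[OF hb] sb] ground_coeff_cmult ..
      finally show ?thesis unfolding Gh .
    qed
    have ReG: "Re (ground_coeff r) = 0" unfolding Gr Gs m_def using gauss1_pos by simp
    \<comment> \<open>The amplitude 1 of \<open>wt_bcf\<close>, corrected by the ground state
      component that \<open>res_perp\<close> subtracts.\<close>
    define a where "a = 1 - ground_coeff (res_wt r) / (of_real gauss1 * of_real gauss1)"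
    have GZc: "complex_of_real gauss1 \<noteq> 0" using gauss1_pos by simp
    have ansatz: "ansatz a (1 / of_real gauss1) r x = of_real (wt x) * h x" for x
    proof -
      have K: "ker_int res_ker r x = of_real (wt x) * res_wt r x" using wt_nz[of x] by (simp add: res_wt_def)
      show ?thesis unfolding ansatz_def hr res_perp_def K a_def wt_2[symmetric] using GZc
        by (simp add: field_simps power2_eq_square)
    qed
    define U where "U = ansatz a (1 / of_real gauss1) r"
    have Uw: "U x = of_real (wt x) * h x" for x unfolding U_def by (rule ansatz)
      define P where "P = (LINT x|lborel. wt x ^ 2 * (norm (h x))\<^sup>2)"
    \<comment> \<open>The energy is real, and so is the pairing of the right-hand side with \<open>U\<close>, by the choice of
      \<open>beta\<close>. Hence the purely imaginary \<open>ground_coeff r\<close> vanishes.\<close>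
    define E where "E = (\<Sum>j\<in>UNIV. LINT x|lborel. ansatz_partial a (1 / of_real gauss1) r j x * cnj (ansatz_partial a (1 / of_real gauss1) r j x)) + (LINT x|lborel. of_real ((norm x)\<^sup>2 - 2) * U x * cnj (U x))"
    have E0: "Im E = 0" "0 \<le> Re E" using ansatz_energy_nonneg[OF rb, of a "1 / of_real gauss1"] unfolding E_def U_def by auto
    \<comment> \<open>In the weak equation the projection term is \<open>ground_coeff r\<close>
      times the conjugate of \<open>ground_coeff h\<close>, divided by \<open>gauss1\<close>; by
      \<open>Gh\<close> the last two factors cancel.\<close>
    have E1: "E = (LINT x|lborel. of_real (wt x) * r x * cnj (U x)) - ground_coeff r"
    proof -
      have "E = 1 / of_real gauss1 * (of_real gauss1 * (LINT x|lborel. of_real (exp (- (norm x)\<^sup>2 / 4)) * r x * cnj (U x))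
         - (LINT y|lborel. of_real (exp (- 3 * (norm y)\<^sup>2 / 4)) * r y) * (LINT x|lborel. of_real (exp (- (norm x)\<^sup>2 / 2)) * cnj (U x)))"
        unfolding E_def U_def
        by (rule ansatz_weak_equation[OF rb rc L2_cnj[OF ansatz_L2(1)[OF rb]] L2_cnj[OF ansatz_L2(2)[OF rb]] has_weak_partial_cnj[OF ansatz_has_weak_partial[OF rb]]])
      also have "(LINT x|lborel. of_real (exp (- (norm x)\<^sup>2 / 2)) * cnj (U x)) = cnj (ground_coeff (apply_bcontfun h))"
        unfolding ground_coeff_def Bochner_Integration.integral_cnj[symmetric] Uw wt_2[symmetric]
        by (intro Bochner_Integration.integral_cong) (simp_all add: power2_eq_square power3_eq_cube mult_ac)
      finally show ?thesis using GZc unfolding Gh unfolding ground_coeff_def wt_3[symmetric] wt_def[symmetric] by (simp add: right_diff_distrib)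
    qed
    have hB: "norm (h x) \<le> norm h" for x by (rule norm_bounded)
    have wi: "integrable lborel (\<lambda>x. wt x ^ k * f x)" if "k > 0" "f \<in> borel_measurable borel" "\<And>x. \<bar>f x\<bar> \<le> B" for f B k
    proof (rule Bochner_Integration.integrable_bound)
      show "integrable lborel (\<lambda>x. wt x ^ k * B)" using that(1) by (intro integrable_mult_left wt_power_integrable)
      show "(\<lambda>x. wt x ^ k * f x) \<in> borel_measurable lborel" using that(2) by measurable
      show "AE x in lborel. norm (wt x ^ k * f x) \<le> norm (wt x ^ k * B)"
        using that(3) by (intro AE_I2) (auto simp: abs_mult wt_nonneg intro!: mult_left_mono order_trans[OF that(3) abs_ge_self])
    qed
    have i1: "integrable lborel (\<lambda>x. wt x ^ 2 * (norm (h x))\<^sup>2)"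
      by (rule wi[of _ _ "(norm h)\<^sup>2"]) (auto intro!: power_mono hB)
    have i2: "integrable lborel (\<lambda>x. wt x ^ 2 * (\<sigma> x * (norm (h x))\<^sup>2))"
    proof (rule wi[of _ _ "Sg * (norm h)\<^sup>2"])
      show "\<bar>\<sigma> x * (norm (h x))\<^sup>2\<bar> \<le> Sg * (norm h)\<^sup>2" for x
        unfolding abs_mult using \<sigma>(2)[of x] hB[of x] by (intro mult_mono) (auto intro!: power_mono)
    qed auto
    have i3: "integrable lborel (\<lambda>x. wt x ^ 4 * (norm (h x)) ^ 4)"
      by (rule wi[of _ _ "(norm h) ^ 4"]) (auto intro!: power_mono hB)
    have Dp: "0 < loss h" and Np: "0 < gain \<sigma> h" using D[OF h(1)] N[OF h(1)] D0 N0 by auto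
    have bD: "beta \<sigma> h * loss h = gain \<sigma> h" using Dp by (simp add: beta_def)
    have bp: "0 < beta \<sigma> h" using Dp Np by (simp add: beta_def)
    have "(LINT x|lborel. of_real (wt x) * r x * cnj (U x)) = (LINT x|lborel. complex_of_real (m * (wt x ^ 2 * (norm (h x))\<^sup>2) - \<delta> * beta \<sigma> h * (wt x ^ 4 * (norm (h x)) ^ 4))
        - \<i> * of_real (\<epsilon> * (wt x ^ 2 * (\<sigma> x * (norm (h x))\<^sup>2) - beta \<sigma> h * (wt x ^ 4 * (norm (h x)) ^ 4))))"
    proof (intro Bochner_Integration.integral_cong refl)
      fix x
      have n2: "complex_of_real ((norm (h x))\<^sup>2) = h x * cnj (h x)" by (rule complex_norm_square)
      have n4: "complex_of_real ((norm (h x)) ^ 4) = (h x * cnj (h x)) * (h x * cnj (h x))"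
        unfolding n2[symmetric] by (simp flip: power_add)
      show "of_real (wt x) * r x * cnj (U x) = complex_of_real (m * (wt x ^ 2 * (norm (h x))\<^sup>2) - \<delta> * beta \<sigma> h * (wt x ^ 4 * (norm (h x)) ^ 4))
        - \<i> * of_real (\<epsilon> * (wt x ^ 2 * (\<sigma> x * (norm (h x))\<^sup>2) - beta \<sigma> h * (wt x ^ 4 * (norm (h x)) ^ 4)))"
        unfolding r_eq s_def cubic_term_def gain_term_def Uw of_real_diff of_real_mult n2 n4
        by (simp add: algebra_simps power2_eq_square power4_eq_xxxx)
    qed
    also have "\<dots> = complex_of_real (m * P - \<delta> * beta \<sigma> h * loss h) - \<i> * of_real (\<epsilon> * (gain \<sigma> h - beta \<sigma> h * loss h))"
      unfolding P_def gain_def loss_def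
      by (subst Bochner_Integration.integral_diff)
        (auto intro!: integrable_mult_right integrable_of_real Bochner_Integration.integrable_diff i1 i2 i3 simp only: integral_complex_of_real integral_mult_right_zero Bochner_Integration.integral_diff integrable_mult_right i1 i2 i3)
    also have "\<dots> = of_real (m * P - \<delta> * beta \<sigma> h * loss h)" unfolding bD by simp
    finally have E2: "E = of_real (m * P - \<delta> * beta \<sigma> h * loss h) - ground_coeff r" unfolding E1 by simp
    have ImG: "Im (ground_coeff r) = 0" using E0(1) unfolding E2 by simp
    have G0: "ground_coeff r = 0" using ReG ImG by (simp add: complex_eq_iff)
    \<comment> \<open>Nonnegativity of the energy forces m P to dominate the repulsive term, which
      is strictly positive.\<close>
    have "0 \<le> m * P - \<delta> * beta \<sigma> h * loss h" using E0(2) unfolding E2 G0 by simp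
    moreover have "0 < \<delta> * beta \<sigma> h * loss h" using \<delta> bp Dp by simp
    ultimately have "0 < m * P" by linarith
    moreover have "0 \<le> P" unfolding P_def by (rule Bochner_Integration.integral_nonneg) (simp add: wt_nonneg)
    ultimately have m: "0 < m" by (auto simp: zero_less_mult_iff)
    show "\<exists>h a r M m. bdd_by r M \<and> continuous_on UNIV r \<and> (\<forall>x. ansatz a (1 / of_real gauss1) r x = of_real (wt x) * apply_bcontfun h x) \<and>
       0 < loss h \<and> 0 < gain \<sigma> h \<and> 0 < m \<and> ground_coeff r = 0 \<and>
       (\<forall>x. r x = of_real m * h x - of_real \<delta> * cubic_term \<sigma> h x - of_real \<epsilon> * gain_term \<sigma> h x)"
      by (intro exI[of _ h] exI[of _ a] exI[of _ r] exI[of _ M] exI[of _ m] conjI allI rb rc ansatz Dp Np m G0) (simp add: r_eq s_def)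
  qed
qed

theorem theorem1p1:
  fixes \<sigma> :: "real ^ 2 \<Rightarrow> real"
  assumes "continuous_on UNIV \<sigma>"
    and "bounded (range \<sigma>)"
    and "\<And>x. 0 \<le> \<sigma> x"
    and "\<exists>x. \<sigma> x \<noteq> 0"
  shows "\<exists>\<alpha>\<^sub>0>0. \<exists>\<epsilon>\<^sub>0>0. \<forall>\<epsilon> \<alpha> :: real. 0 < \<epsilon> \<and> \<epsilon> < \<epsilon>\<^sub>0 \<and> \<alpha>\<^sub>0 < \<alpha> \<longrightarrow>
    (\<exists>(Q :: real ^ 2 \<Rightarrow> complex) (\<mu> :: real).
       Q \<in> Sigma_space \<and> \<not> (AE x in lborel. Q x = 0) \<and> 2 < \<mu> \<and>
       solves_stationary \<sigma> \<epsilon> \<alpha> \<mu> Q \<and>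
       solves_evolution \<sigma> \<epsilon> \<alpha> (\<lambda>t x. exp (- \<i> * of_real (t * \<mu>)) * Q x))"
proof -
  obtain Sg where Sg: "\<And>x. \<bar>\<sigma> x\<bar> \<le> Sg" using assms(2) by (auto simp: bounded_iff)
  obtain x0 where x0: "\<sigma> x0 \<noteq> 0" using assms(4) by blast
  obtain \<eta> where \<eta>: "\<eta> > 0" and sol: "\<And>\<delta> \<epsilon>. 0 < \<delta> \<Longrightarrow> 0 < \<epsilon> \<Longrightarrow> \<delta> + \<epsilon> < \<eta> \<Longrightarrow>
     (\<exists>h a r M m. bdd_by r M \<and> continuous_on UNIV r \<and> (\<forall>x. ansatz a (1 / of_real gauss1) r x = of_real (wt x) * apply_bcontfun h x) \<and>
       0 < loss h \<and> 0 < gain \<sigma> h \<and> 0 < m \<and> ground_coeff r = 0 \<and>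
       (\<forall>x. r x = of_real m * h x - of_real \<delta> * cubic_term \<sigma> h x - of_real \<epsilon> * gain_term \<sigma> h x))"
    using profile_exists[OF assms(1) Sg assms(3) x0] by blast
  have pos: "0 < 2 / \<eta>" "0 < \<eta> / 2" using \<eta> by auto
  show ?thesis
  \<comment> \<open>The smallness \<eta> is shared evenly: \<alpha> > 2 / \<eta> and \<epsilon> <
    \<eta> / 2 give 1 / \<alpha> + \<epsilon> < \<eta>.\<close>
  proof (rule exI[of _ "2 / \<eta>"], rule conjI[OF pos(1)], rule exI[of _ "\<eta> / 2"], rule conjI[OF pos(2)], intro allI impI)
    fix \<epsilon> \<alpha> :: real assume "0 < \<epsilon> \<and> \<epsilon> < \<eta> / 2 \<and> 2 / \<eta> < \<alpha>"
    then have \<epsilon>: "0 < \<epsilon>" "\<epsilon> < \<eta> / 2" and \<alpha>: "2 / \<eta> < \<alpha>" by auto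
    have \<alpha>0: "0 < \<alpha>" using \<alpha> \<eta> by (meson divide_pos_pos less_trans zero_less_numeral)
    define \<delta> where "\<delta> = 1 / \<alpha>"
    have \<delta>: "0 < \<delta>" "\<delta> < \<eta> / 2" "\<alpha> * \<delta> = 1" using \<alpha> \<alpha>0 \<eta> by (auto simp: \<delta>_def field_simps)
    have "\<delta> + \<epsilon> < \<eta>" using \<delta> \<epsilon> by linarith
    from sol[OF \<delta>(1) \<epsilon>(1) this] obtain h a r M m where s: "bdd_by r M" "continuous_on UNIV r" "\<And>x. ansatz a (1 / of_real gauss1) r x = of_real (wt x) * apply_bcontfun h x"
       "0 < loss h" "0 < gain \<sigma> h" "0 < m" "ground_coeff r = 0"
       "\<And>x. r x = of_real m * h x - of_real \<delta> * cubic_term \<sigma> h x - of_real \<epsilon> * gain_term \<sigma> h x"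
      by blast
    define \<kappa> where "\<kappa> = sqrt (\<delta> * beta \<sigma> h)"
    have bp: "0 < beta \<sigma> h" using s(4,5) by (simp add: beta_def)
    have \<kappa>: "0 < \<kappa>" "\<kappa>\<^sup>2 = \<delta> * beta \<sigma> h" using \<delta> bp by (auto simp: \<kappa>_def)
    define U where "U = ansatz a (1 / of_real gauss1) r"
    have U: "U x = of_real (wt x) * h x" for x unfolding U_def by (rule s(3))
    have Ub: "norm (U x) \<le> norm h * wt x" for x
    proof -
      have "norm (U x) = wt x * norm (h x)" by (simp add: U norm_mult wt_nonneg)
      also have "\<dots> \<le> wt x * norm h" by (intro mult_left_mono norm_bounded wt_nonneg)
      finally show ?thesis by (simp only: mult.commute)
    qed
    have [measurable]: "\<sigma> \<in> borel_measurable borel" using assms(1) by (rule borel_measurable_continuous_onI)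
    have wr: "of_real (wt x) * r x = of_real m * U x - of_real (\<delta> * beta \<sigma> h * (norm (U x))\<^sup>2) * U x
        - \<i> * of_real \<epsilon> * (of_real (\<sigma> x - beta \<sigma> h * (norm (U x))\<^sup>2) * U x)" for x
      unfolding of_real_mult of_real_diff complex_norm_square[of "U x"] unfolding U s(8) cubic_term_def gain_term_def
      by (simp add: algebra_simps power2_eq_square)
    have GP: "GP_functional \<sigma> \<epsilon> \<alpha> (\<lambda>x. z * U x) v = of_real (2 + m) * L2_pairing (\<lambda>x. z * U x) v" if "norm z = \<kappa>" "v \<in> Sigma_space" for z v
      unfolding U_def
      by (rule stationary_of_profile[OF s(1,2) _ Sg Ub[unfolded U_def] s(7) wr[unfolded U_def] \<kappa>(2) \<delta>(3) that]) simp
    define Q where "Q x = of_real \<kappa> * U x" for x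
    have QS: "Q \<in> Sigma_space" unfolding Q_def[abs_def] U_def by (rule ansatz_scale_Sigma(1)[OF s(1)])
    show "\<exists>(Q :: real ^ 2 \<Rightarrow> complex) (\<mu> :: real). Q \<in> Sigma_space \<and> \<not> (AE x in lborel. Q x = 0) \<and> 2 < \<mu> \<and>
       solves_stationary \<sigma> \<epsilon> \<alpha> \<mu> Q \<and> solves_evolution \<sigma> \<epsilon> \<alpha> (\<lambda>t x. exp (- \<i> * of_real (t * \<mu>)) * Q x)"
    proof (intro exI[of _ Q] exI[of _ "2 + m"] conjI)
      show "Q \<in> Sigma_space" by fact
      show "2 < 2 + m" using s(6) by simp
      show "\<not> (AE x in lborel. Q x = 0)"
      proof
        assume "AE x in lborel. Q x = 0"
        \<comment> \<open>The integral of |U|^4 is \<open>loss h\<close>, whose positivity excludes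
          a vanishing Q.\<close>
        then have "AE x in lborel. wt x ^ 4 * (norm (h x)) ^ 4 = 0"
          by eventually_elim (use \<kappa>(1) wt_nz in \<open>auto simp: Q_def U\<close>)
        then have "loss h = 0" unfolding loss_def by (rule integral_eq_zero_AE)
        then show False using s(4) by simp
      qed
      show "solves_stationary \<sigma> \<epsilon> \<alpha> (2 + m) Q"
        unfolding solves_stationary_def using QS GP[of "of_real \<kappa>"] \<kappa>(1) by (auto simp: Q_def[abs_def])
      show "solves_evolution \<sigma> \<epsilon> \<alpha> (\<lambda>t x. exp (- \<i> * of_real (t * (2 + m))) * Q x)"
        unfolding Q_def U_def
        by (rule standing_wave_solves_evolution[OF s(1) GP[unfolded U_def]]) (use \<kappa>(1) in auto)
    qed
  qed
qed

end
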